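(* Let $S$ be an abelian topological inverse monoid whose idempotent semilattice $E=\{e\in S:ee=e\}$ is compact and zero-dimensional and whose maximal groups $H_e=\{x\in S:xx^{-1}=e=x^{-1}x\}$, $e\in E$, are all compact. Then the topological monoid $S$ is reflexive if and only if $S$ is compact.
   Context: All topological spaces are assumed Hausdorff. A monoid is a semigroup with a two-sided unit $1$; a topological monoid is a monoid endowed with a (Hausdorff) topology making the multiplication continuous. A semigroup $S$ is inverse if for each $x\in S$ there is a unique $x^{-1}\in S$ with $xx^{-1}x=x$ and $x^{-1}xx^{-1}=x^{-1}$; it is abelian if $xy=yx$ for all $x,y$. A topological inverse monoid is a monoid that is an inverse semigroup, endowed with a topology making both the multiplication and the inversion $x\mapsto x^{-1}$ continuous. In an inverse semigroup the set $E$ of idempotents is a semilattice (a commutative idempotent semigroup), called the idempotent semilattice; $E$ and the $H_e$ carry the subspace topology. A topological space is zero-dimensional if its closed-and-open subsets form a base of the topology. A monoid homomorphism $h:S\to M$ is a function with $h(1)=1$ and $h(xy)=h(x)h(y)$ for all $x,y\in S$. Let $\dot{\mathbb T}=\{z\in\mathbb C:|z|\in\{0,1\}\}$, with the multiplication of complex numbers and the topology inherited from $\mathbb C$. For a topological monoid $S$, the dual inverse monoid $S^{\odot}$ is the set of all continuous monoid homomorphisms $S\to\dot{\mathbb T}$, endowed with pointwise multiplication and the compact-open topology; it is again a topological monoid, and $S^{\odot\odot}=(S^{\odot})^{\odot}$. The canonical homomorphism is $\delta_S:S\to S^{\odot\odot}$, $\delta_S(x)(h)=h(x)$ for $x\in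 S$, $h\in S^{\odot}$. A topological monoid $S$ is reflexive if $\delta_S$ is a topological isomorphism (a monoid isomorphism that is a homeomorphism). *)

theory Defs
  imports "HOL-Analysis.Analysis" "HOL-Algebra.Group"
begin

record 'a top_monoid = "'a monoid" +
  topo :: "'a topology"

text \<open>Topological monoids are Hausdorff by convention.\<close>

locale topological_monoid = Group.monoid S for S :: "'a top_monoid" (structure) +
  assumes topspace_eq: "topspace (topo S) = carrier S"
    and Hausdorff: "Hausdorff_space (topo S)"
    and continuous_mult:
      "continuous_map (prod_topology (topo S) (topo S)) (topo S) (\<lambda>(x, y). x \<otimes> y)"

text \<open>The constant \<open>m_inv\<close> of the library is the inverse with respect to the unit,
  so the inversion of an inverse semigroup needs its own constant.\<close>

definition is_sg_inverse :: "('a, 'b) monoid_scheme \<Rightarrow> 'a \<Rightarrow> 'a \<Rightarrow> bool" where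
  "is_sg_inverse S x y \<longleftrightarrow>
     y \<in> carrier S \<and> x \<otimes>\<^bsub>S\<^esub> y \<otimes>\<^bsub>S\<^esub> x = x \<and> y \<otimes>\<^bsub>S\<^esub> x \<otimes>\<^bsub>S\<^esub> y = y"

definition sg_inv :: "('a, 'b) monoid_scheme \<Rightarrow> 'a \<Rightarrow> 'a" where
  "sg_inv S x = (THE y. is_sg_inverse S x y)"

locale topological_inverse_monoid = topological_monoid S for S :: "'a top_monoid" (structure) +
  assumes unique_inverse: "x \<in> carrier S \<Longrightarrow> \<exists>!y. is_sg_inverse S x y"
    and continuous_inverse: "continuous_map (topo S) (topo S) (sg_inv S)"

definition idempotents :: "('a, 'b) monoid_scheme \<Rightarrow> 'a set" where
  "idempotents S = {e \<in> carrier S. e \<otimes>\<^bsub>S\<^esub> e = e}"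

definition maximal_group :: "('a, 'b) monoid_scheme \<Rightarrow> 'a \<Rightarrow> 'a set" where
  "maximal_group S e =
     {x \<in> carrier S. x \<otimes>\<^bsub>S\<^esub> sg_inv S x = e \<and> sg_inv S x \<otimes>\<^bsub>S\<^esub> x = e}"

definition zero_dimensional_space :: "'a topology \<Rightarrow> bool" where
  "zero_dimensional_space X \<longleftrightarrow>
     (\<forall>U x. openin X U \<and> x \<in> U \<longrightarrow> (\<exists>V. openin X V \<and> closedin X V \<and> x \<in> V \<and> V \<subseteq> U))"

text \<open>Unlike for groups, preservation of the unit is not implied by membership in \<open>hom\<close>.\<close>

definition monoid_hom ::
    "('a, 'c) monoid_scheme \<Rightarrow> ('b, 'd) monoid_scheme \<Rightarrow> ('a \<Rightarrow> 'b) set" where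
  "monoid_hom S M = {h \<in> hom S M. h \<one>\<^bsub>S\<^esub> = \<one>\<^bsub>M\<^esub>}"

definition topological_iso :: "'a top_monoid \<Rightarrow> 'b top_monoid \<Rightarrow> ('a \<Rightarrow> 'b) \<Rightarrow> bool" where
  "topological_iso S M h \<longleftrightarrow>
     h \<in> monoid_hom S M \<and> h \<in> iso S M \<and> homeomorphic_map (topo S) (topo M) h"

definition T_dot :: "complex top_monoid" where
  "T_dot = \<lparr>carrier = {z. cmod z \<in> {0, 1}}, mult = (*), one = 1,
            topo = top_of_set {z. cmod z \<in> {0, 1}}\<rparr>"

definition compact_open_topology ::
    "'a topology \<Rightarrow> 'b topology \<Rightarrow> ('a \<Rightarrow> 'b) set \<Rightarrow> ('a \<Rightarrow> 'b) topology" where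
  "compact_open_topology X Y F =
     topology_generated_by {{f \<in> F. f ` K \<subseteq> U} | K U. compactin X K \<and> openin Y U}"

text \<open>Functions on \<open>carrier S\<close> are represented by functions that are \<open>undefined\<close> outside
  \<open>carrier S\<close>, so that equality of elements of the dual is equality on \<open>carrier S\<close>.\<close>

definition characters :: "'a top_monoid \<Rightarrow> ('a \<Rightarrow> complex) set" where
  "characters S =
     {h \<in> monoid_hom S T_dot. h \<in> extensional (carrier S) \<and>
        continuous_map (topo S) (topo T_dot) h}"

definition dual_monoid :: "'a top_monoid \<Rightarrow> ('a \<Rightarrow> complex) top_monoid" where
  "dual_monoid S =
     \<lparr>carrier = characters S,
      mult = (\<lambda>f g. \<lambda>x\<in>carrier S. f x \<otimes>\<^bsub>T_dot\<^esub> g x),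
      one = (\<lambda>x\<in>carrier S. \<one>\<^bsub>T_dot\<^esub>),
      topo = compact_open_topology (topo S) (topo T_dot) (characters S)\<rparr>"

definition canonical_hom :: "'a top_monoid \<Rightarrow> 'a \<Rightarrow> (('a \<Rightarrow> complex) \<Rightarrow> complex)" where
  "canonical_hom S x = (\<lambda>h\<in>carrier (dual_monoid S). h x)"

definition reflexive_monoid :: "'a top_monoid \<Rightarrow> bool" where
  "reflexive_monoid S \<longleftrightarrow>
     topological_iso S (dual_monoid (dual_monoid S)) (canonical_hom S)"

lemma topspace_compact_open_topology [simp]:
  "topspace (compact_open_topology X Y F) = F"
proof -
  have "F \<in> {{f \<in> F. f ` K \<subseteq> U} | K U. compactin X K \<and> openin Y U}"
    by (intro CollectI exI[of _ "{}"]) auto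
  then show ?thesis
    unfolding compact_open_topology_def topology_generated_by_topspace by auto
qed

end

theory Submission
  imports Defs "HOL-Real_Asymp.Real_Asymp"
begin

text \<open>
  A character \<open>h\<close> of \<open>S\<close> is determined by its values on the compact set \<open>E\<close> and on the compact group
  \<open>H\<^sub>m\<close>, where \<open>m\<close> is the least idempotent with \<open>h m = 1\<close>. The circle has no small subgroups, so
  the dual of \<open>S\<close> is discrete, and its dual is a closed subspace of a power of the compact monoid
  \<open>{0} \<union> \<T>\<close>. Hence the double dual is always compact, and a reflexive \<open>S\<close> is compact.

  If \<open>S\<close> is compact, then \<open>\<delta>\<close> is a continuous map from a compact to a Hausdorff space, so it
  suffices that it is bijective. Injectivity: idempotents \<open>m\<close> with open principal filter are dense
  from below in the zero-dimensional semilattice \<open>E\<close>, and characters of \<open>H\<^sub>m\<close> extend to \<open>S\<close>, which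
  reduces the claim to compact abelian groups. There finite averages of translates give an invariant
  mean, and a sequence of positive definite functions maximising a suitable convolution form clusters
  at a character. Surjectivity: by compactness it suffices to approximate a homomorphism on finitely
  many characters, which a Kronecker-type counting argument does.
\<close>

section \<open>Invariant means on compact abelian groups\<close>

text \<open>For a compact group, the limit of a maximising sequence is a character because it is
  extremal: \<open>4 p\<close> splits into two positive definite functions built from translates of
  \<open>p\<close>, and maximality forces both summands to have nearly proportional correlations.
  The maximum need not be attained among the continuous functions at hand, so everything is done up
  to an error that tends to 0. The form depends on the point \<open>b\<close> that is to be
  separated from the unit: its kernel is orthogonal to \<open>b\<close>-invariant functions, which
  keeps the limit from being trivial at \<open>b\<close>. For the monoid, the value 0 is the
  obstacle, on both sides of the duality. Write m \<le> e for m e = m. A character of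
  \<open>S\<close> is 1 exactly on the idempotents above its least one \<open>m\<close>, so this
  filter has to be open, and zero-dimensionality has to supply enough such \<open>m\<close>. A
  homomorphism on the dual may vanish as well; an idempotent of \<open>S\<close> with the right
  pattern of zeros is found separately, and only unimodular values are left to approximate. There
  the points form a semigroup without inverses, so that averages run over nonnegative powers
  only.\<close>

lemma continuous_map_binop:
  assumes "continuous_map X euclidean f" "continuous_map X euclidean g"
    and "continuous_on UNIV (\<lambda>p. h (fst p) (snd p))"
  shows "continuous_map X euclidean (\<lambda>x. h (f x) (g x))"
proof -
  have "continuous_map X (prod_topology euclidean euclidean) (\<lambda>x. (f x, g x))"
    using assms(1,2) by (rule continuous_map_pairedI)
  then have "continuous_map X euclidean (\<lambda>x. (f x, g x))"
    by simp
  from continuous_map_compose[OF this, of euclidean "\<lambda>p. h (fst p) (snd p)"] show ?thesis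
    using assms(3) by (simp add: o_def)
qed

lemma continuous_map_unop:
  assumes "continuous_map X euclidean f" and "continuous_on UNIV h"
  shows "continuous_map X euclidean (\<lambda>x. h (f x))"
  using continuous_map_compose[OF assms(1), of euclidean h] assms(2) by (simp add: o_def)

locale compact_abelian_group = comm_group G for G :: "('a,'b) monoid_scheme" (structure) +
  fixes X :: "'a topology"
  assumes topspace_carrier: "topspace X = carrier G"
    and compact: "compact_space X"
    and Hausdorff: "Hausdorff_space X"
    and continuous_mult: "continuous_map (prod_topology X X) X (\<lambda>(x, y). x \<otimes> y)"
    and continuous_inv: "continuous_map X X (\<lambda>x. inv x)"
begin

section \<open>Finite averages of translates and the constants that they approximate\<close>

lemma scaleR_sum_list: "r *\<^sub>R (\<Sum>x\<leftarrow>xs. f x) = (\<Sum>x\<leftarrow>xs. r *\<^sub>R f x)"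
  for f :: "'d \<Rightarrow> 'c::real_vector"
  by (induction xs) (simp_all add: scaleR_add_right)

text \<open>Lists are used rather than finite sets: products of translates may coincide and must be
  counted with multiplicity for an iterated average to be an average again.\<close>

definition average :: "'a list \<Rightarrow> ('a \<Rightarrow> 'c::real_vector) \<Rightarrow> 'a \<Rightarrow> 'c" where
  "average as f x = (1 / real (length as)) *\<^sub>R (\<Sum>a\<leftarrow>as. f (a \<otimes> x))"

definition translates :: "'a list \<Rightarrow> bool" where
  "translates as \<longleftrightarrow> as \<noteq> [] \<and> set as \<subseteq> carrier G"

definition products :: "'a list \<Rightarrow> 'a list \<Rightarrow> 'a list" where
  "products as bs = concat (map (\<lambda>a. map (\<lambda>b. a \<otimes> b) bs) as)"

lemma translates_products: "translates as \<Longrightarrow> translates bs \<Longrightarrow> translates (products as bs)"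
  by (auto simp: translates_def products_def neq_Nil_conv)

lemma average_products:
  assumes "translates as" "translates bs" "x \<in> carrier G"
  shows "average (products as bs) f x = average as (average bs f) x"
proof -
  have len: "length (products as bs) = length as * length bs"
    unfolding products_def by (induction as) auto
  have eq: "(\<Sum>p\<leftarrow>products as bs. f (p \<otimes> x)) = (\<Sum>a\<leftarrow>as. \<Sum>b\<leftarrow>bs. f (b \<otimes> (a \<otimes> x)))"
    if "set as \<subseteq> carrier G" for as
    using that
  proof (induction as)
    case (Cons a as)
    have "(a \<otimes> b) \<otimes> x = b \<otimes> (a \<otimes> x)" if "b \<in> set bs" for b
    proof -
      have "b \<in> carrier G" using that assms(2) by (auto simp: translates_def)
      then show ?thesis using Cons.prems assms(3) by (simp add: m_ac)
    qed
    then have "(\<Sum>b\<leftarrow>bs. f ((a \<otimes> b) \<otimes> x)) = (\<Sum>b\<leftarrow>bs. f (b \<otimes> (a \<otimes> x)))"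
      by (intro arg_cong[of _ _ sum_list] map_cong) auto
    moreover have "(\<Sum>p\<leftarrow>products (a # as) bs. f (p \<otimes> x))
        = (\<Sum>b\<leftarrow>bs. f ((a \<otimes> b) \<otimes> x)) + (\<Sum>p\<leftarrow>products as bs. f (p \<otimes> x))"
      by (simp add: products_def o_def)
    ultimately show ?case
      using Cons.IH Cons.prems by (simp only: list.simps sum_list.Cons insert_subset)
  qed (simp add: products_def)
  show ?thesis
    using eq assms len unfolding average_def translates_def
    by (simp add: scaleR_sum_list)
qed

text \<open>An average is a convex combination of values. All later bounds on averages are
  instances, with points, balls and half-lines as \<open>C\<close>.\<close>

lemma average_in_convex:
  assumes "convex C" "translates as" "\<And>a. a \<in> set as \<Longrightarrow> f (a \<otimes> x) \<in> C"
  shows "average as f x \<in> C"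
proof -
  have "average as f x = (\<Sum>i<length as. (1 / real (length as)) *\<^sub>R f (as ! i \<otimes> x))"
    unfolding average_def
    by (simp add: sum_list_sum_nth atLeast0LessThan scaleR_right.sum)
  also have "\<dots> \<in> C"
    using assms(2) by (intro convex_sum assms) (auto simp: translates_def)
  finally show ?thesis .
qed

lemma average_const: "translates as \<Longrightarrow> average as (\<lambda>x. c) x = c"
  using average_in_convex[of "{c}" as "\<lambda>x. c"] by auto

lemma average_add: "average as (\<lambda>x. f x + g x) x = average as f x + average as g x"
  unfolding average_def by (simp add: sum_list_addf scaleR_add_right)

lemma average_linear:
  assumes "linear h"
  shows "average as (\<lambda>x. h (f x)) x = h (average as f x)"
proof -
  have "(\<Sum>a\<leftarrow>as. h (f (a \<otimes> x))) = h (\<Sum>a\<leftarrow>as. f (a \<otimes> x))"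
    by (induction as) (simp_all add: linear_0[OF assms] linear_add[OF assms])
  then show ?thesis
    unfolding average_def by (simp add: linear_scale[OF assms])
qed

lemma average_translate:
  assumes "translates as" "b \<in> carrier G" "x \<in> carrier G"
  shows "average as (\<lambda>x. f (b \<otimes> x)) x = average as f (b \<otimes> x)"
proof -
  have "map (\<lambda>a. f (b \<otimes> (a \<otimes> x))) as = map (\<lambda>a. f (a \<otimes> (b \<otimes> x))) as"
    using assms by (intro map_cong refl arg_cong[of _ _ f])
      (auto simp: translates_def m_lcomm subsetD)
  then show ?thesis
    unfolding average_def by (simp del: map_eq_conv)
qed

lemma average_close:
  fixes f :: "'a \<Rightarrow> 'c::real_normed_vector"
  assumes "translates as" "x \<in> carrier G" "\<And>x. x \<in> carrier G \<Longrightarrow> norm (f x - c) \<le> e"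
  shows "norm (average as f x - c) \<le> e"
  using average_in_convex[of "cball c e" as f x] assms
  by (simp add: translates_def dist_norm norm_minus_commute[of c] subset_iff)

lemma average_commute:
  assumes "translates as" "translates bs" "x \<in> carrier G"
  shows "average as (average bs f) x = average bs (average as f) x"
proof -
  have sw: "(\<Sum>a\<leftarrow>as. \<Sum>b\<leftarrow>bs. g a b) = (\<Sum>b\<leftarrow>bs. \<Sum>a\<leftarrow>as. g a b)" for g :: "'a \<Rightarrow> 'a \<Rightarrow> 'c"
    by (simp add: sum_list_sum_nth sum.swap[of _ "{0..<length as}"])
  have "(\<Sum>a\<leftarrow>as. \<Sum>b\<leftarrow>bs. f (b \<otimes> (a \<otimes> x))) = (\<Sum>a\<leftarrow>as. \<Sum>b\<leftarrow>bs. f (a \<otimes> (b \<otimes> x)))"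
    using assms
    by (intro arg_cong[of _ _ sum_list] map_cong refl arg_cong[of _ _ f])
      (auto simp: translates_def m_lcomm subsetD)
  also have "\<dots> = (\<Sum>b\<leftarrow>bs. \<Sum>a\<leftarrow>as. f (a \<otimes> (b \<otimes> x)))"
    by (rule sw)
  finally show ?thesis
    unfolding average_def by (simp add: scaleR_sum_list[symmetric] mult.commute)
qed

text \<open>The mean in the sense of von Neumann: a constant that is a uniform limit of averages of
  translates. On continuous functions it is the normalised Haar integral, obtained without measure
  theory.\<close>

definition has_mean :: "('a \<Rightarrow> complex) \<Rightarrow> complex \<Rightarrow> bool" where
  "has_mean f c \<longleftrightarrow>
     (\<forall>e>0. \<exists>as. translates as \<and> (\<forall>x\<in>carrier G. norm (average as f x - c) \<le> e))"

definition mean :: "('a \<Rightarrow> complex) \<Rightarrow> complex" where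
  "mean f = (THE c. has_mean f c)"

lemma has_meanD:
  assumes "has_mean f c" "e > 0"
  shows "\<exists>as. translates as \<and> (\<forall>x\<in>carrier G. norm (average as f x - c) \<le> e)"
  using assms unfolding has_mean_def by blast

text \<open>Applying each averaging operator to the other average keeps both estimates, and the two
  iterated averages coincide by \<open>average_commute\<close>. This yields the uniqueness of the
  mean as well as the Cauchy property of approximate means.\<close>

lemma averages_close:
  assumes "translates as" "translates bs"
    and "\<And>x. x \<in> carrier G \<Longrightarrow> norm (average as f x - c) \<le> e"
    and "\<And>x. x \<in> carrier G \<Longrightarrow> norm (average bs f x - d) \<le> e'"
  shows "norm (c - d) \<le> e + e'"
proof -
  have "norm (average bs (average as f) \<one> - c) \<le> e"
    by (rule average_close[OF assms(2) one_closed assms(3)])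
  moreover have "norm (average as (average bs f) \<one> - d) \<le> e'"
    by (rule average_close[OF assms(1) one_closed assms(4)])
  moreover have "norm (c - d) \<le> norm (c - y) + norm (y - d)" for y
    using norm_triangle_ineq[of "c - y" "y - d"] by simp
  ultimately show ?thesis
    using average_commute[OF assms(1,2) one_closed, of f]
    by (metis add_mono norm_minus_commute order_trans)
qed

lemma has_mean_unique: "has_mean f c \<Longrightarrow> has_mean f d \<Longrightarrow> c = d"
proof (rule ccontr)
  assume cd: "has_mean f c" "has_mean f d" "c \<noteq> d"
  define e where "e = norm (c - d) / 3"
  have "e > 0" using cd by (simp add: e_def)
  obtain as where as: "translates as" "\<And>x. x \<in> carrier G \<Longrightarrow> norm (average as f x - c) \<le> e"
    using has_meanD[OF cd(1) \<open>e > 0\<close>] by blast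
  obtain bs where bs: "translates bs" "\<And>x. x \<in> carrier G \<Longrightarrow> norm (average bs f x - d) \<le> e"
    using has_meanD[OF cd(2) \<open>e > 0\<close>] by blast
  have "norm (c - d) \<le> e + e" by (rule averages_close[OF as(1) bs(1) as(2) bs(2)])
  then show False using \<open>e > 0\<close> by (simp add: e_def)
qed

lemma mean_eqI: "has_mean f c \<Longrightarrow> mean f = c"
  unfolding mean_def using has_mean_unique by blast

text \<open>Averages of \<open>f\<close> lie in \<open>C\<close> and approach \<open>c\<close>.
  Half-planes give positivity of the mean, discs its norm bound.\<close>

lemma has_mean_in_closed_convex:
  assumes "has_mean f c" "convex C" "closed C" "\<And>x. x \<in> carrier G \<Longrightarrow> f x \<in> C"
  shows "c \<in> C"
proof -
  have "\<exists>y\<in>C. dist y c < e" if "e > 0" for e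
  proof -
    obtain as where as: "translates as" "\<And>x. x \<in> carrier G \<Longrightarrow> norm (average as f x - c) \<le> e/2"
      using has_meanD[OF assms(1) half_gt_zero[OF \<open>e > 0\<close>]] by blast
    have "average as f \<one> \<in> C"
      using as(1) assms by (intro average_in_convex) (auto simp: translates_def)
    moreover have "dist (average as f \<one>) c < e"
      using as(2)[of \<one>] that by (simp add: dist_norm)
    ultimately show ?thesis by blast
  qed
  then show ?thesis
    using assms(3) by (metis closure_approachable closure_closed)
qed

text \<open>One list has to serve both functions. Further averaging keeps a function near its
  constant, so the products of the two lists will do.\<close>

lemma has_mean_add:
  assumes "has_mean f c" "has_mean g d"
  shows "has_mean (\<lambda>x. f x + g x) (c + d)"
  unfolding has_mean_def
proof (intro allI impI)
  fix e :: real assume e: "e > 0"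
  obtain as where as: "translates as" "\<And>x. x \<in> carrier G \<Longrightarrow> norm (average as f x - c) \<le> e/2"
    using has_meanD[OF assms(1) half_gt_zero[OF e]] by blast
  obtain bs where bs: "translates bs" "\<And>x. x \<in> carrier G \<Longrightarrow> norm (average bs g x - d) \<le> e/2"
    using has_meanD[OF assms(2) half_gt_zero[OF e]] by blast
  have "norm (average (products as bs) (\<lambda>x. f x + g x) x - (c + d)) \<le> e" if x: "x \<in> carrier G" for x
  proof -
    have le: "norm (average bs (average as f) x - c) \<le> e/2" "norm (average as (average bs g) x - d) \<le> e/2"
      using average_close[OF bs(1) x] average_close[OF as(1) x] as(2) bs(2) by blast+
    have eq: "average (products as bs) (\<lambda>x. f x + g x) x - (c + d)
        = (average bs (average as f) x - c) + (average as (average bs g) x - d)"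
      unfolding average_add average_products[OF as(1) bs(1) x] average_commute[OF as(1) bs(1) x, of f]
      by simp
    show ?thesis
      unfolding eq by (rule order_trans[OF norm_triangle_ineq]) (use le in simp)
  qed
  then show "\<exists>as. translates as \<and> (\<forall>x\<in>carrier G. norm (average as (\<lambda>x. f x + g x) x - (c + d)) \<le> e)"
    using translates_products[OF as(1) bs(1)] by blast
qed

lemma has_mean_bounded_linear:
  assumes "has_mean f c" "bounded_linear h"
  shows "has_mean (\<lambda>x. h (f x)) (h c)"
  unfolding has_mean_def
proof (intro allI impI)
  fix e :: real assume e: "e > 0"
  interpret bounded_linear h by fact
  obtain K where K: "K > 0" "\<And>x. norm (h x) \<le> norm x * K"
    using pos_bounded by blast
  obtain as where as: "translates as" "\<And>x. x \<in> carrier G \<Longrightarrow> norm (average as f x - c) \<le> e/K"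
    using has_meanD[OF assms(1) divide_pos_pos[OF e K(1)]] by blast
  have "norm (average as (\<lambda>x. h (f x)) x - h c) \<le> e" if x: "x \<in> carrier G" for x
  proof -
    have "norm (average as (\<lambda>x. h (f x)) x - h c) = norm (h (average as f x - c))"
      by (simp add: average_linear[OF linear_axioms] diff)
    also have "\<dots> \<le> (e/K) * K"
      using K as(2)[OF x] by (meson mult_right_mono less_imp_le order_trans)
    finally show ?thesis using K by simp
  qed
  then show "\<exists>as. translates as \<and> (\<forall>x\<in>carrier G. norm (average as (\<lambda>x. h (f x)) x - h c) \<le> e)"
    using as(1) by blast
qed

lemma has_mean_translate:
  assumes "has_mean f c" "b \<in> carrier G"
  shows "has_mean (\<lambda>x. f (b \<otimes> x)) c"
  using assms unfolding has_mean_def by (metis average_translate m_closed)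

lemma has_mean_cong:
  assumes "\<And>x. x \<in> carrier G \<Longrightarrow> f x = g x"
  shows "has_mean f c = has_mean g c"
proof -
  have "average as f x = average as g x" if "translates as" "x \<in> carrier G" for as x
    using that assms unfolding average_def translates_def
    by (intro arg_cong[of _ _ "scaleR _"] arg_cong[of _ _ sum_list] map_cong) auto
  then show ?thesis unfolding has_mean_def by (intro all_cong1 imp_cong ex_cong1 refl conj_cong ball_cong) auto
qed

lemma has_mean_const: "has_mean (\<lambda>x. c) c"
  unfolding has_mean_def
proof (intro allI impI exI[of _ "[\<one>]"] conjI ballI)
  show "translates [\<one>]" by (simp add: translates_def)
  then show "norm (average [\<one>] (\<lambda>x. c) x - c) \<le> e" if "e > 0" for e x
    using that by (simp add: average_const)
qed

section \<open>Existence of the mean of a continuous function\<close>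

lemma continuous_translate: "b \<in> carrier G \<Longrightarrow> continuous_map X X (\<lambda>x. b \<otimes> x)"
proof -
  assume "b \<in> carrier G"
  then have "continuous_map X (prod_topology X X) (\<lambda>x. (b, x))"
    by (intro continuous_map_pairedI) (auto simp: topspace_carrier)
  from continuous_map_compose[OF this continuous_mult] show ?thesis
    by (simp add: o_def)
qed

lemma continuous_map_translate:
  assumes "continuous_map X Y f" "b \<in> carrier G"
  shows "continuous_map X Y (\<lambda>x. f (b \<otimes> x))"
  using continuous_map_compose[OF continuous_translate[OF assms(2)] assms(1)] by (simp add: o_def)

lemma continuous_map_rtranslate:
  assumes "continuous_map X Y f" "b \<in> carrier G"
  shows "continuous_map X Y (\<lambda>x. f (x \<otimes> b))"
proof (rule continuous_map_eq)
  show "continuous_map X Y (\<lambda>x. f (b \<otimes> x))"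
    by (rule continuous_map_translate[OF assms])
qed (use assms in \<open>simp add: topspace_carrier m_comm\<close>)

text \<open>The pairs (u, x) for which \<open>f\<close> differs by less than \<open>e\<close> at u x
  and at x form an open set containing {1} \<times> G, and compactness of the group provides a tube
  inside it.\<close>

lemma uniformly_continuous:
  fixes f :: "'a \<Rightarrow> 'c::real_normed_vector"
  assumes "continuous_map X euclidean f" "e > 0"
  shows "\<exists>U. openin X U \<and> \<one> \<in> U \<and> (\<forall>u\<in>U. \<forall>x\<in>carrier G. norm (f (u \<otimes> x) - f x) < e)"
proof -
  let ?P = "prod_topology X X"
  let ?d = "\<lambda>p. norm (f (case p of (x, y) \<Rightarrow> x \<otimes> y) - f (snd p))"
  have "continuous_map ?P euclidean (\<lambda>p. f (case p of (x, y) \<Rightarrow> x \<otimes> y))"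
    using continuous_map_compose[OF continuous_mult assms(1)] by (simp add: o_def)
  moreover have "continuous_map ?P euclidean (\<lambda>p. f (snd p))"
    using continuous_map_compose[OF continuous_map_snd assms(1)] by (simp add: o_def)
  ultimately have "continuous_map ?P euclidean ?d"
    by (intro continuous_map_binop[where h = "\<lambda>x y. norm (x - y)"] continuous_intros) auto
  then have W: "openin ?P {p \<in> topspace ?P. ?d p \<in> {..<e}}"
    by (rule openin_continuous_map_preimage) auto
  have sub: "{\<one>} \<times> carrier G \<subseteq> {p \<in> topspace ?P. ?d p \<in> {..<e}}"
    using \<open>e > 0\<close> by (auto simp: topspace_carrier)
  have "compactin X (carrier G)"
    using compact by (simp add: compact_space_def topspace_carrier)
  from tube_lemma_right[OF W this _ sub] obtain U V where
    "openin X U" "openin X V" "\<one> \<in> U" "carrier G \<subseteq> V"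
    "U \<times> V \<subseteq> {p \<in> topspace ?P. ?d p \<in> {..<e}}"
    by (auto simp: topspace_carrier)
  then show ?thesis
    by (intro exI[of _ U]) fastforce
qed

text \<open>Translation by v inv x carries x to a fixed point v of \<open>V\<close>, so the
  preimages of \<open>V\<close> under translations cover the compact group.\<close>

lemma finite_translates_cover:
  assumes "openin X V" "V \<noteq> {}"
  shows "\<exists>as. translates as \<and> (\<forall>x\<in>carrier G. \<exists>a\<in>set as. a \<otimes> x \<in> V)"
proof -
  obtain v where v: "v \<in> V" "v \<in> carrier G"
    using assms openin_subset topspace_carrier by blast
  let ?S = "\<lambda>a. {x \<in> topspace X. a \<otimes> x \<in> V}"
  have "\<forall>W \<in> ?S ` carrier G. openin X W"
    using openin_continuous_map_preimage[OF continuous_translate assms(1)] by blast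
  moreover have "topspace X \<subseteq> \<Union>(?S ` carrier G)"
  proof
    fix x assume x: "x \<in> topspace X"
    then have "(v \<otimes> inv x) \<otimes> x = v"
      using v by (simp add: topspace_carrier m_assoc)
    then show "x \<in> \<Union>(?S ` carrier G)"
      using x v by (auto simp: topspace_carrier intro!: bexI[of _ "v \<otimes> inv x"])
  qed
  ultimately obtain F where F: "finite F" "F \<subseteq> ?S ` carrier G" "topspace X \<subseteq> \<Union>F"
    using compact unfolding compact_space_alt by meson
  then obtain A where A: "A \<subseteq> carrier G" "finite A" "F = ?S ` A"
    by (meson finite_subset_image)
  obtain as where as: "set as = A"
    using A(2) finite_list by blast
  have cov: "\<forall>x\<in>carrier G. \<exists>a\<in>set as. a \<otimes> x \<in> V"
    using F(3) A as by (auto simp: topspace_carrier)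
  then have "translates as"
    using A as one_closed unfolding translates_def by force
  with cov show ?thesis by blast
qed

lemma average_ge: "translates as \<Longrightarrow> x \<in> carrier G \<Longrightarrow> (\<And>x. x \<in> carrier G \<Longrightarrow> l \<le> f x) \<Longrightarrow> l \<le> average as f x"
  and average_le: "translates as \<Longrightarrow> x \<in> carrier G \<Longrightarrow> (\<And>x. x \<in> carrier G \<Longrightarrow> f x \<le> u) \<Longrightarrow> average as f x \<le> u"
  for f :: "'a \<Rightarrow> real"
  using average_in_convex[of "{l..}" as f x] average_in_convex[of "{..u}" as f x]
  by (auto simp: translates_def subset_iff)

text \<open>A single term lies \<open>d\<close> below the bound \<open>u\<close>, and its weight in
  the average is 1 / \<open>length as\<close>.\<close>

lemma average_le_one_small:
  fixes f :: "'a \<Rightarrow> real"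
  assumes "translates as" "x \<in> carrier G" "\<And>x. x \<in> carrier G \<Longrightarrow> f x \<le> u"
    and "a \<in> set as" "f (a \<otimes> x) \<le> u - d"
  shows "average as f x \<le> u - d / real (length as)"
proof -
  obtain i where i: "i < length as" "as ! i = a"
    using assms(4) by (auto simp: in_set_conv_nth)
  have "(\<Sum>a\<leftarrow>as. f (a \<otimes> x)) = (\<Sum>j<length as. f (as ! j \<otimes> x))"
    by (simp add: sum_list_sum_nth atLeast0LessThan)
  also have "\<dots> \<le> (\<Sum>j<length as. u - (if j = i then d else 0))"
  proof (rule sum_mono)
    fix j assume "j \<in> {..<length as}"
    then have "as ! j \<otimes> x \<in> carrier G"
      using assms(1,2) by (auto simp: translates_def subsetD)
    then show "f (as ! j \<otimes> x) \<le> u - (if j = i then d else 0)"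
      using assms(3,5) i by auto
  qed
  also have "\<dots> = real (length as) * u - d"
    using i by (simp add: sum_subtractf)
  finally have "average as f x \<le> (1 / real (length as)) * (real (length as) * u - d)"
    unfolding average_def by (simp add: divide_right_mono)
  also have "\<dots> = u - d / real (length as)"
    using assms(1) by (simp add: translates_def field_simps)
  finally show ?thesis .
qed

text \<open>A modulus of continuity survives averaging, so one neighbourhood and one list of
  translates serve all rounds of the iteration in \<open>small_oscillation\<close>.\<close>

lemma average_uniformly_continuous:
  fixes f :: "'a \<Rightarrow> 'c::real_normed_vector"
  assumes "translates bs" "u \<in> carrier G" "\<forall>x\<in>carrier G. norm (f (u \<otimes> x) - f x) \<le> e"
    and "x \<in> carrier G"
  shows "norm (average bs f (u \<otimes> x) - average bs f x) \<le> e"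
proof -
  have "average bs f (u \<otimes> x) - average bs f x = average bs (\<lambda>x. f (u \<otimes> x) + - f x) x"
    unfolding average_add average_translate[OF assms(1,2,4)]
    by (simp add: average_linear[of uminus] linear_uminus)
  then show ?thesis
    using average_close[OF assms(1,4), of "\<lambda>x. f (u \<otimes> x) + - f x" 0 e] assms(3) by simp
qed

text \<open>If \<open>f\<close> is at most the midpoint of [l, h] at some x0, then every x has a
  translate in U x0, where \<open>f\<close> exceeds the midpoint by at most \<open>e\<close>; this
  one term lowers the upper bound of the average. Otherwise \<open>f\<close> is above the midpoint
  everywhere and the lower bound rises to it. The weaker gain, that of the first case, gives the
  common contraction factor.\<close>

lemma oscillation_step:
  fixes f :: "'a \<Rightarrow> real"
  assumes U: "U \<subseteq> carrier G" "\<And>u x. u \<in> U \<Longrightarrow> x \<in> carrier G \<Longrightarrow> \<bar>f (u \<otimes> x) - f x\<bar> \<le> e"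
    and as: "translates as" "\<And>x. x \<in> carrier G \<Longrightarrow> \<exists>a\<in>set as. a \<otimes> x \<in> U"
    and f: "\<And>x. x \<in> carrier G \<Longrightarrow> l \<le> f x \<and> f x \<le> h" and "e \<ge> 0"
  shows "\<exists>l' h'. (\<forall>x\<in>carrier G. l' \<le> average as f x \<and> average as f x \<le> h') \<and>
    h' - l' \<le> (1 - 1 / (2 * real (length as))) * (h - l) + e / real (length as)"
proof (cases "\<exists>x0\<in>carrier G. f x0 \<le> (l + h) / 2")
  case True
  then obtain x0 where x0: "x0 \<in> carrier G" "f x0 \<le> (l + h) / 2" by blast
  have "average as f x \<le> h - ((h - l) / 2 - e) / real (length as)" if x: "x \<in> carrier G" for x
  proof -
    obtain a where a: "a \<in> set as" "a \<otimes> (x \<otimes> inv x0) \<in> U"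
      using as(2)[of "x \<otimes> inv x0"] x x0 by auto
    have aG: "a \<in> carrier G"
      using a(1) as(1) by (auto simp: translates_def)
    have "(a \<otimes> (x \<otimes> inv x0)) \<otimes> x0 = a \<otimes> x"
      using aG x x0 by (simp add: m_assoc)
    then have "f (a \<otimes> x) \<le> f x0 + e"
      using U(2)[OF a(2) x0(1)] by simp
    then have "f (a \<otimes> x) \<le> h - ((h - l) / 2 - e)"
      using x0(2) by (simp add: field_simps)
    then show ?thesis
      using average_le_one_small[OF as(1) x _ a(1)] f by blast
  qed
  moreover have "l \<le> average as f x" if "x \<in> carrier G" for x
    using average_ge[OF as(1) that] f by blast
  moreover have "real (length as) > 0"
    using as(1) by (simp add: translates_def)
  then have "h - ((h - l) / 2 - e) / real (length as) - l
      \<le> (1 - 1 / (2 * real (length as))) * (h - l) + e / real (length as)"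
    by (simp add: field_simps)
  ultimately show ?thesis by blast
next
  case False
  have 1: "(l + h) / 2 \<le> average as f x" if "x \<in> carrier G" for x
    using False by (intro average_ge[OF as(1) that]) force
  have 2: "average as f x \<le> h" if "x \<in> carrier G" for x
    using average_le[OF as(1) that] f by blast
  have n: "real (length as) \<ge> 1"
    using as(1) by (cases as) (auto simp: translates_def)
  have "l \<le> h"
    using f[OF one_closed] by simp
  have "1 / (2 * real (length as)) \<le> 1/2"
    using n by (intro frac_le) auto
  then have "(1/2) * (h - l) \<le> (1 - 1 / (2 * real (length as))) * (h - l)"
    using \<open>l \<le> h\<close> by (intro mult_right_mono) auto
  moreover have "e / real (length as) \<ge> 0"
    using \<open>e \<ge> 0\<close> by simp
  ultimately have "h - (l + h) / 2 \<le> (1 - 1 / (2 * real (length as))) * (h - l) + e / real (length as)"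
    by (simp add: field_simps)
  with 1 2 show ?thesis by blast
qed

lemma small_oscillation:
  fixes f :: "'a \<Rightarrow> real"
  assumes f: "continuous_map X euclidean f" and e: "e > 0"
  shows "\<exists>bs c. translates bs \<and> (\<forall>x\<in>carrier G. \<bar>average bs f x - c\<bar> \<le> e)"
proof -
  define d where "d = e / 4"
  have d: "d > 0" using e by (simp add: d_def)
  obtain U where U: "openin X U" "\<one> \<in> U" "\<forall>u\<in>U. \<forall>x\<in>carrier G. norm (f (u \<otimes> x) - f x) < d"
    using uniformly_continuous[OF f d] by blast
  have UG: "U \<subseteq> carrier G"
    using U(1) openin_subset topspace_carrier by blast
  obtain as where as: "translates as" "\<And>x. x \<in> carrier G \<Longrightarrow> \<exists>a\<in>set as. a \<otimes> x \<in> U"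
    using finite_translates_cover[OF U(1)] U(2) by blast
  define n where "n = real (length as)"
  define q where "q = 1 - 1 / (2 * n)"
  have n: "n \<ge> 1"
    unfolding n_def using as(1) by (cases as) (auto simp: translates_def)
  have q: "0 \<le> q" "q < 1"
    using n by (auto simp: q_def divide_le_eq)
  have "compactin euclidean (f ` carrier G)"
    using image_compactin[OF _ f, of "carrier G"] compact
    by (simp add: compact_space_def topspace_carrier)
  then obtain B where B: "\<And>x. x \<in> carrier G \<Longrightarrow> \<bar>f x\<bar> \<le> B"
    unfolding compactin_euclidean_iff
    using compact_imp_bounded bounded_iff by (metis image_eqI real_norm_def)
  \<comment> \<open>The summand 2 d is the fixed point of t \<mapsto> q t + d / n, the map by which
    one round transforms the oscillation. In the end the oscillation is below 3 d, hence below e = 4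
    d.\<close>
  have "\<exists>bs l h. translates bs \<and> (\<forall>x\<in>carrier G. l \<le> average bs f x \<and> average bs f x \<le> h) \<and>
      h - l \<le> q ^ k * (2 * B) + 2 * d" for k
  proof (induction k)
    case 0
    have "translates [\<one>]" by (simp add: translates_def)
    moreover have "- B \<le> average [\<one>] f x \<and> average [\<one>] f x \<le> B" if "x \<in> carrier G" for x
      using B[OF that] that by (simp add: average_def abs_le_iff)
    ultimately show ?case
      using d by (intro exI[of _ "[\<one>]"] exI[of _ "- B"] exI[of _ B]) auto
  next
    case (Suc k)
    then obtain bs l h where bs: "translates bs"
      "\<And>x. x \<in> carrier G \<Longrightarrow> l \<le> average bs f x \<and> average bs f x \<le> h"
      "h - l \<le> q ^ k * (2 * B) + 2 * d" by blast
    have "\<bar>average bs f (u \<otimes> x) - average bs f x\<bar> \<le> d" if "u \<in> U" "x \<in> carrier G" for u x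
      using average_uniformly_continuous[OF bs(1), of u f d x] that U(3) UG
      by (auto intro: less_imp_le)
    from oscillation_step[OF UG this as bs(2)] d obtain l' h' where
      lh: "\<And>x. x \<in> carrier G \<Longrightarrow> l' \<le> average as (average bs f) x \<and> average as (average bs f) x \<le> h'"
        "h' - l' \<le> q * (h - l) + d / n"
      unfolding q_def n_def by (metis less_imp_le)
    have "q * (h - l) + d / n \<le> q * (q ^ k * (2 * B) + 2 * d) + d / n"
      using q(1) bs(3) by (intro add_mono mult_left_mono) auto
    also have "\<dots> = q ^ Suc k * (2 * B) + 2 * d"
      using n by (simp add: q_def field_simps)
    finally have "h' - l' \<le> q ^ Suc k * (2 * B) + 2 * d"
      using lh(2) by linarith
    moreover have "translates (products as bs)"
      by (rule translates_products[OF as(1) bs(1)])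
    moreover have "\<forall>x\<in>carrier G. l' \<le> average (products as bs) f x \<and> average (products as bs) f x \<le> h'"
      using lh(1) by (simp add: average_products[OF as(1) bs(1)])
    ultimately show ?case
      by blast
  qed
  moreover obtain k where "q ^ k * (2 * B) < d"
  proof -
    have "(\<lambda>k. q ^ k * (2 * B)) \<longlonglongrightarrow> 0"
      using q by (intro tendsto_mult_left_zero LIMSEQ_realpow_zero) auto
    from order_tendstoD(2)[OF this d] show ?thesis
      using that by (auto simp: eventually_sequentially)
  qed
  ultimately obtain bs l h where bs: "translates bs"
      "\<And>x. x \<in> carrier G \<Longrightarrow> l \<le> average bs f x \<and> average bs f x \<le> h"
      "h - l \<le> q ^ k * (2 * B) + 2 * d" and k: "q ^ k * (2 * B) < d"
    by blast
  have "\<bar>average bs f x - l\<bar> \<le> e" if "x \<in> carrier G" for x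
    using bs(2)[OF that] bs(3) k unfolding d_def abs_le_iff by linarith
  with bs(1) show ?thesis by blast
qed

lemma has_mean_exists:
  assumes f: "continuous_map X euclidean f"
  shows "\<exists>c. has_mean f c"
proof -
  have ex: "\<exists>bs c. translates bs \<and> (\<forall>x\<in>carrier G. norm (average bs f x - c) \<le> e)" if e: "e > 0" for e
  proof -
    have e2: "e/2 > 0" using e by simp
    have "continuous_map X euclidean (\<lambda>x. Re (f x))" "continuous_map X euclidean (\<lambda>x. Im (f x))"
      by (intro continuous_map_unop[OF f] continuous_intros)+
    with small_oscillation[OF _ e2] obtain as c bs d where
      as: "translates as" "\<And>x. x \<in> carrier G \<Longrightarrow> \<bar>average as (\<lambda>x. Re (f x)) x - c\<bar> \<le> e/2" and
      bs: "translates bs" "\<And>x. x \<in> carrier G \<Longrightarrow> \<bar>average bs (\<lambda>x. Im (f x)) x - d\<bar> \<le> e/2"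
      by metis
    \<comment> \<open>The list \<open>as\<close> levels the real part and \<open>bs\<close> the
      imaginary part; each averaging preserves what the other has achieved, so their products level
      both.\<close>
    have "norm (average (products as bs) f x - Complex c d) \<le> e" if x: "x \<in> carrier G" for x
    proof -
      let ?a = "average (products as bs) f x"
      have "Re ?a = average bs (average as (\<lambda>x. Re (f x))) x"
        by (metis (no_types, lifting) average_linear[OF bounded_linear.linear[OF bounded_linear_Re]]
            average_products[OF as(1) bs(1) x] average_commute[OF as(1) bs(1) x])
      then have "\<bar>Re ?a - c\<bar> \<le> e/2"
        using average_close[OF bs(1) x, of "average as (\<lambda>x. Re (f x))" c "e/2"] as(2) by simp
      moreover have "Im ?a = average as (average bs (\<lambda>x. Im (f x))) x"
        by (metis (no_types, lifting) average_linear[OF bounded_linear.linear[OF bounded_linear_Im]]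
            average_products[OF as(1) bs(1) x])
      then have "\<bar>Im ?a - d\<bar> \<le> e/2"
        using average_close[OF as(1) x, of "average bs (\<lambda>x. Im (f x))" d "e/2"] bs(2) by simp
      ultimately show ?thesis
        using cmod_le[of "?a - Complex c d"] by simp
    qed
    then show ?thesis
      using translates_products[OF as(1) bs(1)] by blast
  qed
  have "\<forall>k. \<exists>bs c. translates bs \<and> (\<forall>x\<in>carrier G. norm (average bs f x - c) \<le> inverse (real (Suc k)))"
    using ex by simp
  then obtain bs c where bs: "\<And>k. translates (bs k)"
      "\<And>k x. x \<in> carrier G \<Longrightarrow> norm (average (bs k) f x - c k) \<le> inverse (real (Suc k))"
    by metis
  have dist: "norm (c k - c m) \<le> inverse (real (Suc k)) + inverse (real (Suc m))" for k m
    by (rule averages_close[OF bs(1) bs(1) bs(2) bs(2)])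
  have "Cauchy c"
  proof (rule metric_CauchyI)
    fix e :: real assume "e > 0"
    then obtain N where N: "inverse (real (Suc N)) < e / 2"
      using reals_Archimedean[of "e/2"] by auto
    have "dist (c m) (c n) < e" if "m \<ge> N" "n \<ge> N" for m n
    proof -
      have "inverse (real (Suc m)) \<le> inverse (real (Suc N))" "inverse (real (Suc n)) \<le> inverse (real (Suc N))"
        using that by (auto intro!: le_imp_inverse_le)
      then show ?thesis
        using dist[of m n] N unfolding dist_norm by linarith
    qed
    then show "\<exists>M. \<forall>m\<ge>M. \<forall>n\<ge>M. dist (c m) (c n) < e" by blast
  qed
  then obtain l where l: "c \<longlonglongrightarrow> l"
    using Cauchy_convergent convergent_def by blast
  have "has_mean f l"
    unfolding has_mean_def
  proof (intro allI impI)
    fix e :: real assume "e > 0"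
    then have "\<forall>\<^sub>F k in sequentially. norm (c k - l) < e / 2" "\<forall>\<^sub>F k in sequentially. inverse (real (Suc k)) < e / 2"
      using tendstoD[OF l, of "e/2"] order_tendstoD(2)[OF LIMSEQ_inverse_real_of_nat, of "e/2"]
      by (auto simp: dist_norm)
    then have "\<forall>\<^sub>F k in sequentially. norm (c k - l) < e / 2 \<and> inverse (real (Suc k)) < e / 2"
      by (rule eventually_conj)
    then obtain k where k: "norm (c k - l) < e / 2" "inverse (real (Suc k)) < e / 2"
      using eventually_happens by fastforce
    have "norm (average (bs k) f x - l) \<le> e" if "x \<in> carrier G" for x
      using norm_triangle_ineq[of "average (bs k) f x - c k" "c k - l"] bs(2)[OF that, of k] k
      by simp
    with bs(1) show "\<exists>as. translates as \<and> (\<forall>x\<in>carrier G. norm (average as f x - l) \<le> e)" by blast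
  qed
  then show ?thesis by blast
qed

section \<open>The mean as a positive invariant functional, and its quadratic norm\<close>

abbreviation cont :: "('a \<Rightarrow> complex) \<Rightarrow> bool" where
  "cont f \<equiv> continuous_map X euclidean f"

lemma has_mean_mean: "cont f \<Longrightarrow> has_mean f (mean f)"
  by (metis has_mean_exists mean_eqI)

lemma cont_const [simp]: "cont (\<lambda>x. c)"
  by simp

lemma cont_add: "cont f \<Longrightarrow> cont g \<Longrightarrow> cont (\<lambda>x. f x + g x)"
  by (erule (1) continuous_map_binop[where h = "(+)"]) (intro continuous_intros)

lemma cont_diff: "cont f \<Longrightarrow> cont g \<Longrightarrow> cont (\<lambda>x. f x - g x)"
  by (erule (1) continuous_map_binop[where h = "(-)"]) (intro continuous_intros)

lemma cont_mult: "cont f \<Longrightarrow> cont g \<Longrightarrow> cont (\<lambda>x. f x * g x)"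
  by (erule (1) continuous_map_binop[where h = "(*)"]) (intro continuous_intros)

lemma cont_cnj: "cont f \<Longrightarrow> cont (\<lambda>x. cnj (f x))"
  by (erule continuous_map_unop[where h = cnj]) (intro continuous_intros)

lemmas cont_intros = cont_const cont_add cont_diff cont_mult cont_cnj

lemma cont_cong: "cont f \<Longrightarrow> (\<And>x. x \<in> carrier G \<Longrightarrow> f x = g x) \<Longrightarrow> cont g"
  by (rule continuous_map_eq[of X euclidean f]) (simp_all add: topspace_carrier)

lemma cont_bounded:
  assumes "cont f"
  shows "\<exists>B>0. \<forall>x\<in>carrier G. norm (f x) \<le> B"
proof -
  have "compactin euclidean (f ` carrier G)"
    using image_compactin[OF _ assms, of "carrier G"] compact
    by (simp add: compact_space_def topspace_carrier)
  then have "bounded (f ` carrier G)"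
    by (simp add: compact_imp_bounded)
  then show ?thesis
    by (auto simp: bounded_pos)
qed

lemma mean_cong: "(\<And>x. x \<in> carrier G \<Longrightarrow> f x = g x) \<Longrightarrow> mean f = mean g"
  unfolding mean_def by (intro arg_cong[of _ _ The] ext has_mean_cong)

lemma mean_add: "cont f \<Longrightarrow> cont g \<Longrightarrow> mean (\<lambda>x. f x + g x) = mean f + mean g"
  by (intro mean_eqI has_mean_add has_mean_mean)

lemma mean_bounded_linear: "cont f \<Longrightarrow> bounded_linear h \<Longrightarrow> mean (\<lambda>x. h (f x)) = h (mean f)"
  by (rule mean_eqI, rule has_mean_bounded_linear[OF has_mean_mean])

lemma mean_cmult: "cont f \<Longrightarrow> mean (\<lambda>x. c * f x) = c * mean f"
  using mean_bounded_linear[OF _ bounded_linear_mult_right] .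

lemma mean_cnj: "cont f \<Longrightarrow> mean (\<lambda>x. cnj (f x)) = cnj (mean f)"
  using mean_bounded_linear[OF _ bounded_linear_cnj] .

lemma mean_diff: "cont f \<Longrightarrow> cont g \<Longrightarrow> mean (\<lambda>x. f x - g x) = mean f - mean g"
  using mean_add[of f "\<lambda>x. (-1) * g x"] mean_cmult[of g "-1"] cont_mult[of "\<lambda>x. -1" g] by simp

lemma mean_const: "mean (\<lambda>x. c) = c"
  by (intro mean_eqI has_mean_const)

lemma mean_translate: "cont f \<Longrightarrow> b \<in> carrier G \<Longrightarrow> mean (\<lambda>x. f (b \<otimes> x)) = mean f"
  by (rule mean_eqI, rule has_mean_translate[OF has_mean_mean])

lemma Re_mean_mono:
  assumes "cont f" "cont g" "\<And>x. x \<in> carrier G \<Longrightarrow> Re (f x) \<le> Re (g x)"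
  shows "Re (mean f) \<le> Re (mean g)"
proof -
  have "mean (\<lambda>x. g x - f x) \<in> {z. Re z \<ge> 0}"
  proof (rule has_mean_in_closed_convex)
    show "has_mean (\<lambda>x. g x - f x) (mean (\<lambda>x. g x - f x))"
      using assms by (intro has_mean_mean cont_intros)
    show "convex {z. Re z \<ge> 0}"
      by (simp add: convex_halfspace_Re_ge)
    show "closed {z. Re z \<ge> 0}"
      by (simp add: closed_halfspace_Re_ge)
  qed (use assms in auto)
  then show ?thesis
    using assms by (simp add: mean_diff)
qed

lemma norm_mean_le:
  assumes "cont f" "\<And>x. x \<in> carrier G \<Longrightarrow> norm (f x) \<le> B"
  shows "norm (mean f) \<le> B"
proof -
  have "mean f \<in> cball 0 B"
    by (rule has_mean_in_closed_convex[OF has_mean_mean[OF assms(1)]]) (use assms in auto)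
  then show ?thesis by simp
qed

text \<open>The squared L2 norm for normalised Haar measure; the real part is taken because the mean
  is complex-valued.\<close>

definition sqnorm :: "('a \<Rightarrow> complex) \<Rightarrow> real" where
  "sqnorm f = Re (mean (\<lambda>x. f x * cnj (f x)))"

lemma sqnorm_cong: "(\<And>x. x \<in> carrier G \<Longrightarrow> f x = g x) \<Longrightarrow> sqnorm f = sqnorm g"
  unfolding sqnorm_def by (intro arg_cong[of _ _ Re] mean_cong) simp

lemma sqnorm_le_combine:
  assumes "cont f" "cont g" "cont h"
    and "\<And>x. x \<in> carrier G \<Longrightarrow> (norm (f x))\<^sup>2 \<le> a * (norm (g x))\<^sup>2 + b * (norm (h x))\<^sup>2"
  shows "sqnorm f \<le> a * sqnorm g + b * sqnorm h"
proof -
  have "sqnorm f \<le> Re (mean (\<lambda>x. of_real a * (g x * cnj (g x)) + of_real b * (h x * cnj (h x))))"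
    unfolding sqnorm_def
  proof (rule Re_mean_mono)
    fix x assume "x \<in> carrier G"
    from assms(4)[OF this] show "Re (f x * cnj (f x)) \<le> Re (of_real a * (g x * cnj (g x)) + of_real b * (h x * cnj (h x)))"
      by (simp flip: complex_norm_square of_real_power)
  qed (intro cont_intros assms)+
  also have "\<dots> = a * sqnorm g + b * sqnorm h"
    unfolding sqnorm_def using assms by (simp add: mean_add mean_cmult cont_intros)
  finally show ?thesis .
qed

lemma sqnorm_const: "sqnorm (\<lambda>x. c) = (norm c)\<^sup>2"
  unfolding sqnorm_def mean_const by (simp flip: complex_norm_square of_real_power)

lemma sqnorm_nonneg: "cont f \<Longrightarrow> 0 \<le> sqnorm f"
  using sqnorm_le_combine[of "\<lambda>x. 0" f "\<lambda>x. 0" 1 0] sqnorm_const[of 0] by simp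

lemma sqnorm_le: "cont f \<Longrightarrow> (\<And>x. x \<in> carrier G \<Longrightarrow> norm (f x) \<le> B) \<Longrightarrow> sqnorm f \<le> B\<^sup>2"
  using sqnorm_le_combine[of f "\<lambda>x. of_real B" "\<lambda>x. 0" 1 0] sqnorm_const[of "of_real B"]
  by (simp add: power_mono)

lemma sqnorm_translate:
  assumes "cont f" "b \<in> carrier G"
  shows "sqnorm (\<lambda>x. f (b \<otimes> x)) = sqnorm f"
  unfolding sqnorm_def
  using mean_translate[of "\<lambda>x. f x * cnj (f x)", OF _ assms(2)] assms(1) by (simp add: cont_intros)

lemma sqnorm_combine:
  assumes "cont f" "cont g"
  shows "sqnorm (\<lambda>x. of_real a * f x + of_real b * g x)
    = a\<^sup>2 * sqnorm f + b\<^sup>2 * sqnorm g + 2 * a * b * Re (mean (\<lambda>x. f x * cnj (g x)))"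
proof -
  have "mean (\<lambda>x. (of_real a * f x + of_real b * g x) * cnj (of_real a * f x + of_real b * g x))
    = mean (\<lambda>x. of_real (a\<^sup>2) * (f x * cnj (f x)) + of_real (b\<^sup>2) * (g x * cnj (g x))
        + of_real (a * b) * (f x * cnj (g x) + cnj (f x * cnj (g x))))"
    by (rule mean_cong) (simp add: algebra_simps power2_eq_square)
  also have "\<dots> = of_real (a\<^sup>2) * mean (\<lambda>x. f x * cnj (f x)) + of_real (b\<^sup>2) * mean (\<lambda>x. g x * cnj (g x))
        + of_real (a * b) * (mean (\<lambda>x. f x * cnj (g x)) + cnj (mean (\<lambda>x. f x * cnj (g x))))"
  proof -
    have "cont (\<lambda>x. f x * cnj (f x))" "cont (\<lambda>x. g x * cnj (g x))" "cont (\<lambda>x. f x * cnj (g x))"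
      by (intro cont_intros assms)+
    then show ?thesis
      by (simp only: mean_add mean_cmult mean_cnj cont_intros)
  qed
  finally show ?thesis
    unfolding sqnorm_def by simp
qed

text \<open>|f|^2 exceeds some d > 0 on a nonempty open set, of which finitely many translates cover
  the group. The matching translates of |f|^2 add up to at least d everywhere, while the mean of
  this sum is their number times \<open>sqnorm f\<close>.\<close>

lemma sqnorm_pos:
  assumes f: "cont f" and x0: "x0 \<in> carrier G" "f x0 \<noteq> 0"
  shows "sqnorm f > 0"
proof -
  define d where "d = (norm (f x0))\<^sup>2 / 2"
  have d: "d > 0" using x0 by (simp add: d_def)
  let ?V = "{x \<in> topspace X. (norm (f x))\<^sup>2 \<in> {d<..}}"
  have "continuous_map X euclidean (\<lambda>x. (norm (f x))\<^sup>2)"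
    by (rule continuous_map_unop[OF f]) (intro continuous_intros)
  then have "openin X ?V"
    by (rule openin_continuous_map_preimage) auto
  moreover have "x0 \<in> ?V"
    using x0 d by (simp add: d_def topspace_carrier)
  ultimately obtain as where as: "translates as" "\<forall>x\<in>carrier G. \<exists>a\<in>set as. a \<otimes> x \<in> ?V"
    using finite_translates_cover by blast
  define F where "F = (\<lambda>x. f x * cnj (f x))"
  have F: "cont F" unfolding F_def using f by (intro cont_intros)
  have asG: "set as \<subseteq> carrier G" using as(1) by (simp add: translates_def)
  have cF: "cont (\<lambda>x. \<Sum>a\<leftarrow>bs. F (a \<otimes> x)) \<and> mean (\<lambda>x. \<Sum>a\<leftarrow>bs. F (a \<otimes> x)) = of_nat (length bs) * mean F"
    if "set bs \<subseteq> carrier G" for bs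
    using that
  proof (induction bs)
    case (Cons b bs)
    then have "cont (\<lambda>x. F (b \<otimes> x))"
      using continuous_map_translate[OF F] by simp
    then show ?case
      using Cons mean_translate[OF F] by (simp add: mean_add cont_add algebra_simps)
  qed (simp add: mean_const)
  have "Re (mean (\<lambda>x. of_real d)) \<le> Re (mean (\<lambda>x. \<Sum>a\<leftarrow>as. F (a \<otimes> x)))"
  proof (rule Re_mean_mono)
    fix x assume "x \<in> carrier G"
    then obtain a where a: "a \<in> set as" "a \<otimes> x \<in> ?V" using as by blast
    have ReF: "Re (F y) = (norm (f y))\<^sup>2" for y
      unfolding F_def by (simp flip: complex_norm_square of_real_power)
    have "d \<le> Re (F (a \<otimes> x))"
      using a by (simp add: ReF)
    also have "\<dots> \<le> (\<Sum>a\<leftarrow>as. Re (F (a \<otimes> x)))"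
      using a(1) by (intro member_le_sum_list) (auto simp: ReF)
    also have "\<dots> = Re (\<Sum>a\<leftarrow>as. F (a \<otimes> x))"
      by (induction as) auto
    finally show "Re (of_real d) \<le> Re (\<Sum>a\<leftarrow>as. F (a \<otimes> x))" by simp
  qed (use cF[OF asG] in auto)
  then have "d \<le> real (length as) * sqnorm f"
    using cF[OF asG] unfolding sqnorm_def F_def mean_const by simp
  then have "0 < real (length as) * sqnorm f"
    using d by linarith
  then show ?thesis
    by (simp add: zero_less_mult_iff)
qed

text \<open>The Cauchy-Schwarz inequality in additive form: a unimodular factor \<open>c\<close>
  turns the mean into its modulus, after which 2 a b \<le> a^2 + b^2 applies pointwise.\<close>

lemma norm_mean_mult_le:
  assumes "cont f" "cont g"
  shows "norm (mean (\<lambda>x. f x * cnj (g x))) \<le> (sqnorm f + sqnorm g) / 2"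
proof -
  define m where "m = mean (\<lambda>x. f x * cnj (g x))"
  define c where "c = (if m = 0 then 1 else cnj m / of_real (norm m))"
  have c: "norm c = 1" "c * m = of_real (norm m)"
    using complex_norm_square[of m] by (auto simp: c_def norm_divide mult.commute power2_eq_square divide_eq_eq)
  have "norm m = Re (mean (\<lambda>x. c * (f x * cnj (g x))))"
    using c(2) mean_cmult[of "\<lambda>x. f x * cnj (g x)" c] assms unfolding m_def by (simp add: cont_intros)
  also have "\<dots> \<le> Re (mean (\<lambda>x. of_real (1/2) * (f x * cnj (f x)) + of_real (1/2) * (g x * cnj (g x))))"
  proof (rule Re_mean_mono)
    fix x
    have "Re (c * (f x * cnj (g x))) \<le> norm (f x) * norm (g x)"
      using complex_Re_le_cmod[of "c * (f x * cnj (g x))"] c(1) by (simp add: norm_mult)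
    also have "\<dots> \<le> ((norm (f x))\<^sup>2 + (norm (g x))\<^sup>2) / 2"
      using sum_squares_bound[of "norm (f x)" "norm (g x)"] by simp
    finally show "Re (c * (f x * cnj (g x))) \<le> Re (of_real (1/2) * (f x * cnj (f x)) + of_real (1/2) * (g x * cnj (g x)))"
      by (simp flip: complex_norm_square of_real_power)
  qed (intro cont_intros assms)+
  also have "\<dots> = (sqnorm f + sqnorm g) / 2"
  proof -
    have "cont (\<lambda>x. f x * cnj (f x))" "cont (\<lambda>x. g x * cnj (g x))"
      by (intro cont_intros assms)+
    then show ?thesis
      unfolding sqnorm_def by (simp only: mean_add mean_cmult cont_intros) simp
  qed
  finally show ?thesis unfolding m_def .
qed

text \<open>Translation preserves the norm, so expanding the square gives twice the real part of the
  inner product of f with f - f(b \<cdot>). That inner product is the value of a correlation at the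
  unit, which is how a correlation is shown not to vanish.\<close>

lemma sqnorm_diff_translate:
  assumes "cont f" "b \<in> carrier G"
  shows "sqnorm (\<lambda>x. f x - f (b \<otimes> x)) = 2 * Re (mean (\<lambda>x. f x * cnj (f x - f (b \<otimes> x))))"
proof -
  have c: "cont (\<lambda>x. f (b \<otimes> x))"
    by (rule continuous_map_translate[OF assms])
  have "sqnorm (\<lambda>x. f x - f (b \<otimes> x)) = sqnorm f + sqnorm f - 2 * Re (mean (\<lambda>x. f x * cnj (f (b \<otimes> x))))"
    using sqnorm_combine[OF assms(1) c, of 1 "-1"] sqnorm_translate[OF assms] by simp
  moreover have "mean (\<lambda>x. f x * cnj (f x - f (b \<otimes> x)))
      = mean (\<lambda>x. f x * cnj (f x)) - mean (\<lambda>x. f x * cnj (f (b \<otimes> x)))"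
    using mean_diff[of "\<lambda>x. f x * cnj (f x)" "\<lambda>x. f x * cnj (f (b \<otimes> x))"] assms c
    by (simp add: cont_intros right_diff_distrib)
  ultimately show ?thesis
    unfolding sqnorm_def by simp
qed

subsection \<open>Positive definite functions and characters\<close>

lemma continuous_if_uniformly_continuous:
  fixes f :: "'a \<Rightarrow> 'c::real_normed_vector"
  assumes "\<And>e. e > 0 \<Longrightarrow> \<exists>U. openin X U \<and> \<one> \<in> U \<and> (\<forall>u\<in>U. \<forall>x\<in>carrier G. norm (f (u \<otimes> x) - f x) \<le> e)"
  shows "continuous_map X euclidean f"
  unfolding continuous_map_def
proof (intro conjI allI impI)
  fix V :: "'c set" assume "openin euclidean V"
  then have V: "open V" by simp
  show "openin X {x \<in> topspace X. f x \<in> V}"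
  proof (subst openin_subopen, intro ballI)
    fix x assume "x \<in> {x \<in> topspace X. f x \<in> V}"
    then have x: "x \<in> carrier G" "f x \<in> V" by (auto simp: topspace_carrier)
    obtain d where d: "d > 0" "cball (f x) d \<subseteq> V"
      using V x(2) open_contains_cball by blast
    obtain U where U: "openin X U" "\<one> \<in> U" "\<forall>u\<in>U. \<forall>x\<in>carrier G. norm (f (u \<otimes> x) - f x) \<le> d"
      using assms[OF d(1)] by blast
    let ?T = "{y \<in> topspace X. inv x \<otimes> y \<in> U}"
    have "openin X ?T"
      using openin_continuous_map_preimage[OF continuous_translate U(1)] x(1) by simp
    moreover have "x \<in> ?T"
      using x U by (simp add: topspace_carrier)
    moreover have "f y \<in> V" if y: "y \<in> ?T" for y
    proof -
      have yG: "y \<in> carrier G" using y by (simp add: topspace_carrier)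
      have "(inv x \<otimes> y) \<otimes> x = y"
        using x(1) yG by (metis inv_closed m_assoc m_comm r_inv r_one)
      then have "norm (f y - f x) \<le> d"
        using U(3) y x(1) by (metis (mono_tags, lifting) mem_Collect_eq)
      then have "f y \<in> cball (f x) d"
        by (simp add: dist_norm norm_minus_commute)
      then show ?thesis using d(2) by blast
    qed
    ultimately show "\<exists>T. openin X T \<and> x \<in> T \<and> T \<subseteq> {x \<in> topspace X. f x \<in> V}"
      by (intro exI[of _ ?T]) auto
  qed
qed simp

text \<open>Up to a reflection this is convolution with \<open>k\<close>. For fixed \<open>k\<close>
  it is linear in \<open>p\<close>, commutes with translations and sends bounded families to
  equicontinuous ones.\<close>

definition corr :: "('a \<Rightarrow> complex) \<Rightarrow> ('a \<Rightarrow> complex) \<Rightarrow> 'a \<Rightarrow> complex" where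
  "corr k p x = mean (\<lambda>z. k z * p (x \<otimes> z))"

lemma cont_corr_integrand: "cont k \<Longrightarrow> cont p \<Longrightarrow> x \<in> carrier G \<Longrightarrow> cont (\<lambda>z. k z * p (x \<otimes> z))"
  by (intro cont_mult continuous_map_translate)

lemma norm_corr_le:
  assumes "cont k" "cont p" "x \<in> carrier G"
    and "\<And>z. z \<in> carrier G \<Longrightarrow> norm (k z) \<le> A" "\<And>z. z \<in> carrier G \<Longrightarrow> norm (p z) \<le> B"
  shows "norm (corr k p x) \<le> A * B"
  unfolding corr_def
proof (rule norm_mean_le)
  fix z assume z: "z \<in> carrier G"
  then have "norm (k z) \<le> A" "norm (p (x \<otimes> z)) \<le> B"
    using assms by auto
  then show "norm (k z * p (x \<otimes> z)) \<le> A * B"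
    unfolding norm_mult using norm_ge_zero order_trans by (intro mult_mono) blast+
qed (intro cont_corr_integrand assms)

text \<open>Invariance of the mean moves the translation from \<open>p\<close> to
  \<open>k\<close>.\<close>

lemma corr_shift:
  assumes "cont k" "cont p" "x \<in> carrier G"
  shows "corr k p x = mean (\<lambda>z. k (inv x \<otimes> z) * p z)"
proof -
  have "cont (\<lambda>z. k (inv x \<otimes> z) * p z)"
    by (intro cont_mult continuous_map_translate assms inv_closed)
  from mean_translate[OF this assms(3)]
  have "mean (\<lambda>z. k (inv x \<otimes> z) * p z) = mean (\<lambda>z. k (inv x \<otimes> (x \<otimes> z)) * p (x \<otimes> z))"
    by simp
  also have "\<dots> = corr k p x"
    unfolding corr_def using assms(3) by (intro mean_cong) (simp add: m_assoc[symmetric])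
  finally show ?thesis by simp
qed

text \<open>After \<open>corr_shift\<close> the variable x occurs in \<open>k\<close> only, so the
  modulus of continuity of \<open>k\<close> works for all \<open>p\<close> bounded by 1
  simultaneously.\<close>

lemma corr_equicontinuous:
  assumes k: "cont k" and e: "e > 0"
  shows "\<exists>U. openin X U \<and> \<one> \<in> U \<and> (\<forall>p. cont p \<longrightarrow> (\<forall>z\<in>carrier G. norm (p z) \<le> 1) \<longrightarrow>
    (\<forall>u\<in>U. \<forall>x\<in>carrier G. norm (corr k p (u \<otimes> x) - corr k p x) \<le> e))"
proof -
  obtain V where V: "openin X V" "\<one> \<in> V" "\<forall>u\<in>V. \<forall>x\<in>carrier G. norm (k (u \<otimes> x) - k x) < e"
    using uniformly_continuous[OF k e] by blast
  let ?U = "{u \<in> topspace X. inv u \<in> V}"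
  have "openin X ?U"
    by (rule openin_continuous_map_preimage[OF continuous_inv V(1)])
  moreover have "\<one> \<in> ?U"
    using V(2) by (simp add: topspace_carrier)
  moreover have "norm (corr k p (u \<otimes> x) - corr k p x) \<le> e"
    if p: "cont p" "\<forall>z\<in>carrier G. norm (p z) \<le> 1" and u: "u \<in> ?U" and x: "x \<in> carrier G" for p u x
  proof -
    have uG: "u \<in> carrier G" "inv u \<in> V" using u by (auto simp: topspace_carrier)
    have c: "cont (\<lambda>z. k (inv (u \<otimes> x) \<otimes> z) * p z)" "cont (\<lambda>z. k (inv x \<otimes> z) * p z)"
      using x uG by (intro cont_mult continuous_map_translate k p inv_closed m_closed; simp)+
    have "corr k p (u \<otimes> x) - corr k p x = mean (\<lambda>z. k (inv (u \<otimes> x) \<otimes> z) * p z - k (inv x \<otimes> z) * p z)"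
      using x uG by (simp add: corr_shift[OF k p(1)] mean_diff[OF c])
    moreover have "norm \<dots> \<le> e"
    proof (rule norm_mean_le)
      fix z assume z: "z \<in> carrier G"
      have "inv (u \<otimes> x) \<otimes> z = inv u \<otimes> (inv x \<otimes> z)"
        using x uG z by (simp add: inv_mult m_assoc)
      then have "norm (k (inv (u \<otimes> x) \<otimes> z) - k (inv x \<otimes> z)) \<le> e"
        using V(3) uG x z by (simp add: less_imp_le)
      then have "norm (k (inv (u \<otimes> x) \<otimes> z) - k (inv x \<otimes> z)) * norm (p z) \<le> e * 1"
        using p(2) z e by (intro mult_mono) auto
      then show "norm (k (inv (u \<otimes> x) \<otimes> z) * p z - k (inv x \<otimes> z) * p z) \<le> e"
        by (simp add: norm_mult left_diff_distrib[symmetric])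
    qed (intro cont_diff c)
    ultimately show ?thesis by simp
  qed
  ultimately show ?thesis by (intro exI[of _ ?U]) blast
qed

lemma corr_add: "cont k \<Longrightarrow> cont p \<Longrightarrow> cont q \<Longrightarrow> x \<in> carrier G \<Longrightarrow>
    corr k (\<lambda>x. p x + q x) x = corr k p x + corr k q x"
  unfolding corr_def by (simp add: distrib_left mean_add cont_corr_integrand)

lemma corr_cmult: "cont k \<Longrightarrow> cont p \<Longrightarrow> x \<in> carrier G \<Longrightarrow>
    corr k (\<lambda>x. c * p x) x = c * corr k p x"
  unfolding corr_def mean_cmult[OF cont_corr_integrand, symmetric] by (simp add: mult.left_commute)

lemma corr_translate: "x \<in> carrier G \<Longrightarrow> y \<in> carrier G \<Longrightarrow>
    corr k (\<lambda>x. p (x \<otimes> y)) x = corr k p (x \<otimes> y)"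
  unfolding corr_def by (intro mean_cong) (simp add: m_ac)

lemma cont_corr:
  assumes "cont k" "cont p"
  shows "cont (corr k p)"
proof (rule continuous_if_uniformly_continuous)
  fix e :: real assume e: "e > 0"
  obtain B where B: "B > 0" "\<And>z. z \<in> carrier G \<Longrightarrow> norm (p z) \<le> B"
    using cont_bounded[OF assms(2)] by blast
  define q where "q = (\<lambda>z. of_real (1 / B) * p z)"
  have "cont q"
    unfolding q_def by (intro cont_intros assms)
  moreover have "norm (q z) \<le> 1" if "z \<in> carrier G" for z
    using B(1) B(2)[OF that] by (simp add: q_def norm_mult norm_divide divide_le_eq)
  ultimately have q: "cont q" "\<forall>z\<in>carrier G. norm (q z) \<le> 1"
    by auto
  have eq: "corr k p x = of_real B * corr k q x" if "x \<in> carrier G" for x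
    unfolding q_def corr_cmult[OF assms that] using B(1) by simp
  obtain U where U: "openin X U" "\<one> \<in> U" and all: "\<forall>p. cont p \<longrightarrow> (\<forall>z\<in>carrier G. norm (p z) \<le> 1) \<longrightarrow>
      (\<forall>u\<in>U. \<forall>x\<in>carrier G. norm (corr k p (u \<otimes> x) - corr k p x) \<le> e / B)"
    using corr_equicontinuous[OF assms(1) divide_pos_pos[OF e B(1)]] by (elim exE conjE)
  have near: "\<forall>u\<in>U. \<forall>x\<in>carrier G. norm (corr k q (u \<otimes> x) - corr k q x) \<le> e / B"
    using all[rule_format, OF q(1)] q(2) by simp
  have UG: "U \<subseteq> carrier G" using openin_subset[OF U(1)] by (simp add: topspace_carrier)
  have "norm (corr k p (u \<otimes> x) - corr k p x) \<le> e" if u: "u \<in> U" and x: "x \<in> carrier G" for u x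
  proof -
    have "u \<otimes> x \<in> carrier G" using u x UG by auto
    then have "corr k p (u \<otimes> x) - corr k p x = of_real B * (corr k q (u \<otimes> x) - corr k q x)"
      by (simp only: eq[OF x] eq right_diff_distrib)
    then have "norm (corr k p (u \<otimes> x) - corr k p x) \<le> B * (e / B)"
      using near u x B(1) by (simp only: norm_mult norm_of_real abs_of_pos) (intro mult_left_mono; simp)
    then show ?thesis using B(1) by simp
  qed
  with U show "\<exists>U. openin X U \<and> \<one> \<in> U \<and> (\<forall>u\<in>U. \<forall>x\<in>carrier G. norm (corr k p (u \<otimes> x) - corr k p x) \<le> e)"
    by blast
qed

text \<open>A cone of positive definite functions, large enough to be closed under
  \<open>p \<mapsto> 2 p \<plusminus> (c p(\<cdot> y) + cnj c p(\<cdot> y\<inverse>))\<close> for \<open>|c| = 1\<close>.\<close>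

definition autocorr :: "('a \<Rightarrow> complex) \<Rightarrow> 'a \<Rightarrow> complex" where
  "autocorr t = corr (\<lambda>z. cnj (t z)) t"

definition posdef :: "('a \<Rightarrow> complex) set" where
  "posdef = {p. \<exists>t r. cont t \<and> r \<ge> 0 \<and> (\<forall>x\<in>carrier G. p x = of_real r * autocorr t x)}"

lemma cont_autocorr: "cont t \<Longrightarrow> cont (autocorr t)"
  unfolding autocorr_def by (intro cont_corr cont_cnj)

lemma autocorr_one: "cont t \<Longrightarrow> autocorr t \<one> = of_real (sqnorm t)"
proof -
  assume t: "cont t"
  have *: "autocorr t \<one> = mean (\<lambda>x. t x * cnj (t x))"
    unfolding autocorr_def corr_def by (intro mean_cong) (simp add: mult.commute)
  have "cnj (mean (\<lambda>x. t x * cnj (t x))) = mean (\<lambda>x. t x * cnj (t x))"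
    by (subst mean_cnj[symmetric]) (auto intro!: cont_intros t mean_cong simp: mult.commute)
  then show ?thesis
    unfolding * sqnorm_def by (simp add: complex_eq_iff)
qed

lemma norm_autocorr_le:
  assumes "cont t" "x \<in> carrier G"
  shows "norm (autocorr t x) \<le> sqnorm t"
proof -
  have "norm (mean (\<lambda>z. t (x \<otimes> z) * cnj (t z))) \<le> (sqnorm (\<lambda>z. t (x \<otimes> z)) + sqnorm t) / 2"
    by (intro norm_mean_mult_le continuous_map_translate assms)
  then show ?thesis
    unfolding autocorr_def corr_def by (simp add: sqnorm_translate[OF assms] mult.commute)
qed

lemma autocorr_inv:
  assumes t: "cont t" and x: "x \<in> carrier G"
  shows "autocorr t (inv x) = cnj (autocorr t x)"
proof -
  have "autocorr t (inv x) = mean (\<lambda>z. cnj (t (x \<otimes> z)) * t z)"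
    unfolding autocorr_def using corr_shift[OF cont_cnj[OF t] t inv_closed[OF x]] x by simp
  also have "\<dots> = mean (\<lambda>z. cnj (cnj (t z) * t (x \<otimes> z)))"
    by (intro mean_cong) (simp add: mult.commute)
  also have "\<dots> = cnj (autocorr t x)"
    unfolding autocorr_def corr_def by (intro mean_cnj cont_corr_integrand cont_cnj t x)
  finally show ?thesis .
qed

lemma posdefD:
  assumes "p \<in> posdef"
  shows "cont p" "p \<one> = of_real (Re (p \<one>))" "Re (p \<one>) \<ge> 0"
    "x \<in> carrier G \<Longrightarrow> norm (p x) \<le> Re (p \<one>)"
    "x \<in> carrier G \<Longrightarrow> p (inv x) = cnj (p x)"
proof -
  obtain t r where t: "cont t" "r \<ge> 0" "\<And>x. x \<in> carrier G \<Longrightarrow> p x = of_real r * autocorr t x"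
    using assms unfolding posdef_def by blast
  show "cont p"
    by (rule cont_cong[of "\<lambda>x. of_real r * autocorr t x"])
      (auto intro!: cont_intros cont_autocorr t simp: t(3))
  have 1: "p \<one> = of_real (r * sqnorm t)"
    by (simp add: t(3) autocorr_one[OF t(1)])
  then show "p \<one> = of_real (Re (p \<one>))" "Re (p \<one>) \<ge> 0"
    using t sqnorm_nonneg by auto
  show "norm (p x) \<le> Re (p \<one>)" if x: "x \<in> carrier G"
    unfolding 1 t(3)[OF x] using norm_autocorr_le[OF t(1) x] t(2)
    by (simp add: norm_mult mult_left_mono)
  show "p (inv x) = cnj (p x)" if x: "x \<in> carrier G"
    using t x by (simp add: autocorr_inv)
qed

lemma posdef_scale: "p \<in> posdef \<Longrightarrow> s \<ge> 0 \<Longrightarrow> (\<lambda>x. of_real s * p x) \<in> posdef"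
  unfolding posdef_def by (auto simp flip: mult.assoc of_real_mult) (metis mult_nonneg_nonneg)

text \<open>If \<open>p\<close> comes from t, the new function comes from t + c t(\<cdot> y): its
  square terms give 2 p because c is unimodular, and its cross terms give the two
  translates.\<close>

lemma posdef_combine:
  assumes p: "p \<in> posdef" and c: "norm c = 1" and y: "y \<in> carrier G"
  shows "(\<lambda>x. 2 * p x + (c * p (x \<otimes> y) + cnj c * p (x \<otimes> inv y))) \<in> posdef"
proof -
  obtain t r where t: "cont t" "r \<ge> 0" "\<And>x. x \<in> carrier G \<Longrightarrow> p x = of_real r * autocorr t x"
    using assms unfolding posdef_def by blast
  define s where "s = (\<lambda>z. t z + c * t (z \<otimes> y))"
  have ty: "cont (\<lambda>z. t (z \<otimes> y))"
    by (intro continuous_map_rtranslate t y)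
  have s: "cont s"
    unfolding s_def by (intro cont_intros t ty)
  have cc: "cnj c * c = 1"
    using complex_norm_square[of c] c by (simp add: mult.commute)
  have "autocorr s x = 2 * autocorr t x + (c * autocorr t (x \<otimes> y) + cnj c * autocorr t (x \<otimes> inv y))"
    if x: "x \<in> carrier G" for x
  proof -
    have ct: "cont (\<lambda>z. cnj (t z))" "cont (\<lambda>z. cnj (t (z \<otimes> y)))"
      by (intro cont_cnj t ty)+
    have c1: "cont (\<lambda>z. cnj (t z) * t (x \<otimes> z))" "cont (\<lambda>z. cnj (t (z \<otimes> y)) * t (x \<otimes> (z \<otimes> y)))"
      "cont (\<lambda>z. cnj (t z) * t ((x \<otimes> y) \<otimes> z))" "cont (\<lambda>z. cnj (t (z \<otimes> y)) * t (x \<otimes> z))"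
    proof -
      show "cont (\<lambda>z. cnj (t (z \<otimes> y)) * t (x \<otimes> (z \<otimes> y)))"
        using cont_corr_integrand[OF ct(2) ty x]
        by (rule cont_cong) (simp add: x y m_assoc)
    qed (intro cont_corr_integrand ct t x y m_closed)+
    have "autocorr s x = mean (\<lambda>z. (cnj (t z) * t (x \<otimes> z) + cnj (t (z \<otimes> y)) * t (x \<otimes> (z \<otimes> y)))
       + (c * (cnj (t z) * t ((x \<otimes> y) \<otimes> z)) + cnj c * (cnj (t (z \<otimes> y)) * t (x \<otimes> z))))"
      unfolding autocorr_def corr_def s_def
    proof (rule mean_cong)
      fix z assume z: "z \<in> carrier G"
      have "x \<otimes> z \<otimes> y = x \<otimes> (z \<otimes> y)" "x \<otimes> y \<otimes> z = x \<otimes> (z \<otimes> y)"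
        using x y z by (simp_all add: m_ac)
      then show "cnj (t z + c * t (z \<otimes> y)) * (t (x \<otimes> z) + c * t (x \<otimes> z \<otimes> y)) =
         (cnj (t z) * t (x \<otimes> z) + cnj (t (z \<otimes> y)) * t (x \<otimes> (z \<otimes> y)))
       + (c * (cnj (t z) * t ((x \<otimes> y) \<otimes> z)) + cnj c * (cnj (t (z \<otimes> y)) * t (x \<otimes> z)))"
        using arg_cong[OF cc, of "\<lambda>w. w * (cnj (t (z \<otimes> y)) * t (x \<otimes> (z \<otimes> y)))"]
        by (simp add: algebra_simps)
    qed
    also have "\<dots> = (autocorr t x + mean (\<lambda>z. cnj (t (z \<otimes> y)) * t (x \<otimes> (z \<otimes> y)))) +
       (c * autocorr t (x \<otimes> y) + cnj c * mean (\<lambda>z. cnj (t (z \<otimes> y)) * t (x \<otimes> z)))"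
      unfolding autocorr_def corr_def by (simp only: mean_add mean_cmult cont_intros c1)
    also have "mean (\<lambda>z. cnj (t (z \<otimes> y)) * t (x \<otimes> (z \<otimes> y))) = autocorr t x"
      unfolding autocorr_def corr_def
      using mean_translate[OF c1(1) y] by (simp add: y m_comm cong: mean_cong)
    also have "mean (\<lambda>z. cnj (t (z \<otimes> y)) * t (x \<otimes> z)) = autocorr t (x \<otimes> inv y)"
    proof -
      have c2: "cont (\<lambda>z. cnj (t z) * t ((x \<otimes> inv y) \<otimes> z))"
        using x y by (intro cont_corr_integrand ct t) simp
      have eq: "x \<otimes> inv y \<otimes> (y \<otimes> z) = x \<otimes> z" "y \<otimes> z = z \<otimes> y" if "z \<in> carrier G" for z
      proof -
        have "x \<otimes> inv y \<otimes> (y \<otimes> z) = x \<otimes> ((inv y \<otimes> y) \<otimes> z)"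
          using x y that by (simp only: m_assoc inv_closed m_closed)
        then show "x \<otimes> inv y \<otimes> (y \<otimes> z) = x \<otimes> z" using x y that by simp
        show "y \<otimes> z = z \<otimes> y" using y that by (rule m_comm)
      qed
      have "mean (\<lambda>z. cnj (t (z \<otimes> y)) * t (x \<otimes> z)) 
          = mean (\<lambda>z. cnj (t (y \<otimes> z)) * t (x \<otimes> inv y \<otimes> (y \<otimes> z)))"
      proof (rule mean_cong)
        fix z assume z: "z \<in> carrier G"
        show "cnj (t (z \<otimes> y)) * t (x \<otimes> z) = cnj (t (y \<otimes> z)) * t (x \<otimes> inv y \<otimes> (y \<otimes> z))"
          by (simp only: eq(1)[OF z]) (simp only: eq(2)[OF z])
      qed
      then show ?thesis
        unfolding autocorr_def corr_def using mean_translate[OF c2 y] by (simp only:)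
    qed
    finally show ?thesis by simp
  qed
  then have "\<forall>x\<in>carrier G. 2 * p x + (c * p (x \<otimes> y) + cnj c * p (x \<otimes> inv y)) = of_real r * autocorr s x"
    using y by (simp add: t(3) algebra_simps)
  then show ?thesis
    unfolding posdef_def using s t(2) by blast
qed

text \<open>A near-maximiser \<open>p\<close> cannot be split essentially: the two summands of
  \<open>4 p = (2 p + q) + (2 p - q)\<close> must be nearly proportional to \<open>p\<close>.\<close>

lemma near_maximal_split:
  assumes k: "cont k" and s: "\<And>p. p \<in> posdef \<Longrightarrow> sqnorm (corr k p) \<le> s * (Re (p \<one>))\<^sup>2"
    and p: "p \<in> posdef" "p \<one> = 1" "s - e \<le> sqnorm (corr k p)" "e \<ge> 0"
    and y: "y \<in> carrier G" and c: "norm c = 1"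
  shows "sqnorm (\<lambda>x. (c * corr k p (x \<otimes> y) + cnj c * corr k p (x \<otimes> inv y))
      - of_real (2 * Re (c * p y)) * corr k p x) \<le> 4 * e"
proof -
  define P where "P = corr k p"
  define q where "q = (\<lambda>c x. 2 * p x + (c * p (x \<otimes> y) + cnj c * p (x \<otimes> inv y)))"
  define A where "A = corr k (q c)"
  define B where "B = corr k (q (- c))"
  \<comment> \<open>The values of \<open>q c\<close> and \<open>q (- c)\<close> at the unit are 4 t
    and 4 (1 - t), so t is the share of \<open>q c\<close> in the splitting of 4 p.\<close>
  define t where "t = (1 + Re (c * p y)) / 2"
  note cp = posdefD(1)[OF p(1)]
  have q: "q c \<in> posdef" "q (- c) \<in> posdef"
    unfolding q_def using c by (intro posdef_combine[OF p(1) _ y]; simp)+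
  have cA: "cont A" "cont B" "cont P"
    unfolding A_def B_def P_def using posdefD(1) q cp by (auto intro!: cont_corr k)
  have cp': "cont (\<lambda>x. p (x \<otimes> y))" "cont (\<lambda>x. p (x \<otimes> inv y))"
    using y by (auto intro!: continuous_map_rtranslate cp)
  have corr_q: "corr k (q d) x = 2 * P x + (d * P (x \<otimes> y) + cnj d * P (x \<otimes> inv y))"
    if x: "x \<in> carrier G" for d x
  proof -
    have "corr k (q d) x = corr k (\<lambda>x. 2 * p x) x + (corr k (\<lambda>x. d * p (x \<otimes> y)) x + corr k (\<lambda>x. cnj d * p (x \<otimes> inv y)) x)"
      unfolding q_def using x by (simp only: corr_add k cont_intros cp cp')
    then show ?thesis
      unfolding P_def using x y by (simp only: corr_cmult k cp cp' corr_translate inv_closed)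
  qed
  have p1: "norm (c * p y) \<le> 1"
    using posdefD(4)[OF p(1) y] p(2) c by (simp add: norm_mult)
  then have t: "0 \<le> t" "t \<le> 1"
    using abs_Re_le_cmod[of "c * p y"] by (auto simp: t_def)
  have Re_q: "Re (q d \<one>) = 2 + 2 * Re (d * p y)" for d
    unfolding q_def using y posdefD(5)[OF p(1) y] p(2) by simp
  have a: "sqnorm A \<le> 16 * s * t\<^sup>2"
    using s[OF q(1)] unfolding A_def Re_q t_def by (simp add: power2_eq_square algebra_simps)
  have b: "sqnorm B \<le> 16 * s * (1 - t)\<^sup>2"
    using s[OF q(2)] unfolding B_def Re_q t_def by (simp add: power2_eq_square field_simps)
  define r where "r = Re (mean (\<lambda>x. A x * cnj (B x)))"
  have "sqnorm (\<lambda>x. of_real 1 * A x + of_real 1 * B x) = sqnorm (\<lambda>x. of_real 4 * P x + of_real 0 * P x)"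
    by (rule sqnorm_cong) (simp add: A_def B_def corr_q)
  then have ab: "sqnorm A + sqnorm B + 2 * r = 16 * sqnorm P"
    using sqnorm_combine[OF cA(1,2), of 1 1] sqnorm_combine[OF cA(3,3), of 4 0] r_def by simp
  \<comment> \<open>Exact proportionality would mean A = 4 t P and B = 4 (1 - t) P; the combination
    (1 - t) A - t B measures the deviation from it.\<close>
  have "sqnorm (\<lambda>x. (c * P (x \<otimes> y) + cnj c * P (x \<otimes> inv y)) - of_real (2 * Re (c * p y)) * P x)
     = sqnorm (\<lambda>x. of_real (1 - t) * A x + of_real (- t) * B x)"
    by (rule sqnorm_cong) (simp add: A_def B_def corr_q t_def algebra_simps)
  also have "\<dots> = (1 - t)\<^sup>2 * sqnorm A + t\<^sup>2 * sqnorm B - t * (1 - t) * (2 * r)"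
    using sqnorm_combine[OF cA(1,2), of "1 - t" "- t"] r_def by simp
  also have "\<dots> = (1 - t) * sqnorm A + t * sqnorm B - 16 * (t * (1 - t)) * sqnorm P"
  proof -
    have "2 * r = 16 * sqnorm P - sqnorm A - sqnorm B" using ab by simp
    then show ?thesis by (simp only: power2_eq_square) (simp add: algebra_simps)
  qed
  \<comment> \<open>With the cross term eliminated through A + B = 4 P, the upper bounds for
    \<open>A\<close> and \<open>B\<close> and the lower bound for \<open>P\<close> all act in the
    right direction, and the terms with \<open>s\<close> cancel.\<close>
  also have "\<dots> \<le> (1 - t) * (16 * s * t\<^sup>2) + t * (16 * s * (1 - t)\<^sup>2) - 16 * (t * (1 - t)) * (s - e)"
    using t a b p(3) unfolding P_def
    by (intro diff_mono add_mono mult_left_mono) auto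
  also have "\<dots> = 16 * (t * (1 - t)) * e"
    by (simp add: power2_eq_square algebra_simps)
  also have "\<dots> \<le> 16 * (1/4) * e"
  proof -
    have "0 \<le> (t - 1/2)\<^sup>2" by simp
    then have "t * (1 - t) \<le> 1/4" by (simp add: power2_eq_square algebra_simps)
    then show ?thesis using p(4) by (intro mult_right_mono) auto
  qed
  finally show ?thesis unfolding P_def by simp
qed

text \<open>The preceding estimate controls only combinations of the translates by y and by its
  inverse. Those for c = 1 and c = -\<i> combine to (D 1 + \<i> D (-\<i>)) / 2, which isolates the
  translate by y: \<open>corr k p\<close> is nearly an eigenfunction of translation, with eigenvalue
  \<open>p y\<close>.\<close>

lemma near_maximal:
  assumes k: "cont k" and s: "\<And>p. p \<in> posdef \<Longrightarrow> sqnorm (corr k p) \<le> s * (Re (p \<one>))\<^sup>2"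
    and p: "p \<in> posdef" "p \<one> = 1" "s - e \<le> sqnorm (corr k p)" "e \<ge> 0"
    and y: "y \<in> carrier G"
  shows "sqnorm (\<lambda>x. corr k p (x \<otimes> y) - p y * corr k p x) \<le> 4 * e"
proof -
  define P where "P = corr k p"
  define D where "D = (\<lambda>c x. (c * P (x \<otimes> y) + cnj c * P (x \<otimes> inv y)) - of_real (2 * Re (c * p y)) * P x)"
  have P: "cont P"
    unfolding P_def by (intro cont_corr k posdefD(1)[OF p(1)])
  have D: "cont (D c)" for c
    unfolding D_def using y by (intro cont_intros continuous_map_rtranslate P inv_closed)
  have "sqnorm (D c) \<le> 4 * e" if "norm c = 1" for c
    unfolding D_def P_def by (rule near_maximal_split[OF assms that])
  then have le: "sqnorm (D 1) \<le> 4 * e" "sqnorm (D (- \<i>)) \<le> 4 * e"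
    by auto
  have "sqnorm (\<lambda>x. P (x \<otimes> y) - p y * P x) \<le> 1/2 * sqnorm (D 1) + 1/2 * sqnorm (D (- \<i>))"
  proof (rule sqnorm_le_combine)
    show "cont (\<lambda>x. P (x \<otimes> y) - p y * P x)"
      using y by (intro cont_intros continuous_map_rtranslate P)
    fix x
    have eq: "P (x \<otimes> y) - p y * P x = (D 1 x + \<i> * D (- \<i>) x) / 2"
      unfolding D_def by (simp add: complex_eq_iff algebra_simps)
    have "norm (D 1 x + \<i> * D (- \<i>) x) \<le> norm (D 1 x) + norm (D (- \<i>) x)"
      using norm_triangle_ineq[of "D 1 x" "\<i> * D (- \<i>) x"] by (simp add: norm_mult)
    then have "(norm (D 1 x + \<i> * D (- \<i>) x))\<^sup>2 \<le> (norm (D 1 x) + norm (D (- \<i>) x))\<^sup>2"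
      by (intro power_mono) auto
    also have "\<dots> \<le> 2 * (norm (D 1 x))\<^sup>2 + 2 * (norm (D (- \<i>) x))\<^sup>2"
      using sum_squares_bound[of "norm (D 1 x)" "norm (D (- \<i>) x)"] by (simp add: power2_sum)
    finally show "(norm (P (x \<otimes> y) - p y * P x))\<^sup>2 \<le> 1/2 * (norm (D 1 x))\<^sup>2 + 1/2 * (norm (D (- \<i>) x))\<^sup>2"
      unfolding eq by (simp add: norm_divide power_divide)
  qed (intro D)+
  with le show ?thesis
    unfolding P_def by simp
qed

lemma corr_bounded_on_posdef:
  assumes k: "cont k" and A: "\<And>z. z \<in> carrier G \<Longrightarrow> norm (k z) \<le> A"
    and p: "p \<in> posdef" "p \<one> = 1" and x: "x \<in> carrier G"
  shows "norm (corr k p x) \<le> A"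
  using norm_corr_le[OF k posdefD(1)[OF p(1)] x, of A 1] A posdefD(4)[OF p(1)] p(2) by simp

text \<open>The supremum is taken over functions with value 1 at the unit, where correlations are
  bounded by the bound of \<open>k\<close>. Homogeneity extends the inequality to the whole cone, as
  the two summands of a splitting are not normalised. A nonzero correlation makes the supremum
  positive.\<close>

lemma maximising_sequence:
  assumes k: "cont k" and ex: "\<exists>p\<in>posdef. \<exists>x\<in>carrier G. corr k p x \<noteq> 0"
  obtains s p where "s > 0" "\<And>p. p \<in> posdef \<Longrightarrow> sqnorm (corr k p) \<le> s * (Re (p \<one>))\<^sup>2"
    "\<And>n. p n \<in> posdef" "\<And>n. p n \<one> = 1" "\<And>n. s - 1 / real (Suc n) \<le> sqnorm (corr k (p n))"
proof -
  define J where "J = (\<lambda>p. sqnorm (corr k p)) ` {p \<in> posdef. p \<one> = 1}"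
  define s where "s = Sup J"
  obtain A where A: "\<And>z. z \<in> carrier G \<Longrightarrow> norm (k z) \<le> A"
    using cont_bounded[OF k] by blast
  have bdd: "bdd_above J"
  proof (rule bdd_aboveI)
    fix r assume "r \<in> J"
    then obtain p where p: "p \<in> posdef" "p \<one> = 1" "r = sqnorm (corr k p)"
      unfolding J_def by blast
    show "r \<le> A\<^sup>2"
      unfolding p(3) using corr_bounded_on_posdef[OF k A p(1,2)]
      by (intro sqnorm_le cont_corr k posdefD(1)[OF p(1)])
  qed
  have norm1: "\<exists>q\<in>posdef. q \<one> = 1 \<and> (\<forall>x\<in>carrier G. corr k p x = of_real (Re (p \<one>)) * corr k q x)"
    if p: "p \<in> posdef" "Re (p \<one>) \<noteq> 0" for p
  proof (intro bexI conjI ballI)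
    define r where "r = Re (p \<one>)"
    have r: "r > 0" "p \<one> = of_real r"
      using posdefD(2,3)[OF p(1)] p(2) by (auto simp: r_def)
    show "(\<lambda>x. of_real (1 / r) * p x) \<in> posdef"
      using r by (intro posdef_scale p) auto
    show "of_real (1 / r) * p \<one> = 1"
      using r by simp
    show "corr k p x = of_real (Re (p \<one>)) * corr k (\<lambda>x. of_real (1 / r) * p x) x" if "x \<in> carrier G" for x
      unfolding corr_cmult[OF k posdefD(1)[OF p(1)] that] using r by simp
  qed
  have le: "sqnorm (corr k p) \<le> s * (Re (p \<one>))\<^sup>2" if p: "p \<in> posdef" for p
  proof (cases "Re (p \<one>) = 0")
    case True
    \<comment> \<open>A positive definite function is bounded by its value at the unit, so here
      \<open>p\<close> and its correlation vanish.\<close>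
    have "sqnorm (corr k p) \<le> 0\<^sup>2"
    proof (rule sqnorm_le)
      fix x assume x: "x \<in> carrier G"
      have "norm (corr k p x) \<le> A * 0"
        using posdefD(4)[OF p] True by (intro norm_corr_le k posdefD(1)[OF p] x A) auto
      then show "norm (corr k p x) \<le> 0" by simp
    qed (intro cont_corr k posdefD(1)[OF p])
    then show ?thesis using True by simp
  next
    case False
    obtain q where q: "q \<in> posdef" "q \<one> = 1" "\<And>x. x \<in> carrier G \<Longrightarrow> corr k p x = of_real (Re (p \<one>)) * corr k q x"
      using norm1[OF p False] by blast
    have cq: "cont (corr k q)"
      by (intro cont_corr k posdefD(1)[OF q(1)])
    have "sqnorm (corr k p) = sqnorm (\<lambda>x. of_real (Re (p \<one>)) * corr k q x + of_real 0 * corr k q x)"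
      by (intro sqnorm_cong) (simp add: q(3))
    also have "\<dots> = (Re (p \<one>))\<^sup>2 * sqnorm (corr k q)"
      using sqnorm_combine[OF cq cq, of "Re (p \<one>)" 0] by simp
    also have "\<dots> \<le> (Re (p \<one>))\<^sup>2 * s"
      unfolding s_def using q by (intro mult_left_mono cSup_upper bdd) (auto simp: J_def)
    finally show ?thesis by (simp add: mult.commute)
  qed
  obtain p x where px: "p \<in> posdef" "x \<in> carrier G" "corr k p x \<noteq> 0"
    using ex by blast
  have "sqnorm (corr k p) > 0"
    using px by (intro sqnorm_pos cont_corr k posdefD(1)) auto
  then have pos: "s * (Re (p \<one>))\<^sup>2 > 0"
    using le[OF px(1)] by linarith
  then have s: "s > 0"
    by (simp add: zero_less_mult_iff)
  have "Re (p \<one>) \<noteq> 0"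
    using pos by auto
  then have "J \<noteq> {}"
    using norm1[OF px(1)] unfolding J_def by blast
  have "\<exists>p. p \<in> posdef \<and> p \<one> = 1 \<and> s - 1 / real (Suc n) \<le> sqnorm (corr k p)" for n
  proof -
    have "s - 1 / real (Suc n) < Sup J" by (simp add: s_def)
    then obtain r where "r \<in> J" "s - 1 / real (Suc n) < r"
      using less_cSup_iff[OF \<open>J \<noteq> {}\<close> bdd] by blast
    then show ?thesis unfolding J_def by force
  qed
  then obtain P where "\<And>n. P n \<in> posdef" "\<And>n. P n \<one> = 1" "\<And>n. s - 1 / real (Suc n) \<le> sqnorm (corr k (P n))"
    by metis
  with that s le show ?thesis by blast
qed

text \<open>The functions \<open>corr k (p n)\<close> are equicontinuous, so they cluster uniformly.\<close>

lemma cluster_point: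
  fixes p :: "nat \<Rightarrow> 'a \<Rightarrow> complex"
  assumes k: "cont k" and p: "\<And>n. p n \<in> posdef" "\<And>n. p n \<one> = 1"
  obtains f g where "cont g"
    "\<And>e y. e > 0 \<Longrightarrow> y \<in> carrier G \<Longrightarrow>
       \<exists>n. 1 / real (Suc n) \<le> e \<and> (\<forall>x\<in>carrier G. norm (corr k (p n) x - g x) \<le> e) \<and> norm (p n y - f y) \<le> e"
proof -
  obtain A where A: "A > 0" "\<And>z. z \<in> carrier G \<Longrightarrow> norm (k z) \<le> A"
    using cont_bounded[OF k] by blast
  \<comment> \<open>The two sequences are packed into one, indexed by a Boolean and a point, with
    value 0 outside the carrier. Tychonoff's theorem then yields a common cluster point, at first
    for pointwise convergence only.\<close>
  define Q where "Q = (\<lambda>n (b, x). if x \<in> carrier G then if b then corr k (p n) x else p n x else 0)"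
  define R where "R = max 1 A"
  have "compactin (product_topology (\<lambda>i. euclidean) UNIV) (PiE UNIV (\<lambda>i::bool \<times> 'a. cball (0::complex) R))"
    by (subst compactin_PiE) auto
  then have comp: "compact (PiE UNIV (\<lambda>i::bool \<times> 'a. cball (0::complex) R))"
    by (simp add: euclidean_product_topology)
  have Q_in: "Q n \<in> PiE UNIV (\<lambda>i. cball 0 R)" for n
  proof (intro PiE_I)
    fix i :: "bool \<times> 'a"
    obtain b x where i: "i = (b, x)" by fastforce
    have "norm (corr k (p n) x) \<le> R" "norm (p n x) \<le> R" if "x \<in> carrier G"
      using corr_bounded_on_posdef[OF k A(2) p that] posdefD(4)[OF p(1) that, of n] p(2)[of n]
      by (auto simp: R_def intro: max.coboundedI1 max.coboundedI2)
    then show "Q n i \<in> cball 0 R"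
      using A(1) by (auto simp: Q_def i R_def)
  qed simp
  have "filtermap Q sequentially \<noteq> bot" "eventually (\<lambda>q. q \<in> PiE UNIV (\<lambda>i. cball 0 R)) (filtermap Q sequentially)"
    using Q_in by (auto simp: eventually_filtermap filtermap_bot_iff)
  then obtain q0 where q0: "inf (nhds q0) (filtermap Q sequentially) \<noteq> bot"
    using comp unfolding compact_filter by blast
  define F where "F = inf (nhds q0) (filtermap Q sequentially)"
  have F: "F \<noteq> bot" using q0 by (simp add: F_def)
  have lim: "((\<lambda>q. q i) \<longlongrightarrow> q0 i) F" for i
  proof -
    have "((\<lambda>q. q i) \<longlongrightarrow> q0 i) (nhds q0)"
    proof (rule topological_tendstoI)
      fix S :: "complex set" assume S: "open S" "q0 i \<in> S"
      then have "open ((\<lambda>q. q i) -` S)"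
        using continuous_on_product_coordinates[of i] by (intro open_vimage)
      with S(2) show "eventually (\<lambda>q. q i \<in> S) (nhds q0)"
        unfolding eventually_nhds by (intro exI[of _ "(\<lambda>q. q i) -` S"]) auto
    qed
    then show ?thesis
      unfolding F_def by (rule tendsto_mono[OF inf_le1])
  qed
  have evQ: "eventually (\<lambda>q. \<exists>n\<ge>N. q = Q n) F" for N
  proof -
    have "eventually (\<lambda>q. \<exists>n\<ge>N. q = Q n) (filtermap Q sequentially)"
      unfolding eventually_filtermap using eventually_ge_at_top[of N] by eventually_elim blast
    then show ?thesis
      unfolding F_def by (rule filter_leD[OF inf_le2])
  qed
  define g where "g = (\<lambda>x. q0 (True, x))"
  define f where "f = (\<lambda>x. q0 (False, x))"
  have equi: "\<exists>U. openin X U \<and> \<one> \<in> U \<and> (\<forall>u\<in>U. \<forall>x\<in>carrier G.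
      (\<forall>n. norm (corr k (p n) (u \<otimes> x) - corr k (p n) x) \<le> e) \<and> norm (g (u \<otimes> x) - g x) \<le> e)"
    if e: "e > 0" for e
  proof -
    obtain U where U: "openin X U" "\<one> \<in> U" and equi: "\<forall>p. cont p \<longrightarrow> (\<forall>z\<in>carrier G. norm (p z) \<le> 1) \<longrightarrow>
        (\<forall>u\<in>U. \<forall>x\<in>carrier G. norm (corr k p (u \<otimes> x) - corr k p x) \<le> e)"
      using corr_equicontinuous[OF k e] by (elim exE conjE)
    have le1: "\<forall>z\<in>carrier G. norm (p n z) \<le> 1" for n
      using posdefD(4)[OF p(1)] p(2) by simp
    have UG: "U \<subseteq> carrier G"
      using openin_subset[OF U(1)] by (simp add: topspace_carrier)
    have pn: "norm (corr k (p n) (u \<otimes> x) - corr k (p n) x) \<le> e" if "u \<in> U" "x \<in> carrier G" for n u x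
      using equi[rule_format, OF posdefD(1)[OF p(1)] _ that] le1 by blast
    moreover have "norm (g (u \<otimes> x) - g x) \<le> e" if ux: "u \<in> U" "x \<in> carrier G" for u x
    proof (rule tendsto_upperbound)
      show "((\<lambda>q. norm (q (True, u \<otimes> x) - q (True, x))) \<longlongrightarrow> norm (g (u \<otimes> x) - g x)) F"
        unfolding g_def by (intro tendsto_intros lim)
      show "\<forall>\<^sub>F q in F. norm (q (True, u \<otimes> x) - q (True, x)) \<le> e"
        using evQ[of 0]
      proof eventually_elim
        case (elim q)
        then show ?case
          using pn[OF ux] ux UG by (auto simp: Q_def)
      qed
    qed (rule F)
    ultimately show ?thesis
      using U by (intro exI[of _ U] conjI ballI allI)
  qed
  have g: "cont g"
  proof (rule continuous_if_uniformly_continuous)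
    fix e :: real assume "e > 0"
    from equi[OF this] obtain U where U: "openin X U" "\<one> \<in> U" and "\<forall>u\<in>U. \<forall>x\<in>carrier G.
      (\<forall>n. norm (corr k (p n) (u \<otimes> x) - corr k (p n) x) \<le> e) \<and> norm (g (u \<otimes> x) - g x) \<le> e"
      by (elim exE conjE)
    then have "\<forall>u\<in>U. \<forall>x\<in>carrier G. norm (g (u \<otimes> x) - g x) \<le> e"
      by simp
    with U show "\<exists>U. openin X U \<and> \<one> \<in> U \<and> (\<forall>u\<in>U. \<forall>x\<in>carrier G. norm (g (u \<otimes> x) - g x) \<le> e)"
      by (intro exI[of _ U] conjI)
  qed
  have "\<exists>n. 1 / real (Suc n) \<le> e \<and> (\<forall>x\<in>carrier G. norm (corr k (p n) x - g x) \<le> e) \<and> norm (p n y - f y) \<le> e"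
    if e: "e > 0" and y: "y \<in> carrier G" for e y
  proof -
    obtain N where N: "inverse (real (Suc N)) < e"
      using reals_Archimedean[OF e] by blast
    have e3: "e / 3 > 0" using e by simp
    obtain U where U: "openin X U" "\<one> \<in> U" and near: "\<forall>u\<in>U. \<forall>x\<in>carrier G.
      (\<forall>n. norm (corr k (p n) (u \<otimes> x) - corr k (p n) x) \<le> e/3) \<and> norm (g (u \<otimes> x) - g x) \<le> e/3"
      using equi[OF e3] by (elim exE conjE)
    \<comment> \<open>Every x equals (a x) inv a with a x in \<open>U\<close> for some a in the
      list. By equicontinuity, closeness at the finitely many points inv a therefore implies uniform
      closeness.\<close>
    obtain as where as: "translates as" "\<And>x. x \<in> carrier G \<Longrightarrow> \<exists>a\<in>set as. a \<otimes> x \<in> U"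
      using finite_translates_cover[OF U(1)] U(2) by blast
    have asG: "a \<in> carrier G" if "a \<in> set as" for a
      using as(1) that by (auto simp: translates_def)
    have "\<forall>\<^sub>F q in F. \<forall>a\<in>set as. dist (q (True, inv a)) (q0 (True, inv a)) < e/3"
      by (intro eventually_ball_finite ballI tendstoD[OF lim e3]) simp
    moreover have "\<forall>\<^sub>F q in F. dist (q (False, y)) (q0 (False, y)) < e"
      by (rule tendstoD[OF lim e])
    ultimately have "\<forall>\<^sub>F q in F. (\<exists>n\<ge>N. q = Q n) \<and> (\<forall>a\<in>set as. dist (q (True, inv a)) (q0 (True, inv a)) < e/3)
       \<and> dist (q (False, y)) (q0 (False, y)) < e"
      using evQ[of N] by (intro eventually_conj)
    from eventually_happens'[OF F this] obtain n where n: "n \<ge> N"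
      "\<forall>a\<in>set as. dist (Q n (True, inv a)) (q0 (True, inv a)) < e/3"
      "dist (Q n (False, y)) (q0 (False, y)) < e"
      by (elim exE conjE) simp
    have "norm (corr k (p n) x - g x) \<le> e" if x: "x \<in> carrier G" for x
    proof -
      obtain a where a: "a \<in> set as" "a \<otimes> x \<in> U" using as(2)[OF x] by blast
      have aG: "a \<in> carrier G" by (rule asG[OF a(1)])
      have eq: "(a \<otimes> x) \<otimes> inv a = x"
        using aG x by (metis inv_closed m_assoc m_comm r_inv r_one)
      have 1: "norm (corr k (p n) x - corr k (p n) (inv a)) \<le> e/3" "norm (g x - g (inv a)) \<le> e/3"
        using near[rule_format, OF a(2) inv_closed[OF aG]] by (auto simp: eq)
      have 2: "norm (corr k (p n) (inv a) - g (inv a)) \<le> e/3"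
        using n(2) a(1) aG by (auto simp: Q_def dist_norm g_def intro: less_imp_le)
      have "corr k (p n) x - g x = (corr k (p n) x - corr k (p n) (inv a)) + ((corr k (p n) (inv a) - g (inv a)) - (g x - g (inv a)))"
        by simp
      also have "norm \<dots> \<le> e/3 + (e/3 + e/3)"
        by (rule order_trans[OF norm_triangle_ineq add_mono[OF 1(1) order_trans[OF norm_triangle_ineq4 add_mono[OF 2 1(2)]]]])
      finally show ?thesis by simp
    qed
    moreover have "norm (p n y - f y) \<le> e"
      using n(3) y by (simp add: Q_def f_def dist_norm)
    moreover have "1 / real (Suc n) \<le> inverse (real (Suc N))"
      using n(1) by (simp add: field_simps)
    ultimately show ?thesis
      using N by (intro exI[of _ n]) auto
  qed
  with that g show ?thesis by blast
qed

section \<open>Characters of a compact abelian group separate points\<close>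

lemma continuous_function_separates:
  assumes "x \<in> carrier G" "y \<in> carrier G" "x \<noteq> y"
  shows "\<exists>f. cont f \<and> f x \<noteq> f y"
proof -
  have "normal_space X"
    using compact Hausdorff compact_Hausdorff_or_regular_imp_normal_space by blast
  moreover have "closedin X {x}" "closedin X {y}"
    using assms Hausdorff by (auto simp: closedin_Hausdorff_singleton topspace_carrier)
  moreover have "disjnt {x} {y}"
    using assms by simp
  ultimately obtain f where f: "continuous_map X euclideanreal f" "f ` {x} \<subseteq> {0}" "f ` {y} \<subseteq> {1}"
    using Urysohn_lemma_alt by metis
  have "cont (\<lambda>x. of_real (f x))"
    by (rule continuous_map_unop[OF f(1)]) (intro continuous_intros)
  then show ?thesis
    using f(2,3) by (intro exI[of _ "\<lambda>x. of_real (f x)"]) auto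
qed

text \<open>Twice the real part of the difference of the two values is the squared norm of t - t(b
  \<cdot>), which is positive because this function does not vanish at the unit.\<close>

lemma autocorr_separates:
  assumes t: "cont t" and b: "b \<in> carrier G" and ne: "t \<one> \<noteq> t b"
  shows "autocorr t \<one> \<noteq> autocorr t b"
proof
  assume eq: "autocorr t \<one> = autocorr t b"
  have tb: "cont (\<lambda>x. t (b \<otimes> x))"
    by (rule continuous_map_translate[OF t b])
  have c: "cont (\<lambda>x. cnj (t x) * t x)" "cont (\<lambda>x. cnj (t x) * t (b \<otimes> x))"
    by (intro cont_intros t tb)+
  have one: "mean (\<lambda>x. cnj (t x) * t x) = autocorr t \<one>"
    unfolding autocorr_def corr_def by (rule mean_cong) simp
  have "0 < sqnorm (\<lambda>x. t x - t (b \<otimes> x))"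
    using ne b by (intro sqnorm_pos[of _ \<one>] cont_intros t tb) auto
  also have "\<dots> = 2 * Re (mean (\<lambda>x. t x * cnj (t x - t (b \<otimes> x))))"
    by (rule sqnorm_diff_translate[OF t b])
  also have "mean (\<lambda>x. t x * cnj (t x - t (b \<otimes> x))) = mean (\<lambda>x. cnj (cnj (t x) * t x - cnj (t x) * t (b \<otimes> x)))"
    by (rule mean_cong) (simp add: algebra_simps)
  also have "\<dots> = cnj (autocorr t \<one> - autocorr t b)"
    unfolding mean_cnj[OF cont_diff[OF c]] mean_diff[OF c] one by (simp add: autocorr_def corr_def)
  finally show False
    using eq by simp
qed

text \<open>The limit \<open>g\<close> of the correlations is not 0 and satisfies g (x y) = f y * g
  x. Hence \<open>f\<close> is a translate of \<open>g\<close> up to a constant factor, and this is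
  where its continuity comes from: \<open>f\<close> itself arises as a pointwise cluster point
  only.\<close>

lemma character_separates:
  assumes b: "b \<in> carrier G" "b \<noteq> \<one>"
  shows "\<exists>f. cont f \<and> (\<forall>x\<in>carrier G. norm (f x) = 1) \<and>
    (\<forall>x\<in>carrier G. \<forall>y\<in>carrier G. f (x \<otimes> y) = f x * f y) \<and> f b \<noteq> 1"
proof -
  obtain t where t: "cont t" "t \<one> \<noteq> t b"
    using continuous_function_separates[OF one_closed b(1)] b(2) by metis
  define p0 where "p0 = autocorr t"
  have p0: "cont p0" "p0 \<one> \<noteq> p0 b"
    unfolding p0_def using cont_autocorr autocorr_separates t b(1) by auto
  have p0b: "cont (\<lambda>z. p0 (b \<otimes> z))"
    by (rule continuous_map_translate[OF p0(1) b(1)])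
  \<comment> \<open>With R the correlation of p with the conjugate of \<open>p0\<close>, the
    correlation of p with this kernel is R(x) - R(x inv b). It vanishes if p is invariant under b,
    while for p = \<open>p0\<close> its real part at the unit is half the squared norm of p0 - p0(b
    \<cdot>).\<close>
  define k where "k = (\<lambda>z. cnj (p0 z - p0 (b \<otimes> z)))"
  have k: "cont k"
    unfolding k_def by (intro cont_intros p0 p0b)
  have "p0 \<in> posdef"
    unfolding posdef_def p0_def using t(1) by (auto intro!: exI[of _ t] exI[of _ 1])
  moreover have "corr k p0 \<one> \<noteq> 0"
  proof -
    have "corr k p0 \<one> = mean (\<lambda>x. p0 x * cnj (p0 x - p0 (b \<otimes> x)))"
      unfolding corr_def k_def by (rule mean_cong) (simp add: mult.commute)
    then have "2 * Re (corr k p0 \<one>) = sqnorm (\<lambda>x. p0 x - p0 (b \<otimes> x))"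
      using sqnorm_diff_translate[OF p0(1) b(1)] by simp
    moreover have "sqnorm (\<lambda>x. p0 x - p0 (b \<otimes> x)) > 0"
      using p0 b by (intro sqnorm_pos[of _ \<one>] cont_intros p0b) auto
    ultimately show ?thesis by auto
  qed
  ultimately have "\<exists>p\<in>posdef. \<exists>x\<in>carrier G. corr k p x \<noteq> 0"
    by blast
  from maximising_sequence[OF k this] obtain s p where s: "s > 0"
    "\<And>p. p \<in> posdef \<Longrightarrow> sqnorm (corr k p) \<le> s * (Re (p \<one>))\<^sup>2"
    and p: "\<And>n. p n \<in> posdef" "\<And>n. p n \<one> = 1" "\<And>n. s - 1 / real (Suc n) \<le> sqnorm (corr k (p n))"
    by metis
  from cluster_point[where p = p, OF k p(1,2)] obtain f g where g: "cont g" and small: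
    "\<And>e y. e > 0 \<Longrightarrow> y \<in> carrier G \<Longrightarrow>
       \<exists>n. 1 / real (Suc n) \<le> e \<and> (\<forall>x\<in>carrier G. norm (corr k (p n) x - g x) \<le> e) \<and> norm (p n y - f y) \<le> e"
    by metis
  have cp: "cont (p n)" "cont (corr k (p n))" for n
    using posdefD(1)[OF p(1)] by (auto intro: cont_corr k)
  have f_le: "norm (f y) \<le> 1" if y: "y \<in> carrier G" for y
  proof (rule field_le_epsilon)
    fix e :: real assume e: "e > 0"
    obtain n where n: "norm (p n y - f y) \<le> e"
      using small[OF e y] by blast
    have "norm (p n y) \<le> 1"
      using posdefD(4)[OF p(1) y] p(2) by simp
    then show "norm (f y) \<le> 1 + e"
      using n norm_triangle_sub[of "f y" "p n y"] by (simp add: norm_minus_commute)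
  qed
  obtain A where A: "A > 0" "\<And>z. z \<in> carrier G \<Longrightarrow> norm (g z) \<le> A"
    using cont_bounded[OF g] by blast
  have mult: "g (x \<otimes> y) = f y * g x" if x: "x \<in> carrier G" and y: "y \<in> carrier G" for x y
  proof -
    define d where "d = (\<lambda>x. g (x \<otimes> y) - f y * g x)"
    have d: "cont d"
      unfolding d_def using y by (intro cont_intros continuous_map_rtranslate g)
    have "d x = 0"
    proof (rule ccontr)
      assume "d x \<noteq> 0"
      then have pos: "sqnorm d > 0"
        by (rule sqnorm_pos[OF d x])
      \<comment> \<open>In d = dn - W the error W is at most e (2 + A), and \<open>sqnorm dn\<close>
        is at most 4 e. Together with e \<le> 1 this gives sqnorm d \<le> e C.\<close>
      define C where "C = 8 + 2 * (2 + A)\<^sup>2"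
      have C: "C > 0" unfolding C_def by (simp add: add_pos_nonneg)
      define e where "e = min 1 (sqnorm d / (2 * C))"
      have e: "e > 0" "e \<le> 1" "e * C \<le> sqnorm d / 2"
        using pos C by (auto simp: e_def min_def field_simps)
      obtain n where n: "1 / real (Suc n) \<le> e" "\<And>x. x \<in> carrier G \<Longrightarrow> norm (corr k (p n) x - g x) \<le> e"
          "norm (p n y - f y) \<le> e"
        using small[OF e(1) y] by blast
      define P where "P = corr k (p n)"
      define dn where "dn = (\<lambda>x. P (x \<otimes> y) - p n y * P x)"
      have dn: "cont dn"
        unfolding dn_def P_def using y by (intro cont_intros continuous_map_rtranslate cp)
      have "sqnorm dn \<le> 4 * (1 / real (Suc n))"
        unfolding dn_def P_def by (rule near_maximal[OF k s(2) p(1,2,3) _ y]) simp_all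
      moreover have "sqnorm d \<le> 2 * sqnorm dn + 2 * sqnorm (\<lambda>x. of_real (e * (2 + A)))"
      proof (rule sqnorm_le_combine[OF d dn cont_const])
        fix x assume x: "x \<in> carrier G"
        define W where "W = (P (x \<otimes> y) - g (x \<otimes> y)) - (p n y * (P x - g x) + (p n y - f y) * g x)"
        have "d x = dn x - W"
          unfolding d_def dn_def W_def by (simp add: algebra_simps)
        moreover have "norm W \<le> e + (1 * e + e * A)"
        proof -
          have "norm (P (x \<otimes> y) - g (x \<otimes> y)) \<le> e"
            unfolding P_def using n(2) x y by simp
          moreover have "norm (p n y * (P x - g x)) \<le> 1 * e"
            unfolding norm_mult P_def using posdefD(4)[OF p(1) y, of n] p(2) n(2)[OF x]
            by (intro mult_mono) auto
          moreover have "norm ((p n y - f y) * g x) \<le> e * A"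
            unfolding norm_mult using n(3) A(2)[OF x] e by (intro mult_mono) auto
          moreover have "norm (a - (b + c)) \<le> norm a + (norm b + norm c)" for a b c :: complex
            using norm_triangle_ineq4[of a "b + c"] norm_triangle_ineq[of b c] by linarith
          ultimately show ?thesis
            unfolding W_def by (meson add_mono order_trans)
        qed
        ultimately have "norm (d x) \<le> norm (dn x) + (e + (1 * e + e * A))"
          using norm_triangle_ineq4[of "dn x" W] by simp
        also have "\<dots> = norm (dn x) + e * (2 + A)"
          by (simp add: algebra_simps)
        finally have "norm (d x) \<le> norm (dn x) + e * (2 + A)" .
        then have "(norm (d x))\<^sup>2 \<le> (norm (dn x) + e * (2 + A))\<^sup>2"
          by (intro power_mono) auto
        also have "\<dots> \<le> 2 * (norm (dn x))\<^sup>2 + 2 * (e * (2 + A))\<^sup>2"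
          using sum_squares_bound[of "norm (dn x)" "e * (2 + A)"] by (simp add: power2_sum)
        finally show "(norm (d x))\<^sup>2 \<le> 2 * (norm (dn x))\<^sup>2 + 2 * (norm (of_real (e * (2 + A)) :: complex))\<^sup>2"
          by (simp only: norm_of_real power2_abs)
      qed
      moreover have "sqnorm (\<lambda>x. of_real (e * (2 + A))) = (e * (2 + A))\<^sup>2"
        unfolding sqnorm_const by (simp only: norm_of_real power2_abs)
      moreover have "(e * (2 + A))\<^sup>2 \<le> e * (2 + A)\<^sup>2"
        unfolding power_mult_distrib power2_eq_square[of e]
        using e by (intro mult_right_mono mult_left_le) auto
      ultimately have "sqnorm d \<le> 8 * (1 / real (Suc n)) + 2 * (e * (2 + A)\<^sup>2)"
        by linarith
      also have "\<dots> \<le> e * C"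
        using n(1) unfolding C_def by (simp add: algebra_simps)
      finally show False using e(3) pos by linarith
    qed
    then show ?thesis by (simp add: d_def)
  qed
  have "\<exists>x0\<in>carrier G. g x0 \<noteq> 0"
  proof (rule ccontr)
    assume "\<not> (\<exists>x0\<in>carrier G. g x0 \<noteq> 0)"
    then have g0: "g x = 0" if "x \<in> carrier G" for x using that by blast
    \<comment> \<open>If g were 0, some correlation would be uniformly at most e and have squared
      norm at most e^2 \<le> e, although that norm is at least s - e.\<close>
    define e where "e = min 1 (s / 3)"
    have e: "e > 0" "e \<le> 1" "3 * e \<le> s"
      using s(1) by (auto simp: e_def)
    obtain n where n: "1 / real (Suc n) \<le> e" "\<And>x. x \<in> carrier G \<Longrightarrow> norm (corr k (p n) x - g x) \<le> e"
      using small[OF e(1) one_closed] by blast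
    have "sqnorm (corr k (p n)) \<le> e\<^sup>2"
      using n(2) g0 by (intro sqnorm_le cp) fastforce
    moreover have "e\<^sup>2 \<le> e"
      using e by (simp add: power2_eq_square mult_left_le)
    ultimately show False
      using p(3)[of n] n(1) e by linarith
  qed
  then obtain x0 where x0: "x0 \<in> carrier G" "g x0 \<noteq> 0" by blast
  have f_eq: "f y = inverse (g x0) * g (x0 \<otimes> y)" if "y \<in> carrier G" for y
    using mult[OF x0(1) that] x0(2) by simp
  have "cont (\<lambda>y. inverse (g x0) * g (x0 \<otimes> y))"
    by (intro cont_intros continuous_map_translate[OF g x0(1)])
  then have cf: "cont f"
    by (rule cont_cong) (simp add: f_eq)
  have fmult: "f (x \<otimes> y) = f x * f y" if "x \<in> carrier G" "y \<in> carrier G" for x y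
  proof -
    have "f (x \<otimes> y) * g x0 = f y * (f x * g x0)"
      using mult[OF x0(1), of "x \<otimes> y"] mult[of "x0 \<otimes> x" y] mult[OF x0(1), of x] that x0(1)
      by (simp add: m_assoc)
    then show ?thesis using x0(2) by simp
  qed
  have f1: "f \<one> = 1"
    using f_eq[OF one_closed] x0 by simp
  have norm_f: "norm (f x) = 1" if x: "x \<in> carrier G" for x
  proof (rule antisym)
    have "1 = norm (f x) * norm (f (inv x))"
      using fmult[OF x inv_closed[OF x]] x f1 by (simp flip: norm_mult)
    also have "\<dots> \<le> norm (f x) * 1"
      using f_le x by (intro mult_left_mono) auto
    finally show "1 \<le> norm (f x)" by simp
  qed (rule f_le[OF x])
  have "f b \<noteq> 1"
  proof
    assume fb: "f b = 1"
    obtain B where B: "B > 0" "\<And>z. z \<in> carrier G \<Longrightarrow> norm (p0 z) \<le> B"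
      using cont_bounded[OF p0(1)] by blast
    \<comment> \<open>If f b = 1, then g is constant along this orbit, so that sums of nearby
      correlations along it grow linearly. But these sums telescope to a difference of two values of
      R, which stays below 2 B.\<close>
    define w where "w = (\<lambda>m::nat. x0 \<otimes> b [^] m)"
    have w: "w m \<in> carrier G" "w (Suc m) = w m \<otimes> b" for m
      using x0(1) b(1) by (simp_all add: w_def m_assoc)
    have gw: "g (w m) = g x0" for m
    proof (induction m)
      case (Suc m)
      then show ?case using mult[OF w(1) b(1), of m] fb w(2) by simp
    qed (use x0 in \<open>simp add: w_def\<close>)
    have cp0: "cont (\<lambda>z. cnj (p0 z))" by (intro cont_intros p0)
    have tele: "norm (\<Sum>m<N. corr k (p n) (w (Suc m))) \<le> 2 * B" for n N
    proof -
      define R where "R = corr (\<lambda>z. cnj (p0 z)) (p n)"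
      have R: "norm (R (w m)) \<le> B" for m
        using norm_corr_le[OF cp0 cp(1) w(1), where A = B and B = 1] B(2) posdefD(4)[OF p(1)] p(2) unfolding R_def by simp
      have "corr k (p n) (w (Suc m)) = R (w (Suc m)) - R (w m)" for m
      proof -
        have c: "cont (\<lambda>z. cnj (p0 z) * p n (w (Suc m) \<otimes> z))" "cont (\<lambda>z. cnj (p0 z) * p n (w m \<otimes> z))"
          by (intro cont_corr_integrand cp0 cp w(1))+
        have "w (Suc m) \<otimes> z = w m \<otimes> (b \<otimes> z)" if "z \<in> carrier G" for z
          using that w b(1) by (simp add: m_assoc)
        then have "mean (\<lambda>z. cnj (p0 (b \<otimes> z)) * p n (w (Suc m) \<otimes> z)) = mean (\<lambda>z. cnj (p0 (b \<otimes> z)) * p n (w m \<otimes> (b \<otimes> z)))"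
          by (intro mean_cong) simp
        also have "\<dots> = R (w m)"
          unfolding R_def corr_def using mean_translate[OF c(2) b(1)] by simp
        finally have eq: "mean (\<lambda>z. cnj (p0 (b \<otimes> z)) * p n (w (Suc m) \<otimes> z)) = R (w m)" .
        have cb: "cont (\<lambda>z. cnj (p0 (b \<otimes> z)) * p n (w (Suc m) \<otimes> z))"
          by (intro cont_corr_integrand cont_cnj p0b cp w(1))
        have "corr k (p n) (w (Suc m)) = mean (\<lambda>z. cnj (p0 z) * p n (w (Suc m) \<otimes> z) - cnj (p0 (b \<otimes> z)) * p n (w (Suc m) \<otimes> z))"
          unfolding corr_def k_def by (simp add: left_diff_distrib)
        also have "\<dots> = R (w (Suc m)) - R (w m)"
          unfolding mean_diff[OF c(1) cb] eq by (simp add: R_def corr_def)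
        finally show ?thesis .
      qed
      then have "(\<Sum>m<N. corr k (p n) (w (Suc m))) = R (w N) - R (w 0)"
        by (simp add: sum_lessThan_telescope[of "\<lambda>m. R (w m)"])
      then show ?thesis
        using norm_triangle_ineq4[of "R (w N)" "R (w 0)"] R[of N] R[of 0] by simp
    qed
    \<comment> \<open>With e half of |g x0|, the sum of N terms has modulus at least N e, and this N
      makes N e exceed 2 B.\<close>
    obtain N where N: "real N > 4 * B / norm (g x0)"
      using reals_Archimedean2 by blast
    define e where "e = norm (g x0) / 2"
    have e: "e > 0" using x0(2) by (simp add: e_def)
    obtain n where n: "\<And>x. x \<in> carrier G \<Longrightarrow> norm (corr k (p n) x - g x) \<le> e"
      using small[OF e one_closed] by blast
    have "norm (\<Sum>m<N. corr k (p n) (w (Suc m)) - g (w (Suc m))) \<le> (\<Sum>m<N. e)"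
      by (intro sum_norm_le n w(1))
    then have "norm ((\<Sum>m<N. corr k (p n) (w (Suc m))) - of_nat N * g x0) \<le> real N * e"
      unfolding gw by (simp add: sum_subtractf)
    then have "norm (of_nat N * g x0) \<le> 2 * B + real N * e"
      using norm_triangle_sub[of "of_nat N * g x0" "\<Sum>m<N. corr k (p n) (w (Suc m))"] tele[of n N]
      by (simp add: norm_minus_commute)
    then have "real N * e \<le> 2 * B"
      by (simp add: norm_mult e_def)
    moreover have "real N * e > 2 * B"
      using N x0(2) by (simp add: e_def field_simps)
    ultimately show False by simp
  qed
  with cf norm_f fmult show ?thesis by blast
qed

end

section \<open>Abelian topological inverse monoids\<close>

lemma (in topological_inverse_monoid) is_sg_inverse_sg_inv:
  "x \<in> carrier S \<Longrightarrow> is_sg_inverse S x (sg_inv S x)"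
  unfolding sg_inv_def by (rule theI') (rule unique_inverse)

lemma (in topological_inverse_monoid) sg_inv_eqI:
  "x \<in> carrier S \<Longrightarrow> is_sg_inverse S x y \<Longrightarrow> sg_inv S x = y"
  using unique_inverse is_sg_inverse_sg_inv by blast

locale abelian_topological_inverse_monoid =
  topological_inverse_monoid S + comm_monoid S for S :: "'a top_monoid" (structure)
begin

abbreviation star :: "'a \<Rightarrow> 'a" where "star x \<equiv> sg_inv S x"

text \<open>The idempotent whose maximal group contains x. In the abelian case it defines a
  homomorphic retraction of \<open>S\<close> onto its idempotents.\<close>

definition dom :: "'a \<Rightarrow> 'a" where "dom x = x \<otimes> star x"

lemma star_closed [simp]: "x \<in> carrier S \<Longrightarrow> star x \<in> carrier S"
  and mult_star_mult: "x \<in> carrier S \<Longrightarrow> x \<otimes> star x \<otimes> x = x"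
  and star_mult_star: "x \<in> carrier S \<Longrightarrow> star x \<otimes> x \<otimes> star x = star x"
  using is_sg_inverse_sg_inv unfolding is_sg_inverse_def by blast+

lemma star_star: "x \<in> carrier S \<Longrightarrow> star (star x) = x"
  by (rule sg_inv_eqI) (simp_all add: is_sg_inverse_def mult_star_mult star_mult_star)

lemma star_mult:
  assumes "x \<in> carrier S" "y \<in> carrier S"
  shows "star (x \<otimes> y) = star x \<otimes> star y"
proof (rule sg_inv_eqI)
  have "(x \<otimes> y) \<otimes> (star x \<otimes> star y) \<otimes> (x \<otimes> y) = (x \<otimes> star x \<otimes> x) \<otimes> (y \<otimes> star y \<otimes> y)"
    using assms by (simp add: m_ac)
  moreover have "(star x \<otimes> star y) \<otimes> (x \<otimes> y) \<otimes> (star x \<otimes> star y)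
      = (star x \<otimes> x \<otimes> star x) \<otimes> (star y \<otimes> y \<otimes> star y)"
    using assms by (simp add: m_ac)
  ultimately show "is_sg_inverse S (x \<otimes> y) (star x \<otimes> star y)"
    unfolding is_sg_inverse_def using assms by (simp add: mult_star_mult star_mult_star)
qed (use assms in simp)

lemma idemD: "e \<in> idempotents S \<Longrightarrow> e \<in> carrier S" "e \<in> idempotents S \<Longrightarrow> e \<otimes> e = e"
  by (auto simp: idempotents_def)

lemma star_idem: "e \<in> idempotents S \<Longrightarrow> star e = e"
  by (rule sg_inv_eqI) (auto simp: is_sg_inverse_def idempotents_def)

lemma one_idem: "\<one> \<in> idempotents S"
  by (simp add: idempotents_def)

lemma idem_mult:
  assumes "e \<in> idempotents S" "f \<in> idempotents S"
  shows "e \<otimes> f \<in> idempotents S"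
proof -
  have "(e \<otimes> f) \<otimes> (e \<otimes> f) = (e \<otimes> e) \<otimes> (f \<otimes> f)"
    using idemD(1)[OF assms(1)] idemD(1)[OF assms(2)] by (simp add: m_ac)
  then show ?thesis
    using assms by (simp add: idempotents_def)
qed

lemma dom_closed [simp]: "x \<in> carrier S \<Longrightarrow> dom x \<in> carrier S"
  by (simp add: dom_def)

lemma dom_mult_self: "x \<in> carrier S \<Longrightarrow> dom x \<otimes> x = x"
  by (simp add: dom_def mult_star_mult)

lemma dom_idem: "x \<in> carrier S \<Longrightarrow> dom x \<in> idempotents S"
  unfolding idempotents_def by (simp add: dom_def m_assoc[symmetric] mult_star_mult)

lemma dom_of_idem: "e \<in> idempotents S \<Longrightarrow> dom e = e"
  by (simp add: dom_def star_idem idemD)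

lemma dom_mult: "x \<in> carrier S \<Longrightarrow> y \<in> carrier S \<Longrightarrow> dom (x \<otimes> y) = dom x \<otimes> dom y"
  by (simp add: dom_def star_mult m_ac)

lemma dom_star: "x \<in> carrier S \<Longrightarrow> dom (star x) = dom x"
  by (simp add: dom_def star_star m_comm)

lemma maximal_group_eq: "maximal_group S e = {x \<in> carrier S. dom x = e}"
  unfolding maximal_group_def dom_def by (auto simp: m_comm)

lemma idem_in_maximal_group: "e \<in> idempotents S \<Longrightarrow> e \<in> maximal_group S e"
  by (simp add: maximal_group_eq dom_of_idem idemD)

text \<open>Multiplication by a smaller idempotent e is the connecting homomorphism of the Clifford
  semigroup \<open>S\<close>, from the group at \<open>dom x\<close> to the group at e.\<close>

lemma mult_in_maximal_group:
  "x \<in> carrier S \<Longrightarrow> e \<in> idempotents S \<Longrightarrow> e \<otimes> dom x = e \<Longrightarrow> x \<otimes> e \<in> maximal_group S e"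
  by (simp add: maximal_group_eq dom_mult dom_of_idem idemD m_comm)

lemma continuous_mult': "continuous_map Z (topo S) f \<Longrightarrow> continuous_map Z (topo S) g \<Longrightarrow>
    continuous_map Z (topo S) (\<lambda>z. f z \<otimes> g z)"
  using continuous_map_compose[OF continuous_map_pairedI continuous_mult] by (simp add: o_def)

lemma continuous_mult_right: "a \<in> carrier S \<Longrightarrow> continuous_map (topo S) (topo S) (\<lambda>x. x \<otimes> a)"
  by (intro continuous_mult') (auto simp: topspace_eq)

lemma continuous_dom: "continuous_map (topo S) (topo S) dom"
  unfolding dom_def[abs_def] by (intro continuous_mult' continuous_inverse) auto

text \<open>The unit of the group is \<open>e\<close> and not that of \<open>S\<close>, hence the
  new record. Its group inverse agrees with \<open>star\<close>, through which it inherits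
  continuity.\<close>

lemma maximal_group_comm_group:
  assumes e: "e \<in> idempotents S"
  defines "G \<equiv> \<lparr>carrier = maximal_group S e, mult = (\<otimes>), one = e\<rparr>"
  shows "comm_group G" and "\<And>x. x \<in> maximal_group S e \<Longrightarrow> inv\<^bsub>G\<^esub> x = star x"
proof -
  have H: "x \<in> carrier S" "dom x = e" "e \<otimes> x = x" if "x \<in> maximal_group S e" for x
    using that dom_mult_self[of x] by (auto simp: maximal_group_eq)
  have star_H: "star x \<in> maximal_group S e" if "x \<in> maximal_group S e" for x
    using H[OF that] by (simp add: maximal_group_eq dom_star)
  have star_mult: "star x \<otimes> x = e" if "x \<in> maximal_group S e" for x
    using H[OF that] by (simp add: dom_def m_comm)
  show "comm_group G"
  proof (rule comm_groupI)
    fix x y assume "x \<in> carrier G" "y \<in> carrier G"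
    then show "x \<otimes>\<^bsub>G\<^esub> y \<in> carrier G" "x \<otimes>\<^bsub>G\<^esub> y = y \<otimes>\<^bsub>G\<^esub> x"
      using idemD(2)[OF e] by (simp_all add: G_def maximal_group_eq dom_mult m_comm)
  next
    fix x y z assume "x \<in> carrier G" "y \<in> carrier G" "z \<in> carrier G"
    then show "x \<otimes>\<^bsub>G\<^esub> y \<otimes>\<^bsub>G\<^esub> z = x \<otimes>\<^bsub>G\<^esub> (y \<otimes>\<^bsub>G\<^esub> z)"
      using H by (simp add: G_def m_assoc)
  next
    fix x assume "x \<in> carrier G"
    then show "\<one>\<^bsub>G\<^esub> \<otimes>\<^bsub>G\<^esub> x = x" "\<exists>y\<in>carrier G. y \<otimes>\<^bsub>G\<^esub> x = \<one>\<^bsub>G\<^esub>"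
      using H star_H star_mult by (auto simp: G_def intro!: bexI[of _ "star x"])
  qed (simp add: G_def idem_in_maximal_group[OF e])
  then interpret G: comm_group G .
  show "inv\<^bsub>G\<^esub> x = star x" if "x \<in> maximal_group S e" for x
    using that star_H star_mult by (intro G.inv_equality) (auto simp: G_def)
qed

lemma maximal_group_compact_abelian_group:
  assumes e: "e \<in> idempotents S"
    and compact: "compact_space (subtopology (topo S) (maximal_group S e))"
  shows "compact_abelian_group \<lparr>carrier = maximal_group S e, mult = (\<otimes>), one = e\<rparr>
    (subtopology (topo S) (maximal_group S e))"
proof -
  define G where "G = \<lparr>carrier = maximal_group S e, mult = (\<otimes>), one = e\<rparr>"
  define Y where "Y = subtopology (topo S) (maximal_group S e)"
  interpret G: comm_group G
    unfolding G_def by (rule maximal_group_comm_group(1)[OF e])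
  have carrier: "carrier G = maximal_group S e" by (simp add: G_def)
  have sub: "maximal_group S e \<subseteq> carrier S"
    by (auto simp: maximal_group_eq)
  have top: "topspace Y = maximal_group S e"
    using sub by (auto simp: Y_def topspace_eq)
  have cY: "continuous_map Y (topo S) (\<lambda>x. x)"
    unfolding Y_def using continuous_map_from_subtopology by fastforce
  have "compact_abelian_group G Y"
  proof unfold_locales
    show "topspace Y = carrier G" by (simp add: top carrier)
    show "compact_space Y" using compact by (simp add: Y_def)
    show "Hausdorff_space Y" unfolding Y_def by (intro Hausdorff_space_subtopology Hausdorff)
    have "continuous_map (prod_topology Y Y) (topo S) (\<lambda>p. fst p \<otimes> snd p)"
      by (intro continuous_mult' continuous_map_compose[OF continuous_map_fst cY, unfolded o_def]
          continuous_map_compose[OF continuous_map_snd cY, unfolded o_def])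
    then show "continuous_map (prod_topology Y Y) Y (\<lambda>(x, y). x \<otimes>\<^bsub>G\<^esub> y)"
      using G.m_closed unfolding Y_def continuous_map_in_subtopology
      by (auto simp: case_prod_unfold top[unfolded Y_def] carrier G_def)
    have "continuous_map Y (topo S) star"
      using continuous_map_compose[OF cY continuous_inverse] by (simp add: o_def)
    moreover have "star ` topspace Y \<subseteq> maximal_group S e"
      by (auto simp: top maximal_group_eq dom_star)
    ultimately have "continuous_map Y Y star"
      unfolding Y_def continuous_map_in_subtopology by auto
    then show "continuous_map Y Y (\<lambda>x. inv\<^bsub>G\<^esub> x)"
      by (rule continuous_map_eq) (simp add: top G_def maximal_group_comm_group(2)[OF e])
  qed
  then show ?thesis by (simp add: G_def Y_def)
qed

text \<open>Finitely many elements of \<open>F\<close> have a lower bound in \<open>F\<close>,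
  formed by multiplication. The condition z f = z on z is closed, so compactness gives a lower bound
  for all of \<open>F\<close> at once.\<close>

lemma compact_semilattice_has_minimum:
  assumes F: "compactin (topo S) F" "F \<subseteq> idempotents S" "F \<noteq> {}"
    and mult: "\<And>e f. e \<in> F \<Longrightarrow> f \<in> F \<Longrightarrow> e \<otimes> f \<in> F"
  shows "\<exists>m\<in>F. \<forall>f\<in>F. m \<otimes> f = m"
proof -
  let ?C = "\<lambda>f. {z \<in> topspace (topo S). z \<otimes> f = z}"
  have FG: "f \<in> carrier S" "f \<otimes> f = f" if "f \<in> F" for f
    using that F(2) idemD by auto
  have fin: "\<exists>m\<in>F. \<forall>f\<in>A. m \<otimes> f = m" if "finite A" "A \<subseteq> F" for A
    using that
  proof (induction A rule: finite_induct)
    case (insert a A)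
    then obtain m where m: "m \<in> F" "\<forall>f\<in>A. m \<otimes> f = m" by auto
    have "(m \<otimes> a) \<otimes> f = m \<otimes> a" if "f \<in> insert a A" for f
    proof -
      have fF: "f \<in> F" using that insert.prems by blast
      have "(m \<otimes> a) \<otimes> f = (m \<otimes> f) \<otimes> a"
        using FG fF m(1) insert.prems by (simp add: m_ac)
      moreover have "(m \<otimes> a) \<otimes> a = m \<otimes> a"
        using FG m(1) insert.prems by (simp add: m_assoc)
      ultimately show ?thesis using that m(2) by auto
    qed
    moreover have "m \<otimes> a \<in> F" using mult m(1) insert.prems by simp
    ultimately show ?case by blast
  qed (use F(3) in auto)
  have closed: "closedin (topo S) (?C f)" if "f \<in> F" for f
    by (rule closedin_continuous_maps_eq[OF Hausdorff]) (use FG(1)[OF that] continuous_mult_right in auto)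
  have fip: "F \<inter> \<Inter>\<F> \<noteq> {}" if \<F>: "finite \<F> \<and> \<F> \<subseteq> ?C ` F" for \<F>
  proof -
    obtain A where A: "A \<subseteq> F" "finite A" "\<F> = ?C ` A"
      using finite_subset_image[OF conjunct1[OF \<F>] conjunct2[OF \<F>]] by (elim exE conjE)
    obtain m where "m \<in> F" "\<forall>f\<in>A. m \<otimes> f = m"
      using fin[OF A(2,1)] by blast
    then have "m \<in> F \<inter> \<Inter>\<F>"
      unfolding A(3) using FG by (auto simp: topspace_eq)
    then show ?thesis by blast
  qed
  have "F \<inter> \<Inter>(?C ` F) \<noteq> {}"
    by (rule F(1)[unfolded compactin_fip, THEN conjunct2, rule_format]) (use closed fip in auto)
  then show ?thesis by auto
qed

end

section \<open>Discreteness of the dual\<close>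

lemma openin_T_dot: "open U \<Longrightarrow> openin (topo T_dot) ({z. cmod z \<in> {0, 1}} \<inter> U)"
  by (auto simp: T_dot_def openin_open)

lemma characters_iff:
  assumes "Group.monoid S" "topspace (topo S) = carrier S"
  shows "h \<in> characters S \<longleftrightarrow> h \<in> extensional (carrier S) \<and> h \<one>\<^bsub>S\<^esub> = 1 \<and>
    (\<forall>x\<in>carrier S. cmod (h x) \<in> {0, 1}) \<and>
    (\<forall>x\<in>carrier S. \<forall>y\<in>carrier S. h (x \<otimes>\<^bsub>S\<^esub> y) = h x * h y) \<and>
    continuous_map (topo S) euclidean h"
  using assms(2) unfolding characters_def monoid_hom_def hom_def T_dot_def
  by (auto simp: continuous_map_in_subtopology)

lemma openin_compact_open_subbase:
  "compactin X K \<Longrightarrow> openin Y U \<Longrightarrow> openin (compact_open_topology X Y F) {f \<in> F. f ` K \<subseteq> U}"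
  unfolding compact_open_topology_def by (rule topology_generated_by_Basis) blast

text \<open>Squaring a point z of the circle at distance less than 1 from 1 multiplies this distance
  by |z + 1| \<ge> 3/2. The iterated squares of some w \<noteq> 1 would leave the disc.\<close>

lemma no_small_subgroups:
  fixes w :: complex
  assumes w: "cmod w = 1" and small: "\<And>n. cmod (w ^ n - 1) < 1"
  shows "w = 1"
proof (rule ccontr)
  assume "w \<noteq> 1"
  have step: "cmod (z\<^sup>2 - 1) \<ge> cmod (z - 1) * (3/2)" if z: "cmod z = 1" "cmod (z - 1) < 1" for z
  proof -
    have "(cmod (z - 1))\<^sup>2 < 1"
      using z(2) by (simp add: power_less_one_iff abs_square_less_1)
    moreover have "(Re z)\<^sup>2 + (Im z)\<^sup>2 = 1"
      using z(1) cmod_power2[of z] by simp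
    ultimately have "Re z > 1/2"
      using cmod_power2[of "z - 1"] by (simp add: power2_eq_square algebra_simps)
    then have "cmod (z + 1) \<ge> 3/2"
      using complex_Re_le_cmod[of "z + 1"] by simp
    then have "cmod (z - 1) * (3/2) \<le> cmod (z - 1) * cmod (z + 1)"
      by (intro mult_left_mono) auto
    also have "\<dots> = cmod (z\<^sup>2 - 1)"
      unfolding norm_mult[symmetric] by (simp add: power2_eq_square algebra_simps)
    finally show ?thesis .
  qed
  have grow: "cmod (w ^ (2 ^ k) - 1) \<ge> cmod (w - 1) * (3/2) ^ k" for k
  proof (induction k)
    case (Suc k)
    have "cmod (w - 1) * (3/2) ^ Suc k \<le> cmod (w ^ (2 ^ k) - 1) * (3/2)"
      using Suc by simp
    also have "\<dots> \<le> cmod ((w ^ (2 ^ k))\<^sup>2 - 1)"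
      using w small by (intro step) (simp_all add: norm_power)
    also have "(w ^ (2 ^ k))\<^sup>2 = w ^ (2 ^ Suc k)"
      by (simp add: power_mult[symmetric] mult.commute)
    finally show ?case .
  qed simp
  obtain k where "1 / cmod (w - 1) < (3/2) ^ k"
    using real_arch_pow[of "3/2" "1 / cmod (w - 1)"] by auto
  then have "1 < cmod (w - 1) * (3/2) ^ k"
    using \<open>w \<noteq> 1\<close> by (simp add: divide_less_eq mult.commute)
  then show False
    using grow[of k] small[of "2 ^ k"] by linarith
qed

context abelian_topological_inverse_monoid
begin

lemmas character_iff = characters_iff[OF monoid_axioms topspace_eq]

lemma characterD:
  assumes "h \<in> characters S"
  shows "h \<in> extensional (carrier S)" "h \<one> = 1"
    "x \<in> carrier S \<Longrightarrow> cmod (h x) = 0 \<or> cmod (h x) = 1"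
    "x \<in> carrier S \<Longrightarrow> y \<in> carrier S \<Longrightarrow> h (x \<otimes> y) = h x * h y"
    "continuous_map (topo S) euclidean h"
  using assms unfolding character_iff by auto

lemma character_idem: "h \<in> characters S \<Longrightarrow> e \<in> idempotents S \<Longrightarrow> h e = 0 \<or> h e = 1"
  using characterD(4)[of h e e] idemD[of e] by simp

text \<open>Composing \<open>h\<close> with \<open>dom\<close> gives the indicator of the support of
  \<open>h\<close>, so zeros of a character can be tested on idempotents.\<close>

lemma character_dom: 
  assumes h: "h \<in> characters S" and x: "x \<in> carrier S"
  shows "h (dom x) = (if h x = 0 then 0 else 1)"
proof -
  have "h x = h (dom x) * h x"
    using characterD(4)[OF h dom_closed[OF x] x] dom_mult_self[OF x] by simp
  moreover have "h (dom x) = h x * h (star x)"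
    using characterD(4)[OF h x star_closed[OF x]] by (simp add: dom_def)
  ultimately show ?thesis by auto
qed

text \<open>The idempotents at which \<open>h\<close> is 1 form a compact semilattice that contains
  the unit.\<close>

lemma character_support_minimum:
  assumes E: "compactin (topo S) (idempotents S)" and h: "h \<in> characters S"
  shows "\<exists>m\<in>idempotents S. h m = 1 \<and> (\<forall>e\<in>idempotents S. h e = 1 \<longrightarrow> m \<otimes> e = m)"
proof -
  let ?F = "idempotents S \<inter> {x \<in> topspace (topo S). h x \<in> {1}}"
  have "closedin (topo S) {x \<in> topspace (topo S). h x \<in> {1}}"
    by (rule closedin_continuous_map_preimage[OF characterD(5)[OF h]]) simp
  then have "compactin (topo S) ?F"
    by (intro compact_Int_closedin E)
  moreover have "\<one> \<in> ?F"
    using one_idem characterD(2)[OF h] by (simp add: topspace_eq)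
  moreover have "e \<otimes> f \<in> ?F" if "e \<in> ?F" "f \<in> ?F" for e f
    using that idem_mult characterD(4)[OF h] by (auto simp: topspace_eq)
  ultimately have "\<exists>m\<in>?F. \<forall>f\<in>?F. m \<otimes> f = m"
    by (intro compact_semilattice_has_minimum) auto
  then show ?thesis
    by (auto simp: topspace_eq idemD)
qed

text \<open>On the support of \<open>h\<close>, multiplication by \<open>m\<close> changes neither
  value and moves every point into the single group at \<open>m\<close>; off the support,
  \<open>dom\<close> decides.\<close>

lemma character_eqI:
  assumes h: "h \<in> characters S" and f: "f \<in> characters S"
    and E: "\<And>e. e \<in> idempotents S \<Longrightarrow> f e = h e"
    and m: "m \<in> idempotents S" "h m = 1" "\<And>e. e \<in> idempotents S \<Longrightarrow> h e = 1 \<Longrightarrow> m \<otimes> e = m"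
    and H: "\<And>x. x \<in> maximal_group S m \<Longrightarrow> f x = h x"
  shows "f = h"
proof (rule extensionalityI[OF characterD(1)[OF f] characterD(1)[OF h]])
  fix x assume x: "x \<in> carrier S"
  show "f x = h x"
  proof (cases "h x = 0")
    case True
    then have "f (dom x) = 0"
      using E[OF dom_idem[OF x]] character_dom[OF h x] by simp
    then show ?thesis
      using True character_dom[OF f x] by (auto split: if_splits)
  next
    case False
    then have "h (dom x) = 1"
      using character_dom[OF h x] by simp
    then have "x \<otimes> m \<in> maximal_group S m"
      using m(3)[OF dom_idem[OF x]] by (intro mult_in_maximal_group x m(1))
    then have "f (x \<otimes> m) = h (x \<otimes> m)"
      by (rule H)
    then show ?thesis
      using characterD(4)[OF f x idemD(1)[OF m(1)]] characterD(4)[OF h x idemD(1)[OF m(1)]] E[OF m(1)] m(2)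
      by simp
  qed
qed

text \<open>If w is the quotient of the two values at x, then w^n is their quotient at m x^n, a
  point of the same group. So all powers of w stay within distance 1 of 1.\<close>

lemma characters_agree_on_maximal_group:
  assumes h: "h \<in> characters S" and f: "f \<in> characters S" and m: "m \<in> idempotents S" "h m = 1" "f m = 1"
    and near: "\<And>x. x \<in> maximal_group S m \<Longrightarrow> cmod (f x - h x) < 1"
    and x: "x \<in> maximal_group S m"
  shows "f x = h x"
proof -
  have H: "z \<in> carrier S" "dom z = m" "cmod (g z) = 1"
    if "z \<in> maximal_group S m" "g \<in> characters S" "g m = 1" for z g
    using that character_dom[of g z] characterD(3)[of g z] by (auto simp: maximal_group_eq split: if_splits)
  define w where "w = f x * cnj (h x)"
  have hx: "cmod (h x) = 1" "h x * cnj (h x) = 1"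
    using H(3)[OF x h m(2)] complex_norm_square[of "h x"] by auto
  have w1: "cmod w = 1"
    unfolding w_def using H(3)[OF x h m(2)] H(3)[OF x f m(3)] by (simp add: norm_mult)
  have "cmod (w ^ n - 1) < 1" for n
  proof -
    \<comment> \<open>The factor \<open>m\<close> matters for n = 0, where x^0 is the unit of
      \<open>S\<close> rather than that of the group.\<close>
    define z where "z = m \<otimes> x [^] n"
    have xc: "x \<in> carrier S" by (rule H(1)[OF x h m(2)])
    have pw: "g (x [^] n) = g x ^ n" if "g \<in> characters S" for g
      using characterD(2,4)[OF that] xc by (induction n) auto
    have "m \<otimes> dom (x [^] n) = m"
    proof (induction n)
      case 0 then show ?case using dom_of_idem[OF one_idem] idemD(1)[OF m(1)] by simp
    next
      case (Suc n)
      then show ?case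
        using xc H(2)[OF x h m(2)] idemD[OF m(1)] by (simp add: dom_mult m_assoc[symmetric])
    qed
    then have zH: "z \<in> maximal_group S m"
      unfolding z_def using mult_in_maximal_group[of "x [^] n" m] xc m(1) idemD(1)[OF m(1)] by (simp add: m_comm)
    have gz: "g z = g x ^ n" if "g \<in> characters S" "g m = 1" for g
      unfolding z_def using characterD(4)[OF that(1)] pw[OF that(1)] that(2) idemD(1)[OF m(1)] xc by simp
    have "cmod (w ^ n - 1) = cmod ((f z - h z) * cnj (h z))"
    proof -
      have "(f z - h z) * cnj (h z) = w ^ n - (h x * cnj (h x)) ^ n"
        using gz[OF f m(3)] gz[OF h m(2)] by (simp add: w_def power_mult_distrib algebra_simps)
      then show ?thesis using hx(2) by simp
    qed
    also have "\<dots> = cmod (f z - h z)"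
      using H(3)[OF zH h m(2)] by (simp add: norm_mult)
    finally show ?thesis using near[OF zH] by simp
  qed
  then have "w = 1"
    by (rule no_small_subgroups[OF w1])
  then have "f x * (h x * cnj (h x)) = h x"
    unfolding w_def by (simp add: mult.left_commute)
  then show ?thesis using hx(2) by simp
qed

lemma dual_discrete:
  assumes E: "compactin (topo S) (idempotents S)"
    and H: "\<And>e. e \<in> idempotents S \<Longrightarrow> compactin (topo S) (maximal_group S e)"
  shows "topo (dual_monoid S) = discrete_topology (characters S)"
proof -
  let ?X = "topo S" and ?Y = "topo T_dot" and ?D = "characters S"
  let ?T = "{z. cmod z \<in> {0, 1}}"
  let ?CO = "compact_open_topology ?X ?Y ?D"
  have "openin ?CO {h}" if h: "h \<in> ?D" for h
  proof -
    obtain m where m: "m \<in> idempotents S" "h m = 1" "\<And>e. e \<in> idempotents S \<Longrightarrow> h e = 1 \<Longrightarrow> m \<otimes> e = m"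
      using character_support_minimum[OF E h] by blast
    have comp: "compactin ?X (K \<inter> {x \<in> topspace ?X. h x \<in> C})" if "compactin ?X K" "closed C" for K C
      by (intro compact_Int_closedin that closedin_continuous_map_preimage[OF characterD(5)[OF h]])
        (use that in simp)
    define N1 where "N1 = {f \<in> ?D. f ` (idempotents S \<inter> {x \<in> topspace ?X. h x \<in> {1}}) \<subseteq> ?T \<inter> - cball 0 (1/2)}"
    define N0 where "N0 = {f \<in> ?D. f ` (idempotents S \<inter> {x \<in> topspace ?X. h x \<in> {0}}) \<subseteq> ?T \<inter> ball 0 (1/2)}"
    \<comment> \<open>Closed discs of radius 1/3 keep the sets on which \<open>h\<close> is near t
      compact. The larger radius 1/2 admits \<open>h\<close> itself, and 1/3 + 1/2 < 1 is close
      enough for \<open>characters_agree_on_maximal_group\<close>. The sets \<open>N1\<close> and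
      \<open>N0\<close> fix the values on idempotents.\<close>
    define N where "N = (\<lambda>t. {f \<in> ?D. f ` (maximal_group S m \<inter> {x \<in> topspace ?X. h x \<in> cball t (1/3)}) \<subseteq> ?T \<inter> ball t (1/2)})"
    have "sphere (0::complex) 1 \<subseteq> (\<Union>t\<in>sphere 0 1. ball t (1/3))"
      by force
    then obtain A where A: "A \<subseteq> sphere (0::complex) 1" "finite A" "sphere 0 1 \<subseteq> (\<Union>t\<in>A. ball t (1/3))"
      using compactE_image[OF compact_sphere, of "sphere (0::complex) 1" "\<lambda>t. ball t (1/3)" 0 1] open_ball by metis
    have N1: "openin ?CO N1"
      unfolding N1_def by (rule openin_compact_open_subbase[OF comp[OF E] openin_T_dot]) (auto intro: open_Compl)
    have N0: "openin ?CO N0"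
      unfolding N0_def by (rule openin_compact_open_subbase[OF comp[OF E] openin_T_dot]) auto
    have N: "openin ?CO (N t)" for t
      unfolding N_def by (rule openin_compact_open_subbase[OF comp[OF H[OF m(1)]] openin_T_dot]) auto
    have "openin ?CO ?D"
      using openin_topspace[of ?CO] by simp
    then have "openin ?CO (\<Inter>(insert ?D (N ` A)))"
      using N A(2) by (intro openin_Inter) auto
    then have op: "openin ?CO (N1 \<inter> N0 \<inter> \<Inter>(insert ?D (N ` A)))"
      by (intro openin_Int N1 N0)
    have idemX: "e \<in> topspace ?X" if "e \<in> idempotents S" for e
      using idemD(1)[OF that] by (simp add: topspace_eq)
    have "N1 \<inter> N0 \<inter> \<Inter>(insert ?D (N ` A)) = {h}"
    proof (rule equalityI)
      have "cmod (h x) \<in> {0, 1}" if "x \<in> topspace ?X" for x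
        using characterD(3)[OF h] that by (auto simp: topspace_eq)
      moreover have "cball t (1/3) \<subseteq> ball t (1/2)" for t :: complex
        by (rule cball_subset_ball_iff[THEN iffD2]) simp
      ultimately show "{h} \<subseteq> N1 \<inter> N0 \<inter> \<Inter>(insert ?D (N ` A))"
        using h unfolding N1_def N0_def N_def by (auto simp: dist_norm)
    next
      show "N1 \<inter> N0 \<inter> \<Inter>(insert ?D (N ` A)) \<subseteq> {h}"
      proof
        fix f assume f: "f \<in> N1 \<inter> N0 \<inter> \<Inter>(insert ?D (N ` A))"
        have fD: "f \<in> ?D" using f by auto
        have fE: "f e = h e" if e: "e \<in> idempotents S" for e
        proof (cases "h e = 1")
          case True
          then have "f e \<in> ?T \<inter> - cball 0 (1/2)"
            using f e idemX[OF e] unfolding N1_def by blast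
          then have "f e \<noteq> 0" by auto
          then show ?thesis using True character_idem[OF fD e] by simp
        next
          case False
          then have he: "h e = 0" using character_idem[OF h e] by simp
          then have "f e \<in> ?T \<inter> ball 0 (1/2)"
            using f e idemX[OF e] unfolding N0_def by blast
          then have "f e \<noteq> 1" by auto
          then show ?thesis using he character_idem[OF fD e] by simp
        qed
        have "f x = h x" if x: "x \<in> maximal_group S m" for x
        proof (rule characters_agree_on_maximal_group[OF h fD m(1,2) _ _ x])
          show "f m = 1" using fE[OF m(1)] m(2) by simp
          fix z assume z: "z \<in> maximal_group S m"
          then have zc: "z \<in> carrier S" "dom z = m" by (auto simp: maximal_group_eq)
          then have "h z \<noteq> 0"
            using character_dom[OF h zc(1)] m(2) by auto
          then have "h z \<in> sphere 0 1"
            using characterD(3)[OF h zc(1)] by auto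
          then obtain t where t: "t \<in> A" "h z \<in> ball t (1/3)"
            using A(3) by blast
          have "f \<in> N t" using f t(1) by auto
          moreover have "z \<in> maximal_group S m \<inter> {x \<in> topspace ?X. h x \<in> cball t (1/3)}"
            using z zc(1) t(2) by (simp add: topspace_eq)
          ultimately have "f z \<in> ball t (1/2)"
            unfolding N_def by blast
          then show "cmod (f z - h z) < 1"
            using t(2) dist_triangle_less_add[of "f z" t "1/2" "h z" "1/2"] by (simp add: dist_norm norm_minus_commute)
        qed
        then have "f = h"
          by (intro character_eqI[OF h fD fE m]) auto
        then show "f \<in> {h}" by simp
      qed
    qed
    with op show ?thesis by simp
  qed
  then have "discrete_topology ?D = ?CO"
    by (subst discrete_topology_unique) simp
  then show ?thesis
    by (simp add: dual_monoid_def)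
qed

section \<open>The dual as a commutative monoid, and duals of discrete monoids\<close>

lemma carrier_dual: "carrier (dual_monoid S) = characters S"
  and one_dual: "\<one>\<^bsub>dual_monoid S\<^esub> = (\<lambda>x\<in>carrier S. 1)"
  and mult_dual: "h \<otimes>\<^bsub>dual_monoid S\<^esub> f = (\<lambda>x\<in>carrier S. h x * f x)"
  and topspace_dual: "topspace (topo (dual_monoid S)) = characters S"
  by (simp_all add: dual_monoid_def T_dot_def)

lemma dual_comm_monoid: "comm_monoid (dual_monoid S)"
proof (rule comm_monoidI)
  fix h f assume "h \<in> carrier (dual_monoid S)" "f \<in> carrier (dual_monoid S)"
  then have h: "h \<in> characters S" and f: "f \<in> characters S" by (auto simp: carrier_dual)
  have abs1: "h x * f x = 0 \<or> cmod (h x * f x) = 1" if "x \<in> carrier S" for x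
    using characterD(3)[OF h that] characterD(3)[OF f that] by (auto simp: norm_mult)
  have "continuous_map (topo S) euclidean (\<lambda>x. h x * f x)"
    by (rule continuous_map_binop[OF characterD(5)[OF h] characterD(5)[OF f]]) (intro continuous_intros)
  then have "continuous_map (topo S) euclidean (\<lambda>x\<in>carrier S. h x * f x)"
    by (rule continuous_map_eq) (simp add: topspace_eq)
  then show "h \<otimes>\<^bsub>dual_monoid S\<^esub> f \<in> carrier (dual_monoid S)"
    unfolding carrier_dual mult_dual character_iff
    using characterD(2,4)[OF h] characterD(2,4)[OF f] abs1 by auto
next
  show "\<one>\<^bsub>dual_monoid S\<^esub> \<in> carrier (dual_monoid S)"
    unfolding carrier_dual one_dual character_iff
    using continuous_map_eq[of "topo S" euclidean "\<lambda>x. 1::complex" "\<lambda>x\<in>carrier S. 1"] by (auto simp: topspace_eq)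
next
  fix h assume "h \<in> carrier (dual_monoid S)"
  then have "h \<in> extensional (carrier S)" using characterD(1) by (simp add: carrier_dual)
  then show "\<one>\<^bsub>dual_monoid S\<^esub> \<otimes>\<^bsub>dual_monoid S\<^esub> h = h"
    by (auto simp: mult_dual one_dual extensional_def fun_eq_iff)
qed (auto simp: mult_dual mult_ac)

end

text \<open>Compact subsets of a discrete space are finite, so the compact-open topology is that of
  pointwise convergence.\<close>

lemma continuous_into_dual_of_discrete:
  assumes S: "Group.monoid S" and discrete: "topo S = discrete_topology (carrier S)"
    and d: "\<And>z. z \<in> topspace Z \<Longrightarrow> d z \<in> characters S"
    and cont: "\<And>x. x \<in> carrier S \<Longrightarrow> continuous_map Z euclidean (\<lambda>z. d z x)"
  shows "continuous_map Z (topo (dual_monoid S)) d"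
  unfolding dual_monoid_def compact_open_topology_def top_monoid.simps
proof (rule continuous_on_generated_topo)
  let ?T = "{z. cmod z \<in> {0, 1}}"
  fix W assume "W \<in> {{f \<in> characters S. f ` K \<subseteq> U} |K U. compactin (topo S) K \<and> openin (topo T_dot) U}"
  then obtain K U where W: "W = {f \<in> characters S. f ` K \<subseteq> U}" and K: "compactin (topo S) K"
    and U: "openin (topo T_dot) U"
    by blast
  have K': "K \<subseteq> carrier S" "finite K"
    using K unfolding discrete by (auto simp: compactin_discrete_topology)
  obtain V where V: "open V" "U = ?T \<inter> V"
    using U by (auto simp: T_dot_def openin_open)
  have "openin Z (\<Inter>(insert (topspace Z) ((\<lambda>x. {z \<in> topspace Z. d z x \<in> V}) ` K)))"
  proof (rule openin_Inter)
    fix C assume "C \<in> insert (topspace Z) ((\<lambda>x. {z \<in> topspace Z. d z x \<in> V}) ` K)"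
    moreover have "openin Z {z \<in> topspace Z. d z x \<in> V}" if "x \<in> K" for x
      using V(1) K'(1) that by (intro openin_continuous_map_preimage[OF cont]) auto
    ultimately show "openin Z C"
      using openin_topspace[of Z] by blast
  qed (use K'(2) in auto)
  moreover have "d z \<in> W \<longleftrightarrow> (\<forall>x\<in>K. d z x \<in> V)" if "z \<in> topspace Z" for z
  proof -
    have "d z x \<in> ?T" if "x \<in> K" for x
      using d[OF \<open>z \<in> topspace Z\<close>] K'(1) that characters_iff[OF S, of "d z"] discrete by auto
    then show ?thesis
      using d[OF that] by (auto simp: W V(2))
  qed
  then have "d -` W \<inter> topspace Z = \<Inter>(insert (topspace Z) ((\<lambda>x. {z \<in> topspace Z. d z x \<in> V}) ` K))"
    by auto
  ultimately show "openin Z (d -` W \<inter> topspace Z)" by simp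
next
  have "characters S \<in> {{f \<in> characters S. f ` K \<subseteq> U} |K U. compactin (topo S) K \<and> openin (topo T_dot) U}"
    by (intro CollectI exI[of _ "{}"]) auto
  then show "d ` topspace Z \<subseteq> \<Union>{{f \<in> characters S. f ` K \<subseteq> U} |K U. compactin (topo S) K \<and> openin (topo T_dot) U}"
    using d by auto
qed

text \<open>On a discrete monoid every function is continuous, so the characters are cut out of the
  product by the algebraic identities alone. Each identity involves finitely many coordinates and is
  a closed condition.\<close>

lemma compact_dual_of_discrete:
  assumes S: "Group.monoid S" and discrete: "topo S = discrete_topology (carrier S)"
  shows "compact_space (topo (dual_monoid S))"
proof -
  interpret Group.monoid S by fact
  let ?I = "carrier S"
  let ?T = "{z. cmod z \<in> {0, 1}}"
  let ?P = "product_topology (\<lambda>_. euclidean) ?I :: ('a \<Rightarrow> complex) topology"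
  have "?T = sphere 0 1 \<union> {0}"
    by auto
  then have "compact ?T"
    by (simp add: compact_Un)
  then have comp: "compactin ?P (PiE ?I (\<lambda>_. ?T))"
    by (simp add: compactin_PiE)
  have proj: "continuous_map ?P euclidean (\<lambda>h. h x)" if "x \<in> ?I" for x
    by (rule continuous_map_product_projection[OF that])
  define \<C> where "\<C> = insert {h \<in> topspace ?P. h \<one>\<^bsub>S\<^esub> = 1}
    ((\<lambda>(x, y). {h \<in> topspace ?P. h (x \<otimes>\<^bsub>S\<^esub> y) = h x * h y}) ` (?I \<times> ?I))"
  have "closedin ?P C" if "C \<in> \<C>" for C
  proof -
    have "closedin ?P {h \<in> topspace ?P. h \<one>\<^bsub>S\<^esub> = 1}"
      by (intro closedin_continuous_maps_eq[of euclidean] proj one_closed) auto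
    moreover have "closedin ?P {h \<in> topspace ?P. h (x \<otimes>\<^bsub>S\<^esub> y) = h x * h y}" if "x \<in> ?I" "y \<in> ?I" for x y
    proof (rule closedin_continuous_maps_eq[of euclidean])
      show "continuous_map ?P euclidean (\<lambda>h. h x * h y)"
        by (rule continuous_map_binop[OF proj[OF that(1)] proj[OF that(2)]]) (intro continuous_intros)
    qed (use that proj in auto)
    ultimately show ?thesis using that unfolding \<C>_def by auto
  qed
  then have "closedin ?P (\<Inter>\<C>)"
    by (intro closedin_Inter) (auto simp: \<C>_def)
  then have "compactin ?P (PiE ?I (\<lambda>_. ?T) \<inter> \<Inter>\<C>)"
    by (intro compact_Int_closedin comp)
  moreover have "PiE ?I (\<lambda>_. ?T) \<inter> \<Inter>\<C> = characters S"
  proof -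
    have "continuous_map (topo S) euclidean h" for h :: "'a \<Rightarrow> complex"
      unfolding discrete by simp
    moreover have "topspace (topo S) = ?I" unfolding discrete by simp
    ultimately show ?thesis
      unfolding set_eq_iff Int_iff characters_iff[OF S \<open>topspace (topo S) = ?I\<close>]
      by (auto simp: \<C>_def PiE_iff)
  qed
  ultimately have compD: "compactin ?P (characters S)" by simp
  have "continuous_map (subtopology ?P (characters S)) (topo (dual_monoid S)) (\<lambda>h. h)"
    by (intro continuous_into_dual_of_discrete[OF S discrete] continuous_map_from_subtopology proj) auto
  moreover have "compactin (subtopology ?P (characters S)) (characters S)"
    using compD by (simp add: compactin_subtopology)
  ultimately have "compactin (topo (dual_monoid S)) ((\<lambda>h. h) ` characters S)"
    by (rule image_compactin[rotated])
  then show ?thesis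
    by (simp add: compact_space_def dual_monoid_def)
qed

section \<open>Characters separate points\<close>

context abelian_topological_inverse_monoid
begin

lemma topspace_idempotents: "topspace (subtopology (topo S) (idempotents S)) = idempotents S"
  using idemD(1) by (auto simp: topspace_eq)

text \<open>The syntactic congruence of a clopen set \<open>V\<close>,
  \<open>f \<sim> g \<longleftrightarrow> (\<forall>s. s f \<in> V \<longleftrightarrow> s g \<in> V)\<close>, has clopen classes by compactness;
  \<open>F\<close> consists of the \<open>f\<close> with \<open>f e \<sim> e\<close>.\<close>

lemma open_principal_filter_near:
  assumes comp: "compact_space (subtopology (topo S) (idempotents S))"
    and zero: "zero_dimensional_space (subtopology (topo S) (idempotents S))"
    and e: "e \<in> idempotents S" and U: "openin (topo S) U" "e \<in> U"
  shows "\<exists>m\<in>idempotents S. m \<in> U \<and> m \<otimes> e = m \<and>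
    openin (subtopology (topo S) (idempotents S)) {f \<in> idempotents S. m \<otimes> f = m}"
proof -
  let ?E = "idempotents S"
  define Y where "Y = subtopology (topo S) ?E"
  have topY: "topspace Y = ?E" unfolding Y_def by (rule topspace_idempotents)
  have "openin Y (U \<inter> ?E)"
    unfolding Y_def using U(1) by (auto simp: openin_subtopology)
  then obtain V where V: "openin Y V" "closedin Y V" "e \<in> V" "V \<subseteq> U \<inter> ?E"
    using zero e U(2) unfolding zero_dimensional_space_def Y_def by blast
  define F where "F = {f \<in> ?E. \<forall>s\<in>?E. s \<otimes> f \<otimes> e \<in> V \<longleftrightarrow> s \<otimes> e \<in> V}"
  have mult_Y: "continuous_map Z Y (\<lambda>z. a z \<otimes> b z)" if "continuous_map Z Y a" "continuous_map Z Y b" for Z :: "'z topology" and a b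
  proof -
    have "continuous_map Z (topo S) a" "continuous_map Z (topo S) b" "a \<in> topspace Z \<rightarrow> ?E" "b \<in> topspace Z \<rightarrow> ?E"
      using that unfolding Y_def continuous_map_in_subtopology by auto
    then show ?thesis
      unfolding Y_def continuous_map_in_subtopology using idem_mult by (auto intro: continuous_mult')
  qed
  have const: "continuous_map Z Y (\<lambda>_. c)" if "c \<in> ?E" for Z :: "'z topology" and c
    using that topY by simp
  have clopen: "openin Z {z \<in> topspace Z. a z \<in> V \<longleftrightarrow> b z \<in> V} \<and> closedin Z {z \<in> topspace Z. a z \<in> V \<longleftrightarrow> b z \<in> V}"
    if "continuous_map Z Y a" "continuous_map Z Y b" for Z :: "'z topology" and a b
  proof -
    let ?A = "{z \<in> topspace Z. a z \<in> V}" and ?B = "{z \<in> topspace Z. b z \<in> V}"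
    have o: "openin Z ?A" "closedin Z ?A" "openin Z ?B" "closedin Z ?B"
      using that V by (auto intro: openin_continuous_map_preimage closedin_continuous_map_preimage)
    have eq: "{z \<in> topspace Z. a z \<in> V \<longleftrightarrow> b z \<in> V} = (?A \<inter> ?B) \<union> (topspace Z - (?A \<union> ?B))"
      by auto
    show ?thesis
      unfolding eq using o by (intro conjI openin_Un closedin_Un openin_Int closedin_Int openin_diff closedin_diff) auto
  qed
  have FE: "F \<subseteq> ?E" unfolding F_def by blast
  have "closedin Y F"
  proof -
    have "closedin Y {f \<in> topspace Y. s \<otimes> f \<otimes> e \<in> V \<longleftrightarrow> s \<otimes> e \<in> V}" if "s \<in> ?E" for s
      by (intro clopen[THEN conjunct2] mult_Y const continuous_map_id[unfolded id_def] that e idem_mult)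
    then have "closedin Y (\<Inter>s\<in>?E. {f \<in> topspace Y. s \<otimes> f \<otimes> e \<in> V \<longleftrightarrow> s \<otimes> e \<in> V})"
      using e by (intro closedin_Inter) auto
    moreover have "(\<Inter>s\<in>?E. {f \<in> topspace Y. s \<otimes> f \<otimes> e \<in> V \<longleftrightarrow> s \<otimes> e \<in> V}) = F"
      using e by (auto simp: F_def topY)
    ultimately show ?thesis by simp
  qed
  then have "compactin Y F"
    using comp closedin_compact_space unfolding Y_def by blast
  then have compF: "compactin (topo S) F"
    unfolding Y_def by (simp add: compactin_subtopology)
  have multF: "f \<otimes> g \<in> F" if f: "f \<in> F" and g: "g \<in> F" for f g
  proof -
    have "s \<otimes> (f \<otimes> g) \<otimes> e \<in> V \<longleftrightarrow> s \<otimes> e \<in> V" if s: "s \<in> ?E" for s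
    proof -
      have "s \<otimes> (f \<otimes> g) \<otimes> e = (s \<otimes> g) \<otimes> f \<otimes> e"
        using s f g e FE idemD(1) by (simp add: m_ac subsetD)
      then show ?thesis
        using f g s idem_mult unfolding F_def by auto
    qed
    then show ?thesis
      using f g idem_mult unfolding F_def by auto
  qed
  \<comment> \<open>Membership of f g is tested at s and at s f; the two test products agree because
    f is idempotent.\<close>
  have filterF: "f \<in> F" if f: "f \<in> ?E" and g: "g \<in> ?E" and fg: "f \<otimes> g \<in> F" for f g
  proof -
    have "s \<otimes> f \<otimes> e \<in> V \<longleftrightarrow> s \<otimes> e \<in> V" if s: "s \<in> ?E" for s
    proof -
      have "(s \<otimes> f) \<otimes> (f \<otimes> g) \<otimes> e = s \<otimes> ((f \<otimes> f) \<otimes> g) \<otimes> e"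
        using s f g e idemD(1) by (simp add: m_assoc)
      then have "(s \<otimes> f) \<otimes> (f \<otimes> g) \<otimes> e = s \<otimes> (f \<otimes> g) \<otimes> e"
        using f idemD(2) by simp
      moreover have "(s \<otimes> f) \<otimes> (f \<otimes> g) \<otimes> e \<in> V \<longleftrightarrow> (s \<otimes> f) \<otimes> e \<in> V"
        using fg idem_mult[OF s f] unfolding F_def by blast
      moreover have "s \<otimes> (f \<otimes> g) \<otimes> e \<in> V \<longleftrightarrow> s \<otimes> e \<in> V"
        using fg s unfolding F_def by blast
      ultimately show ?thesis by simp
    qed
    then show ?thesis using f unfolding F_def by blast
  qed
  have eF: "e \<in> F"
    unfolding F_def using e idemD by (auto simp: m_assoc)
  obtain m where m: "m \<in> F" "\<forall>f\<in>F. m \<otimes> f = m"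
    using compact_semilattice_has_minimum[OF compF FE _ multF] eF by blast
  have mE: "m \<in> ?E" using m(1) FE by blast
  \<comment> \<open>Being upward closed and having the least element \<open>m\<close>, the set
    \<open>F\<close> is the principal filter of \<open>m\<close>.\<close>
  have "{f \<in> ?E. m \<otimes> f = m} = F"
  proof (intro equalityI subsetI)
    fix f assume f: "f \<in> {f \<in> ?E. m \<otimes> f = m}"
    then have "f \<otimes> m = m" using m_comm[OF idemD(1)[of f] idemD(1)[OF mE]] by simp
    then have "f \<otimes> m \<in> F" using m(1) by simp
    then show "f \<in> F" using filterF[of f m] f mE by blast
  qed (use m FE in auto)
  \<comment> \<open>The condition that defines \<open>F\<close> is open in the pair (s, f) and holds
    at f0 for all s in the compact semilattice; a tube extends it to all f near f0.\<close>
  moreover have "openin Y F"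
  proof (subst openin_subopen, intro ballI)
    fix f0 assume f0: "f0 \<in> F"
    let ?W = "{p \<in> topspace (prod_topology Y Y). fst p \<otimes> snd p \<otimes> e \<in> V \<longleftrightarrow> fst p \<otimes> e \<in> V}"
    have "openin (prod_topology Y Y) ?W"
      by (intro clopen[THEN conjunct1] mult_Y const continuous_map_fst continuous_map_snd e)
    moreover have "compactin Y ?E"
      using comp topY unfolding Y_def compact_space_def by simp
    moreover have "?E \<times> {f0} \<subseteq> ?W"
      using f0 FE unfolding F_def by (auto simp: topY)
    moreover have "f0 \<in> topspace Y"
      using f0 FE topY by blast
    ultimately obtain A B where AB: "openin Y B" "?E \<subseteq> A" "f0 \<in> B" "A \<times> B \<subseteq> ?W"
      using tube_lemma_left[of Y Y ?W ?E f0] by blast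
    have "B \<subseteq> F"
    proof
      fix f assume f: "f \<in> B"
      have "f \<in> ?E" using f AB(1) openin_subset topY by blast
      moreover have "s \<otimes> f \<otimes> e \<in> V \<longleftrightarrow> s \<otimes> e \<in> V" if "s \<in> ?E" for s
        using AB(2,4) f that by fastforce
      ultimately show "f \<in> F" unfolding F_def by blast
    qed
    with AB show "\<exists>T. openin Y T \<and> f0 \<in> T \<and> T \<subseteq> F" by blast
  qed
  moreover have me: "m \<otimes> e = m" using m(2) eF by blast
  moreover have "m \<in> U"
  proof -
    \<comment> \<open>The test at s = 1 brings \<open>m\<close> itself into
      \<open>V\<close>.\<close>
    have "\<one> \<otimes> m \<otimes> e \<in> V \<longleftrightarrow> \<one> \<otimes> e \<in> V"
      using m(1) one_idem unfolding F_def by blast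
    then have "m \<in> V"
      using me V(3) mE e idemD(1) by simp
    then show ?thesis using V(4) by blast
  qed
  ultimately show ?thesis
    using mE unfolding Y_def by blast
qed

text \<open>Continuity holds because the set where m \<le> dom x is clopen: closed since the space
  is Hausdorff, open since the filter of \<open>m\<close> is. Multiplicativity holds because
  \<open>m\<close> lies below a product of idempotents exactly when it lies below both
  factors.\<close>

lemma extend_group_character:
  assumes m: "m \<in> idempotents S"
    and open_filter: "openin (subtopology (topo S) (idempotents S)) {f \<in> idempotents S. m \<otimes> f = m}"
    and cont: "continuous_map (subtopology (topo S) (maximal_group S m)) euclidean p"
    and norm: "\<And>x. x \<in> maximal_group S m \<Longrightarrow> cmod (p x) = 1"
    and mult: "\<And>x y. x \<in> maximal_group S m \<Longrightarrow> y \<in> maximal_group S m \<Longrightarrow> p (x \<otimes> y) = p x * p y"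
  shows "(\<lambda>x\<in>carrier S. if m \<otimes> dom x = m then p (x \<otimes> m) else 0) \<in> characters S"
proof -
  define c where "c = (\<lambda>x\<in>carrier S. if m \<otimes> dom x = m then p (x \<otimes> m) else 0)"
  have mc: "m \<in> carrier S" by (rule idemD(1)[OF m])
  have H: "x \<otimes> m \<in> maximal_group S m" if "x \<in> carrier S" "m \<otimes> dom x = m" for x
    by (rule mult_in_maximal_group[OF that(1) m that(2)])
  define A where "A = {x \<in> topspace (topo S). m \<otimes> dom x = m}"
  have cm: "continuous_map (topo S) (topo S) (\<lambda>x. x \<otimes> m)"
    by (rule continuous_mult_right[OF mc])
  have clA: "closedin (topo S) A"
    unfolding A_def
    by (intro closedin_continuous_maps_eq[OF Hausdorff] continuous_mult' continuous_dom) (auto simp: topspace_eq mc)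
  have "continuous_map (topo S) (subtopology (topo S) (idempotents S)) dom"
    using continuous_dom dom_idem by (auto simp: continuous_map_in_subtopology topspace_eq)
  from openin_continuous_map_preimage[OF this open_filter]
  have opA: "openin (topo S) A"
    by (rule back_subst[where P = "openin (topo S)"]) (auto simp: A_def topspace_eq dom_idem)
  have "continuous_map (topo S) euclidean c"
    unfolding continuous_map_def
  proof (intro conjI allI impI)
    fix V :: "complex set" assume V: "openin euclidean V"
    have "continuous_map (subtopology (topo S) A) (topo S) (\<lambda>x. x \<otimes> m)"
      by (rule continuous_map_from_subtopology[OF cm])
    then have "continuous_map (subtopology (topo S) A) (subtopology (topo S) (maximal_group S m)) (\<lambda>x. x \<otimes> m)"
      using H by (auto simp: continuous_map_in_subtopology A_def topspace_eq)
    from continuous_map_compose[OF this cont]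
    have "continuous_map (subtopology (topo S) A) euclidean (\<lambda>x. p (x \<otimes> m))"
      by (simp add: o_def)
    from openin_continuous_map_preimage[OF this V]
    have "openin (topo S) {x \<in> topspace (subtopology (topo S) A). p (x \<otimes> m) \<in> V}"
      using opA openin_trans_full by blast
    moreover have "openin (topo S) (if 0 \<in> V then topspace (topo S) - A else {})"
      using clA by auto
    moreover have "{x \<in> topspace (topo S). c x \<in> V}
      = {x \<in> topspace (subtopology (topo S) A). p (x \<otimes> m) \<in> V} \<union> (if 0 \<in> V then topspace (topo S) - A else {})"
      by (auto simp: c_def A_def topspace_eq)
    ultimately show "openin (topo S) {x \<in> topspace (topo S). c x \<in> V}"
      by auto
  qed simp
  moreover have "c \<one> = 1"
  proof -
    have "p (m \<otimes> m) = p m * p m"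
      by (intro mult idem_in_maximal_group m)
    then have "p m = p m * p m"
      using idemD(2)[OF m] by simp
    then have "p m = 1"
      using norm[OF idem_in_maximal_group[OF m]] by auto
    then show ?thesis
      using mc dom_of_idem[OF one_idem] by (simp add: c_def)
  qed
  moreover have "c (x \<otimes> y) = c x * c y" if x: "x \<in> carrier S" and y: "y \<in> carrier S" for x y
  proof -
    have d: "dom x \<in> carrier S" "dom y \<in> carrier S" "dom x \<otimes> dom x = dom x" "dom y \<otimes> dom y = dom y"
      using x y idemD(2)[OF dom_idem] by auto
    show ?thesis
    proof (cases "m \<otimes> dom (x \<otimes> y) = m")
      case True
      then have xy: "m \<otimes> (dom x \<otimes> dom y) = m"
        by (simp add: dom_mult x y)
      have "m \<otimes> dom x = (m \<otimes> (dom x \<otimes> dom y)) \<otimes> dom x"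
        by (simp add: xy)
      also have "\<dots> = m \<otimes> ((dom x \<otimes> dom x) \<otimes> dom y)"
        using d(1,2) mc by (simp add: m_ac)
      finally have mx: "m \<otimes> dom x = m"
        using d(3) xy by simp
      have "m \<otimes> dom y = (m \<otimes> dom x) \<otimes> dom y"
        by (simp add: mx)
      then have my: "m \<otimes> dom y = m"
        using xy d mc by (simp add: m_assoc)
      have "(x \<otimes> y) \<otimes> (m \<otimes> m) = (x \<otimes> m) \<otimes> (y \<otimes> m)"
        using x y mc by (simp add: m_ac)
      then have "p (x \<otimes> y \<otimes> m) = p (x \<otimes> m) * p (y \<otimes> m)"
        using mult[OF H[OF x mx] H[OF y my]] idemD(2)[OF m] by simp
      then show ?thesis
        using True mx my x y by (simp add: c_def)
    next
      case False
      then have "m \<otimes> dom x \<noteq> m \<or> m \<otimes> dom y \<noteq> m"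
        using d mc by (auto simp: dom_mult x y m_assoc[symmetric])
      then show ?thesis
        using False x y by (auto simp: c_def)
    qed
  qed
  moreover have "cmod (c x) \<in> {0, 1}" if "x \<in> carrier S" for x
    using that norm H by (simp add: c_def)
  ultimately have "c \<in> characters S"
    unfolding character_iff by (auto simp: c_def)
  then show ?thesis unfolding c_def .
qed

text \<open>If the domains agree, x z and y z still differ for z near the common domain, so some
  \<open>m\<close> with open filter moves x and y to different points of one compact group. If they
  differ, some such \<open>m\<close> lies below one domain and not below the other, and the
  indicator of m \<le> dom z separates.\<close>

lemma characters_separate_points:
  assumes comp: "compact_space (subtopology (topo S) (idempotents S))"
    and zero: "zero_dimensional_space (subtopology (topo S) (idempotents S))"
    and groups: "\<And>e. e \<in> idempotents S \<Longrightarrow> compact_space (subtopology (topo S) (maximal_group S e))"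
    and x: "x \<in> carrier S" and y: "y \<in> carrier S" and ne: "x \<noteq> y"
  shows "\<exists>h\<in>characters S. h x \<noteq> h y"
proof (cases "dom x = dom y")
  case True
  let ?U = "topspace (topo S) - {z \<in> topspace (topo S). x \<otimes> z = y \<otimes> z}"
  have "closedin (topo S) {z \<in> topspace (topo S). x \<otimes> z = y \<otimes> z}"
    by (intro closedin_continuous_maps_eq[OF Hausdorff] continuous_mult') (auto simp: topspace_eq x y)
  then have U: "openin (topo S) ?U" by blast
  have "dom x \<in> ?U"
    using ne x y dom_mult_self[OF x] dom_mult_self[OF y] True by (auto simp: topspace_eq m_comm)
  from open_principal_filter_near[OF comp zero dom_idem[OF x] U this]
  obtain m where m: "m \<in> idempotents S" "m \<in> ?U" "m \<otimes> dom x = m"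
    and op: "openin (subtopology (topo S) (idempotents S)) {f \<in> idempotents S. m \<otimes> f = m}" by blast
  have mc: "m \<in> carrier S" by (rule idemD(1)[OF m(1)])
  have xm: "x \<otimes> m \<noteq> y \<otimes> m" using m(2) by auto
  define G where "G = \<lparr>carrier = maximal_group S m, mult = (\<otimes>), one = m\<rparr>"
  interpret G: compact_abelian_group G "subtopology (topo S) (maximal_group S m)"
    unfolding G_def by (rule maximal_group_compact_abelian_group[OF m(1) groups[OF m(1)]])
  have H: "x \<otimes> m \<in> carrier G" "y \<otimes> m \<in> carrier G"
    using mult_in_maximal_group[OF x m(1)] mult_in_maximal_group[OF y m(1)] m(3) True by (simp_all add: G_def)
  define b where "b = x \<otimes> m \<otimes>\<^bsub>G\<^esub> inv\<^bsub>G\<^esub> (y \<otimes> m)"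
  have b: "b \<in> carrier G" "b \<otimes>\<^bsub>G\<^esub> (y \<otimes> m) = x \<otimes> m"
    unfolding b_def using H by (simp_all add: G.m_assoc)
  have "b \<noteq> \<one>\<^bsub>G\<^esub>"
    using b(2) xm H(2) by auto
  from G.character_separates[OF b(1) this] obtain p where
    p: "continuous_map (subtopology (topo S) (maximal_group S m)) euclidean p"
      "\<And>z. z \<in> carrier G \<Longrightarrow> cmod (p z) = 1"
      "\<And>z w. z \<in> carrier G \<Longrightarrow> w \<in> carrier G \<Longrightarrow> p (z \<otimes>\<^bsub>G\<^esub> w) = p z * p w" "p b \<noteq> 1"
    by blast
  have "p (x \<otimes> m) = p b * p (y \<otimes> m)"
    using p(3)[OF b(1) H(2)] b(2) by simp
  moreover have "p (y \<otimes> m) \<noteq> 0"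
    using p(2)[OF H(2)] by auto
  ultimately have "p (x \<otimes> m) \<noteq> p (y \<otimes> m)"
    using p(4) by simp
  moreover have "(\<lambda>x\<in>carrier S. if m \<otimes> dom x = m then p (x \<otimes> m) else 0) \<in> characters S"
    by (rule extend_group_character[OF m(1) op p(1)]) (use p(2,3) in \<open>simp_all add: G_def\<close>)
  ultimately show ?thesis
    using m(3) True x y by (intro bexI) auto
next
  case False
  have *: "\<exists>h\<in>characters S. h x \<noteq> h y"
    if x: "x \<in> carrier S" and y: "y \<in> carrier S" and ne: "dom x \<otimes> dom y \<noteq> dom x" for x y
  proof -
    let ?U = "topspace (topo S) - {z \<in> topspace (topo S). z \<otimes> dom y = z}"
    have "closedin (topo S) {z \<in> topspace (topo S). z \<otimes> dom y = z}"
      by (rule closedin_continuous_maps_eq[OF Hausdorff]) (auto simp: y intro!: continuous_mult_right)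
    then have U: "openin (topo S) ?U" by blast
    have "dom x \<in> ?U"
      using ne x by (simp add: topspace_eq)
    from open_principal_filter_near[OF comp zero dom_idem[OF x] U this]
    obtain m where m: "m \<in> idempotents S" "m \<in> ?U" "m \<otimes> dom x = m"
      and op: "openin (subtopology (topo S) (idempotents S)) {f \<in> idempotents S. m \<otimes> f = m}" by blast
    have "(\<lambda>x\<in>carrier S. if m \<otimes> dom x = m then (1::complex) else 0) \<in> characters S"
      by (rule extend_group_character[OF m(1) op, of "\<lambda>_. 1"]) auto
    then show ?thesis
      using m x y by (intro bexI) auto
  qed
  show ?thesis
  proof (cases "dom x \<otimes> dom y = dom x")
    case True
    then have "dom y \<otimes> dom x \<noteq> dom y"
      using False x y by (metis dom_closed m_comm)
    then show ?thesis using *[OF y x] by metis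
  qed (use *[OF x y] in blast)
qed

end

section \<open>Homomorphisms on the dual are evaluations\<close>

lemma sum_power_words:
  fixes f :: "'b \<Rightarrow> 'c::comm_semiring_1"
  assumes "finite B"
  shows "(\<Sum>b\<in>B. f b) ^ n = (\<Sum>w | set w \<subseteq> B \<and> length w = n. prod_list (map f w))"
proof (induction n)
  case 0
  have "{w. set w \<subseteq> B \<and> length w = 0} = {[]}" by auto
  then show ?case by simp
next
  case (Suc n)
  let ?W = "{w. set w \<subseteq> B \<and> length w = n}"
  have "(\<Sum>w | set w \<subseteq> B \<and> length w = Suc n. prod_list (map f w)) = (\<Sum>(w, b)\<in>?W \<times> B. f b * prod_list (map f w))"
    unfolding lists_length_Suc_eq by (subst sum.reindex) (auto simp: inj_on_def case_prod_unfold o_def)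
  also have "\<dots> = (\<Sum>b\<in>B. f b) * (\<Sum>w\<in>?W. prod_list (map f w))"
    by (simp add: sum.cartesian_product[symmetric] sum_distrib_left sum_distrib_right mult.commute)
  finally show ?case using Suc by simp
qed

lemma prod_list_map_eq_prod_count:
  fixes f :: "'b \<Rightarrow> 'c::comm_monoid_mult"
  assumes "finite B" "set w \<subseteq> B"
  shows "prod_list (map f w) = (\<Prod>b\<in>B. f b ^ count_list w b)"
  using assms(2)
proof (induction w)
  case (Cons a w)
  have "(\<Prod>b\<in>B. f b ^ count_list (a # w) b) = (\<Prod>b\<in>B. (if a = b then f b else 1) * f b ^ count_list w b)"
    by (intro prod.cong) auto
  also have "\<dots> = f a * (\<Prod>b\<in>B. f b ^ count_list w b)"
    using assms(1) Cons.prems by (simp add: prod.distrib prod.delta')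
  finally show ?case using Cons by simp
qed simp

lemma polynomial_less_exponential:
  fixes r k :: real
  assumes "0 < r" "r < k"
  shows "\<exists>n. real (n + 1) ^ d * r ^ n < k ^ n"
proof -
  define q where "q = r / k"
  have q: "0 < q" "q < 1" using assms by (auto simp: q_def)
  have "((\<lambda>n. real (n + 1) ^ d * q ^ n) \<longlongrightarrow> 0) at_top"
    using q by real_asymp
  from order_tendstoD(2)[OF this, of 1] obtain n where "real (n + 1) ^ d * q ^ n < 1"
    by (auto simp: eventually_sequentially)
  then show ?thesis
    using assms by (intro exI[of _ n]) (simp add: q_def power_divide field_simps)
qed

lemma norm_geometric_average_le:
  fixes q :: complex
  assumes "cmod q = 1" "q \<noteq> 1"
  shows "cmod ((\<Sum>j<n. q ^ j) / of_nat n) \<le> 2 / (real n * cmod (1 - q))"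
proof -
  have "cmod (1 - q ^ n) \<le> 2"
    using norm_triangle_ineq4[of 1 "q ^ n"] assms(1) by (simp add: norm_power)
  then have "cmod (1 - q ^ n) / (real n * cmod (1 - q)) \<le> 2 / (real n * cmod (1 - q))"
    by (intro divide_right_mono) auto
  moreover have "cmod ((\<Sum>j<n. q ^ j) / of_nat n) = cmod (1 - q ^ n) / (real n * cmod (1 - q))"
    using assms(2) by (simp add: sum_gp_strict norm_divide norm_mult mult.commute)
  ultimately show ?thesis by simp
qed

context Group.monoid
begin

text \<open>Averaging \<open>x \<mapsto> h0(y)\<inverse>\<^sup>j f(x y\<^sup>j)\<close> over \<open>j < N\<close> keeps the coefficient of \<open>h0\<close> and makes
  that of \<open>h1\<close> tend to 0 if \<open>h1(y) \<noteq> h0(y)\<close>.\<close>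

lemma coefficient_le_sup_norm:
  fixes c :: "('a \<Rightarrow> complex) \<Rightarrow> complex"
  assumes "finite B"
    and V: "V \<subseteq> carrier G" "V \<noteq> {}" "\<And>x y. x \<in> V \<Longrightarrow> y \<in> V \<Longrightarrow> x \<otimes> y \<in> V"
    and mult: "\<And>h x y. h \<in> insert h0 B \<Longrightarrow> x \<in> V \<Longrightarrow> y \<in> V \<Longrightarrow> h (x \<otimes> y) = h x * h y"
    and unit: "\<And>h x. h \<in> insert h0 B \<Longrightarrow> x \<in> V \<Longrightarrow> cmod (h x) = 1"
    and dist: "\<And>h. h \<in> B \<Longrightarrow> \<exists>y\<in>V. h y \<noteq> h0 y"
    and bound: "\<And>x. x \<in> V \<Longrightarrow> cmod (c0 * h0 x + (\<Sum>h\<in>B. c h * h x)) \<le> r"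
  shows "cmod c0 \<le> r"
  using assms(1) mult unit dist bound
proof (induction B arbitrary: c r rule: finite_induct)
  case empty
  obtain x where "x \<in> V" using V(2) by blast
  then show ?case using empty.prems(2)[of h0 x] empty.prems(4)[of x] by (simp add: norm_mult)
next
  case (insert h1 B)
  note mult = insert.prems(1) and unit = insert.prems(2) and bound = insert.prems(4)
  obtain y where y: "y \<in> V" "h1 y \<noteq> h0 y" using insert.prems(3) by blast
  define q where "q = (\<lambda>h. h y / h0 y)"
  have h0y: "h0 y \<noteq> 0" using unit[of h0 y] y(1) by auto
  have q1: "cmod (q h1) = 1" "q h1 \<noteq> 1"
    using unit[of h1 y] unit[of h0 y] y h0y by (auto simp: q_def norm_divide)
  \<comment> \<open>The set \<open>V\<close> need not contain the unit; the factor x keeps the point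
    in \<open>V\<close> also for j = 0.\<close>
  have shift: "x \<otimes> y [^] j \<in> V \<and> h (x \<otimes> y [^] j) = h x * h y ^ j"
    if h: "h \<in> insert h0 (insert h1 B)" and x: "x \<in> V" for h x and j :: nat
  proof (induction j)
    case 0 then show ?case using x V(1) by auto
  next
    case (Suc j)
    have "x \<otimes> y [^] Suc j = (x \<otimes> y [^] j) \<otimes> y"
      using x y(1) V(1) by (simp add: m_assoc subsetD)
    then show ?case using Suc V(3) y(1) mult[OF h, of "x \<otimes> y [^] j" y] by simp
  qed
  \<comment> \<open>Averaging multiplies each coefficient c h by a h, where a h0 = 1, and keeps the
    bound because h0 y is unimodular. Charging the term of h1 to the bound leaves the smaller
    family, to which the induction hypothesis applies with new coefficients and a new bound.\<close>
  have main: "cmod c0 \<le> r + cmod (c h1) * (2 / (real N * cmod (1 - q h1)))" if N: "N > 0" for N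
  proof -
    define a where "a = (\<lambda>h. (\<Sum>j<N. q h ^ j) / of_nat N)"
    have a0: "a h0 = 1" using N h0y by (simp add: a_def q_def)
    show ?thesis
    proof (rule insert.IH[where c = "\<lambda>h. c h * a h"])
      fix x assume x: "x \<in> V"
      have xj: "x \<otimes> y [^] j \<in> V" for j :: nat using shift[OF _ x, of h0 j] by simp
      define f where "f = (\<lambda>x. c0 * h0 x + (\<Sum>h\<in>insert h1 B. c h * h x))"
      have tm: "(1 / h0 y) ^ j * h (x \<otimes> y [^] j) = h x * q h ^ j" if "h \<in> insert h0 (insert h1 B)" for h and j :: nat
        using shift[OF that x, of j] by (simp add: q_def power_divide)
      have "(\<Sum>j<N. (1 / h0 y) ^ j * f (x \<otimes> y [^] j)) / of_nat N
          = c0 * h0 x * a h0 + (\<Sum>h\<in>insert h1 B. c h * h x * a h)"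
      proof -
        have "(1 / h0 y) ^ j * f (x \<otimes> y [^] j) = c0 * h0 x * q h0 ^ j + (\<Sum>h\<in>insert h1 B. c h * h x * q h ^ j)" for j :: nat
        proof -
          have "(1 / h0 y) ^ j * f (x \<otimes> y [^] j) = c0 * ((1 / h0 y) ^ j * h0 (x \<otimes> y [^] j))
            + (\<Sum>h\<in>insert h1 B. c h * ((1 / h0 y) ^ j * h (x \<otimes> y [^] j)))"
            unfolding f_def distrib_left sum_distrib_left by (simp only: mult.left_commute)
          also have "(\<Sum>h\<in>insert h1 B. c h * ((1 / h0 y) ^ j * h (x \<otimes> y [^] j))) = (\<Sum>h\<in>insert h1 B. c h * h x * q h ^ j)"
            by (intro sum.cong refl) (simp only: tm insertI2 mult.assoc)
          finally show ?thesis by (simp only: tm insertI1 mult.assoc)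
        qed
        then have "(\<Sum>j<N. (1 / h0 y) ^ j * f (x \<otimes> y [^] j))
          = c0 * h0 x * (\<Sum>j<N. q h0 ^ j) + (\<Sum>h\<in>insert h1 B. c h * h x * (\<Sum>j<N. q h ^ j))"
          by (simp only: sum.distrib sum_distrib_left sum.swap[of _ "insert h1 B"])
        then show ?thesis
          unfolding a_def by (simp only: add_divide_distrib sum_divide_distrib[where A = "insert h1 B"] times_divide_eq_right)
      qed
      also have "\<dots> = (c0 * h0 x + (\<Sum>h\<in>B. c h * a h * h x)) + c h1 * h1 x * a h1"
        using insert.hyps by (simp add: a0 algebra_simps)
      finally have eq: "c0 * h0 x + (\<Sum>h\<in>B. c h * a h * h x)
        = (\<Sum>j<N. (1 / h0 y) ^ j * f (x \<otimes> y [^] j)) / of_nat N - c h1 * h1 x * a h1"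
        by (simp add: algebra_simps)
      have "cmod (\<Sum>j<N. (1 / h0 y) ^ j * f (x \<otimes> y [^] j)) \<le> (\<Sum>j<N. r)"
      proof (rule sum_norm_le)
        fix j
        show "cmod ((1 / h0 y) ^ j * f (x \<otimes> y [^] j)) \<le> r"
          using bound[OF xj[of j]] unit[of h0 y] y(1) unfolding f_def by (simp add: norm_mult norm_power norm_divide)
      qed
      then have 1: "cmod ((\<Sum>j<N. (1 / h0 y) ^ j * f (x \<otimes> y [^] j)) / of_nat N) \<le> r"
        using N by (simp add: norm_divide divide_le_eq mult.commute)
      have 2: "cmod (c h1 * h1 x * a h1) \<le> cmod (c h1) * (2 / (real N * cmod (1 - q h1)))"
      proof -
        have "cmod (h1 x) = 1" using unit[of h1 x] x by simp
        then have "cmod (c h1 * h1 x * a h1) = cmod (c h1) * cmod (a h1)"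
          by (simp add: norm_mult)
        also have "\<dots> \<le> cmod (c h1) * (2 / (real N * cmod (1 - q h1)))"
          unfolding a_def by (rule mult_left_mono[OF norm_geometric_average_le[OF q1]]) simp
        finally show ?thesis .
      qed
      show "cmod (c0 * h0 x + (\<Sum>h\<in>B. c h * a h * h x)) \<le> r + cmod (c h1) * (2 / (real N * cmod (1 - q h1)))"
        unfolding eq by (rule order_trans[OF norm_triangle_ineq4 add_mono[OF 1 2]])
    qed (use insert.prems(1-3) in auto)
  qed
  show ?case
  proof (rule field_le_epsilon)
    fix e :: real assume e: "e > 0"
    define K where "K = cmod (c h1) * 2 / cmod (1 - q h1)"
    obtain N where N: "real N > K / e" using reals_Archimedean2 by blast
    have K: "K \<ge> 0" by (simp add: K_def)
    then have "N > 0" using N e by (metis divide_nonneg_pos of_nat_0_less_iff order_le_less_trans)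
    then have "K / real N \<le> e"
      using N e by (simp add: field_simps)
    then show "cmod c0 \<le> r + e"
      using main[OF \<open>N > 0\<close>] by (simp add: K_def field_simps)
  qed
qed

text \<open>A Kronecker-type theorem. In \<open>f = \<Sum>b. cnj (t b) b\<close> all phases agree at a common
  approximation, so one has to show \<open>sup |f| = card B\<close>. The power \<open>f ^ n\<close> has \<open>(card B) ^ n\<close> words,
  words giving the same monomial do not cancel, and there are only polynomially many monomials.\<close>

lemma simultaneous_approximation:
  fixes t :: "('a \<Rightarrow> complex) \<Rightarrow> complex"
  assumes B: "finite B" "u \<in> B"
    and V: "V \<subseteq> carrier G" "V \<noteq> {}" "\<And>x y. x \<in> V \<Longrightarrow> y \<in> V \<Longrightarrow> x \<otimes> y \<in> V"
    and mult: "\<And>h x y. h \<in> B \<Longrightarrow> x \<in> V \<Longrightarrow> y \<in> V \<Longrightarrow> h (x \<otimes> y) = h x * h y"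
    and unit: "\<And>h x. h \<in> B \<Longrightarrow> x \<in> V \<Longrightarrow> cmod (h x) = 1"
    and t: "\<And>h. h \<in> B \<Longrightarrow> cmod (t h) = 1"
    and u: "\<And>x. x \<in> V \<Longrightarrow> u x = 1" "t u = 1"
    and consistent: "\<And>w w'. set w \<subseteq> B \<Longrightarrow> set w' \<subseteq> B \<Longrightarrow>
      (\<And>x. x \<in> V \<Longrightarrow> (\<Prod>b\<leftarrow>w. b x) = (\<Prod>b\<leftarrow>w'. b x)) \<Longrightarrow> (\<Prod>b\<leftarrow>w. t b) = (\<Prod>b\<leftarrow>w'. t b)"
    and e: "e > 0"
  shows "\<exists>x\<in>V. \<forall>h\<in>B. cmod (h x - t h) < e"
proof -
  define k where "k = real (card B)"
  have k: "k \<ge> 1"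
    using B by (simp add: k_def Suc_le_eq card_gt_0_iff) auto
  define f where "f = (\<lambda>x. \<Sum>h\<in>B. cnj (t h) * h x)"
  \<comment> \<open>The last estimate needs 4 d < e^2: from |1 + z| \<ge> 2 - d follows |1 - z|^2
    \<le> 4 d for unimodular z. The bound d \<le> 1/2 keeps k - d positive.\<close>
  define d where "d = min (1/2) (e\<^sup>2 / 8)"
  have d: "d > 0" "d \<le> 1/2" "4 * d < e\<^sup>2"
    using e by (auto simp: d_def min_def)
  have "\<exists>x\<in>V. cmod (f x) > k - d"
  proof (rule ccontr)
    assume "\<not> (\<exists>x\<in>V. cmod (f x) > k - d)"
    then have le: "\<And>x. x \<in> V \<Longrightarrow> cmod (f x) \<le> k - d" by force
    \<comment> \<open>The value 0 outside \<open>V\<close> makes two monomials equal as functions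
      exactly when they agree on \<open>V\<close>. So \<open>consistent\<close> applies to words
      with equal monomials, and different monomials differ at a point of \<open>V\<close>.\<close>
    define P :: "('a \<Rightarrow> complex) list \<Rightarrow> 'a \<Rightarrow> complex"
      where "P = (\<lambda>w x. if x \<in> V then \<Prod>b\<leftarrow>w. b x else 0)"
    define T where "T = (\<lambda>w. \<Prod>b\<leftarrow>w. t b)"
    have bound: "k ^ n \<le> real (n + 1) ^ card B * (k - d) ^ n" for n
    proof -
      define W where "W = {w. set w \<subseteq> B \<and> length w = n}"
      have W: "finite W" "real (card W) = k ^ n"
        unfolding W_def k_def using B(1) by (simp_all add: finite_lists_length_eq card_lists_length_eq)
      define C where "C = (\<lambda>g. \<Sum>w | w \<in> W \<and> P w = g. cnj (T w))"
      have PT: "T w = T w'" if "w \<in> W" "w' \<in> W" "P w = P w'" for w w'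
        unfolding T_def
      proof (rule consistent)
        fix x assume "x \<in> V"
        then show "(\<Prod>b\<leftarrow>w. b x) = (\<Prod>b\<leftarrow>w'. b x)"
          using fun_cong[OF that(3), of x] by (simp add: P_def)
      qed (use that in \<open>auto simp: W_def\<close>)
      have T1: "cmod (T w) = 1" if "w \<in> W" for w
      proof -
        have "set w \<subseteq> B" using that by (simp add: W_def)
        then show ?thesis unfolding T_def by (induction w) (auto simp: norm_mult t)
      qed
      have C: "cmod (C g) = real (card {w \<in> W. P w = g})" if g: "g \<in> P ` W" for g
      proof -
        obtain w0 where w0: "w0 \<in> W" "P w0 = g" using g by blast
        have "C g = (\<Sum>w | w \<in> W \<and> P w = g. cnj (T w0))"
          unfolding C_def
        proof (rule sum.cong[OF refl])
          fix w assume "w \<in> {w \<in> W. P w = g}"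
          then show "cnj (T w) = cnj (T w0)"
            using PT[of w w0] w0 by simp
        qed
        then show ?thesis
          using T1[OF w0(1)] by (simp add: norm_mult)
      qed
      have expand: "f x ^ n = (\<Sum>g\<in>P ` W. C g * g x)" if x: "x \<in> V" for x
      proof -
        have "f x ^ n = (\<Sum>w\<in>W. \<Prod>h\<leftarrow>w. cnj (t h) * h x)"
          unfolding f_def W_def by (rule sum_power_words[OF B(1)])
        also have "\<dots> = (\<Sum>w\<in>W. cnj (T w) * P w x)"
        proof (rule sum.cong[OF refl])
          fix w
          have "(\<Prod>h\<leftarrow>w. cnj (t h) * h x) = cnj (\<Prod>h\<leftarrow>w. t h) * (\<Prod>h\<leftarrow>w. h x)"
            by (induction w) (simp_all add: mult_ac)
          then show "(\<Prod>h\<leftarrow>w. cnj (t h) * h x) = cnj (T w) * P w x"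
            using x by (simp add: T_def P_def)
        qed
        also have "\<dots> = (\<Sum>g\<in>P ` W. \<Sum>w | w \<in> W \<and> P w = g. cnj (T w) * P w x)"
          by (rule sum.image_gen[OF W(1)])
        also have "\<dots> = (\<Sum>g\<in>P ` W. C g * g x)"
          unfolding C_def sum_distrib_right by (intro sum.cong refl) auto
        finally show ?thesis .
      qed
      have P_mult: "P w (x \<otimes> y) = P w x * P w y" and P_unit: "cmod (P w x) = 1"
        if w: "w \<in> W" and x: "x \<in> V" and y: "y \<in> V" for w x y
      proof -
        have wB: "set w \<subseteq> B" using w by (simp add: W_def)
        have "(\<Prod>b\<leftarrow>w. b (x \<otimes> y)) = (\<Prod>b\<leftarrow>w. b x) * (\<Prod>b\<leftarrow>w. b y)"
          using wB by (induction w) (auto simp: mult x y mult_ac)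
        then show "P w (x \<otimes> y) = P w x * P w y"
          using x y V(3) by (simp add: P_def)
        have "cmod (\<Prod>b\<leftarrow>w. b x) = 1"
          using wB by (induction w) (auto simp: norm_mult unit x)
        then show "cmod (P w x) = 1" using x by (simp add: P_def)
      qed
      \<comment> \<open>The monomials are again unimodular and multiplicative on \<open>V\<close>,
        so the coefficients of f^n are bounded by its supremum.\<close>
      have coeff: "cmod (C g) \<le> (k - d) ^ n" if g: "g \<in> P ` W" for g
      proof (rule coefficient_le_sup_norm[of "P ` W - {g}" V g "C g" C])
        show "finite (P ` W - {g})" using W(1) by simp
        fix h assume "h \<in> P ` W - {g}"
        then obtain w w' where ww: "w \<in> W" "h = P w" "w' \<in> W" "g = P w'" "h \<noteq> g" using g by blast
        then obtain y where "h y \<noteq> g y" by blast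
        then have "y \<in> V" unfolding ww by (auto simp: P_def split: if_splits)
        then show "\<exists>y\<in>V. h y \<noteq> g y" using \<open>h y \<noteq> g y\<close> by blast
      next
        fix x assume x: "x \<in> V"
        have "C g * g x + (\<Sum>h\<in>P ` W - {g}. C h * h x) = f x ^ n"
          unfolding expand[OF x] using W(1) g by (simp add: sum.remove[of "P ` W" g])
        then show "cmod (C g * g x + (\<Sum>h\<in>P ` W - {g}. C h * h x)) \<le> (k - d) ^ n"
          using le[OF x] by (simp add: norm_power power_mono)
      next
        fix h x y assume "h \<in> insert g (P ` W - {g})" "x \<in> V" "y \<in> V"
        then show "h (x \<otimes> y) = h x * h y" using g P_mult by auto
      next
        fix h x assume "h \<in> insert g (P ` W - {g})" "x \<in> V"
        then show "cmod (h x) = 1" using g P_unit[of _ x x] by auto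
      qed (use V in auto)
      \<comment> \<open>A monomial is determined by its exponents, each of which is at most
        n.\<close>
      have "card (P ` W) \<le> (n + 1) ^ card B"
      proof -
        let ?A = "PiE B (\<lambda>_. {..n})"
        have finA: "finite ?A" using B(1) by (intro finite_PiE) auto
        have "P ` W \<subseteq> (\<lambda>a x. if x \<in> V then \<Prod>b\<in>B. b x ^ a b else 0) ` ?A"
        proof
          fix g assume "g \<in> P ` W"
          then obtain w where w: "w \<in> W" "g = P w" by blast
          then have wB: "set w \<subseteq> B" "length w = n" by (auto simp: W_def)
          have "restrict (count_list w) B \<in> ?A"
            using count_le_length[of w] wB(2) by auto
          moreover have "g = (\<lambda>x. if x \<in> V then \<Prod>b\<in>B. b x ^ restrict (count_list w) B b else 0)"
            unfolding w(2) P_def using prod_list_map_eq_prod_count[OF B(1) wB(1)] by (auto intro!: ext)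
          ultimately show "g \<in> (\<lambda>a x. if x \<in> V then \<Prod>b\<in>B. b x ^ a b else 0) ` ?A"
            by (intro image_eqI[of _ _ "restrict (count_list w) B"])
        qed
        then have "card (P ` W) \<le> card ?A"
          using finA by (rule surj_card_le[rotated])
        also have "\<dots> = (n + 1) ^ card B"
          using B(1) by (simp add: card_PiE)
        finally show ?thesis .
      qed
      then have cardP: "real (card (P ` W)) \<le> real (n + 1) ^ card B"
        by (metis of_nat_le_iff of_nat_power)
      have "k ^ n = (\<Sum>g\<in>P ` W. real (card {w \<in> W. P w = g}))"
        using sum.image_gen[OF W(1), of "\<lambda>_. 1::real" P] W(2) by simp
      also have "\<dots> \<le> (\<Sum>g\<in>P ` W. (k - d) ^ n)"
        using C coeff by (intro sum_mono) metis
      also have "\<dots> = real (card (P ` W)) * (k - d) ^ n" by simp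
      also have "\<dots> \<le> real (n + 1) ^ card B * (k - d) ^ n"
        using cardP k d by (intro mult_right_mono) auto
      finally show ?thesis .
    qed
    have "0 < k - d" "k - d < k" using k d by auto
    from polynomial_less_exponential[OF this] obtain n where "real (n + 1) ^ card B * (k - d) ^ n < k ^ n"
      by blast
    then show False using bound[of n] by linarith
  qed
  then obtain x where x: "x \<in> V" "cmod (f x) > k - d" by blast
  \<comment> \<open>The element u fixes the common phase: its term in f x is exactly 1. The terms
    other than those of u and h contribute at most k - 2, so a nearly maximal |f x| forces 1 and z
    to be nearly aligned.\<close>
  have "cmod (h x - t h) < e" if h: "h \<in> B" for h
  proof (cases "h = u")
    case True
    then show ?thesis using u x(1) e by simp
  next
    case False
    define z where "z = cnj (t h) * h x"
    have z1: "cmod z = 1" unfolding z_def using t[OF h] unit[OF h x(1)] by (simp add: norm_mult)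
    have fx: "f x = (1 + z) + (\<Sum>h\<in>B - {u} - {h}. cnj (t h) * h x)"
      unfolding f_def z_def using B h False u x(1)
      by (simp add: sum.remove[of B u] sum.remove[of "B - {u}" h])
    have "cmod (\<Sum>h\<in>B - {u} - {h}. cnj (t h) * h x) \<le> (\<Sum>h\<in>B - {u} - {h}. 1)"
      by (rule sum_norm_le) (simp add: norm_mult t unit x(1))
    moreover have "(\<Sum>h\<in>B - {u} - {h}. 1) = k - 2"
    proof -
      have "card B = Suc (Suc (card (B - {u} - {h})))"
        using card_Suc_Diff1[OF B] card_Suc_Diff1[of "B - {u}" h] B(1) h False by simp
      then show ?thesis by (simp add: k_def)
    qed
    ultimately have "cmod (f x) \<le> cmod (1 + z) + (k - 2)"
      unfolding fx using norm_triangle_ineq[of "1 + z" "\<Sum>h\<in>B - {u} - {h}. cnj (t h) * h x"] by linarith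
    then have "cmod (1 + z) \<ge> 2 - d" using x(2) by linarith
    then have "(cmod (1 + z))\<^sup>2 \<ge> (2 - d)\<^sup>2" using d by (intro power_mono) auto
    moreover have "(cmod (1 - z))\<^sup>2 + (cmod (1 + z))\<^sup>2 = 4"
    proof -
      have "(Re z)\<^sup>2 + (Im z)\<^sup>2 = 1"
        using z1 cmod_power2[of z] by simp
      then show ?thesis
        unfolding cmod_power2 by (simp add: power2_eq_square algebra_simps)
    qed
    moreover have "(2 - d)\<^sup>2 \<ge> 4 - 4 * d" by (simp add: power2_eq_square algebra_simps)
    ultimately have "(cmod (1 - z))\<^sup>2 < e\<^sup>2" using d(3) by linarith
    then have lt: "cmod (1 - z) < e" using e by (simp add: power2_less_imp_less)
    have "t h * cnj (t h) = 1" using complex_norm_square[of "t h"] t[OF h] by simp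
    then have "t h * (1 - z) = t h - h x"
      unfolding z_def by (simp add: right_diff_distrib mult.assoc[symmetric])
    then have "cmod (h x - t h) = cmod (1 - z)"
      using t[OF h] norm_mult[of "t h" "1 - z"] by (simp add: norm_minus_commute)
    then show ?thesis using lt by simp
  qed
  with x(1) show ?thesis by blast
qed

end

context abelian_topological_inverse_monoid
begin

abbreviation dual_mult (infixl "\<odot>" 70) where
  "h \<odot> f \<equiv> h \<otimes>\<^bsub>dual_monoid S\<^esub> f"

lemma dual_mult_apply: "x \<in> carrier S \<Longrightarrow> (h \<odot> f) x = h x * f x"
  by (simp add: mult_dual)

lemma characters_ext:
  assumes "h \<in> characters S" "f \<in> characters S" "\<And>x. x \<in> carrier S \<Longrightarrow> h x = f x"
  shows "h = f"
  using characterD(1)[OF assms(1)] characterD(1)[OF assms(2)] assms(3) by (rule extensionalityI)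

lemma cnj_character:
  assumes h: "h \<in> characters S"
  shows "(\<lambda>x\<in>carrier S. cnj (h x)) \<in> characters S"
proof -
  have "continuous_map (topo S) euclidean (\<lambda>x. cnj (h x))"
    by (rule continuous_map_unop[OF characterD(5)[OF h]]) (intro continuous_intros)
  then have "continuous_map (topo S) euclidean (\<lambda>x\<in>carrier S. cnj (h x))"
    by (rule continuous_map_eq) (simp add: topspace_eq)
  then show ?thesis
    unfolding character_iff using characterD(2,3,4)[OF h] by auto
qed

text \<open>An idempotent kills the characters on which \<open>p\<close> vanishes; the others
  are units on a common support \<open>V\<close>.\<close>

lemma evaluation_approximates:
  assumes p_one: "p \<one>\<^bsub>dual_monoid S\<^esub> = 1"
    and p_norm: "\<And>h. h \<in> characters S \<Longrightarrow> cmod (p h) \<in> {0, 1}"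
    and p_mult: "\<And>h f. h \<in> characters S \<Longrightarrow> f \<in> characters S \<Longrightarrow> p (h \<odot> f) = p h * p f"
    and F: "finite F" "F \<subseteq> characters S" and e: "e > 0"
  shows "\<exists>x\<in>carrier S. \<forall>h\<in>F. cmod (h x - p h) < e"
proof -
  interpret D: comm_monoid "dual_monoid S" by (rule dual_comm_monoid)
  let ?D = "characters S"
  note D_mult = D.m_closed[unfolded carrier_dual]
  \<comment> \<open>A character times its conjugate is the indicator of its support, an idempotent
    of the dual.\<close>
  define supp where "supp = (\<lambda>h. h \<odot> (\<lambda>x\<in>carrier S. cnj (h x)))"
  have supp: "supp h \<in> ?D" "p h \<noteq> 0 \<Longrightarrow> p (supp h) = 1" "p h = 0 \<Longrightarrow> p (supp h) = 0"
    and supp_apply: "\<And>x. x \<in> carrier S \<Longrightarrow> supp h x = (if h x = 0 then 0 else 1)" if h: "h \<in> ?D" for h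
  proof -
    show sD: "supp h \<in> ?D"
      unfolding supp_def by (intro D_mult h cnj_character)
    show ap: "supp h x = (if h x = 0 then 0 else 1)" if x: "x \<in> carrier S" for x
      using characterD(3)[OF h x] complex_norm_square[of "h x"] x by (auto simp: supp_def dual_mult_apply)
    have "supp h \<odot> h = h"
      by (rule characters_ext[OF D_mult[OF sD h] h]) (simp add: dual_mult_apply ap)
    then have "p h = p (supp h) * p h"
      using p_mult[OF sD h] by simp
    then show "p h \<noteq> 0 \<Longrightarrow> p (supp h) = 1" by simp
    show "p h = 0 \<Longrightarrow> p (supp h) = 0"
      unfolding supp_def using p_mult[OF h cnj_character[OF h]] by simp
  qed
  define F1 where "F1 = {h \<in> F. p h \<noteq> 0}"
  define F0 where "F0 = {h \<in> F. p h = 0}"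
  have F1: "finite F1" "F1 \<subseteq> ?D" "\<And>h. h \<in> F1 \<Longrightarrow> p h \<noteq> 0"
    and F0: "finite F0" "F0 \<subseteq> ?D" "\<And>h. h \<in> F0 \<Longrightarrow> p h = 0"
    using F by (auto simp: F1_def F0_def)
  \<comment> \<open>The product of the supports over \<open>A\<close>; for \<open>A\<close> =
    \<open>F1\<close> it is the indicator of their common support.\<close>
  have "\<exists>g\<in>?D. p g = 1 \<and> (\<forall>x\<in>carrier S. g x = (if \<forall>h\<in>A. h x \<noteq> 0 then 1 else 0))"
    if "finite A" "A \<subseteq> F1" for A
    using that
  proof (induction A rule: finite_induct)
    case empty
    have "\<one>\<^bsub>dual_monoid S\<^esub> \<in> ?D" using D.one_closed carrier_dual by simp
    moreover have "\<one>\<^bsub>dual_monoid S\<^esub> x = 1" if "x \<in> carrier S" for x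
      using that by (simp add: one_dual)
    ultimately show ?case using p_one by (intro bexI[of _ "\<one>\<^bsub>dual_monoid S\<^esub>"]) simp_all
  next
    case (insert h A)
    then obtain g where g: "g \<in> ?D" "p g = 1" "\<forall>x\<in>carrier S. g x = (if \<forall>h\<in>A. h x \<noteq> 0 then 1 else 0)"
      by auto
    have h: "h \<in> ?D" "p h \<noteq> 0" using insert.prems F1 by auto
    show ?case
    proof (intro bexI conjI ballI)
      show "p (supp h \<odot> g) = 1"
        using p_mult[OF supp(1)[OF h(1)] g(1)] supp(2)[OF h] g(2) by simp
      show "supp h \<odot> g \<in> ?D"
        by (intro D_mult supp(1) h g)
      show "(supp h \<odot> g) x = (if \<forall>h\<in>insert h A. h x \<noteq> 0 then 1 else 0)" if "x \<in> carrier S" for x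
        using that g(3) by (simp add: dual_mult_apply supp_apply[OF h(1)])
    qed
  qed
  from this[OF F1(1)] obtain g where g: "g \<in> ?D" "p g = 1"
    and g_apply: "\<And>x. x \<in> carrier S \<Longrightarrow> g x = (if \<forall>h\<in>F1. h x \<noteq> 0 then 1 else 0)"
    by blast
  have one_zero: "\<exists>x\<in>carrier S. g x = 1 \<and> h x = 0" if h: "h \<in> F0" for h
  proof (rule ccontr)
    assume none: "\<not> (\<exists>x\<in>carrier S. g x = 1 \<and> h x = 0)"
    have hD: "h \<in> ?D" using h F0 by blast
    \<comment> \<open>If h had no zero where g is 1, its support would be absorbed by g, and
      applying p would give p g = 0.\<close>
    have "supp h \<odot> g = g"
    proof (rule characters_ext[OF D_mult[OF supp(1)[OF hD] g(1)] g(1)])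
      fix x assume x: "x \<in> carrier S"
      then show "(supp h \<odot> g) x = g x"
        using none g_apply[OF x] by (auto simp: dual_mult_apply supp_apply[OF hD])
    qed
    then have "p g = p (supp h) * p g"
      using p_mult[OF supp(1)[OF hD] g(1)] by simp
    then show False
      using supp(3)[OF hD F0(3)[OF h]] g(2) by simp
  qed
  \<comment> \<open>Multiplying points accumulates the zeros and keeps the value of g equal to
    1.\<close>
  have "\<exists>x\<in>carrier S. g x = 1 \<and> (\<forall>h\<in>A. h x = 0)" if "finite A" "A \<subseteq> F0" for A
    using that
  proof (induction A rule: finite_induct)
    case empty
    show ?case using characterD(2)[OF g(1)] by (intro bexI[of _ \<one>]) auto
  next
    case (insert h A)
    then obtain x where x: "x \<in> carrier S" "g x = 1" "\<forall>h\<in>A. h x = 0" by auto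
    obtain y where y: "y \<in> carrier S" "g y = 1" "h y = 0"
      using one_zero insert.prems by blast
    have "f (x \<otimes> y) = f x * f y" if "f \<in> insert g (insert h A)" for f
    proof -
      have "f \<in> ?D" using that insert.prems F0(2) g(1) by blast
      then show ?thesis using characterD(4) x(1) y(1) by blast
    qed
    then have "\<forall>f\<in>insert g (insert h A). f (x \<otimes> y) = f x * f y" by blast
    then have "g (x \<otimes> y) = 1 \<and> (\<forall>h\<in>insert h A. h (x \<otimes> y) = 0)"
      using x(2,3) y(2,3) by auto
    then show ?case using x(1) y(1) by (intro bexI[of _ "x \<otimes> y"]) simp_all
  qed
  from this[OF F0(1)] obtain z where z: "z \<in> carrier S" "g z = 1" "\<And>h. h \<in> F0 \<Longrightarrow> h z = 0"
    by blast
  define V where "V = {x \<in> carrier S. g x = 1}"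
  \<comment> \<open>Here g takes the role of the phase reference u: it is 1 on \<open>V\<close>, and
    p g = 1.\<close>
  define B where "B = insert g F1"
  have BD: "B \<subseteq> ?D" using F1(2) g(1) by (auto simp: B_def)
  have pB: "cmod (p h) = 1" if "h \<in> B" for h
    using that p_norm[of h] BD F1(3) g(2) by (auto simp: B_def)
  have V: "V \<subseteq> carrier S" "V \<noteq> {}" "\<And>x y. x \<in> V \<Longrightarrow> y \<in> V \<Longrightarrow> x \<otimes> y \<in> V"
    using z characterD(4)[OF g(1)] by (auto simp: V_def)
  have B_unit: "cmod (h x) = 1" if h: "h \<in> B" and x: "x \<in> V" for h x
  proof -
    have "h x \<noteq> 0"
      using h x g_apply[of x] by (auto simp: B_def V_def split: if_splits)
    then show ?thesis
      using characterD(3)[of h x] h x BD V(1) by auto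
  qed
  have "\<exists>x\<in>V. \<forall>h\<in>B. cmod (h x - p h) < e"
  proof (rule simultaneous_approximation[where u = g])
    fix w w' assume w: "set w \<subseteq> B" "set w' \<subseteq> B" and eq: "\<And>x. x \<in> V \<Longrightarrow> (\<Prod>b\<leftarrow>w. b x) = (\<Prod>b\<leftarrow>w'. b x)"
    \<comment> \<open>The factor g makes the product vanish outside \<open>V\<close>, so agreement
      on \<open>V\<close> becomes equality of characters, to which p can be applied; p g = 1 leaves
      the value unchanged.\<close>
    define M where "M = (\<lambda>w. foldr (\<lambda>h f. h \<odot> f) w g)"
    have M: "M w \<in> ?D \<and> p (M w) = (\<Prod>b\<leftarrow>w. p b) \<and> (\<forall>x\<in>carrier S. M w x = (\<Prod>b\<leftarrow>w. b x) * g x)"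
      if "set w \<subseteq> B" for w
      using that
    proof (induction w)
      case Nil
      then show ?case using g by (simp add: M_def)
    next
      case (Cons b w)
      then have b: "b \<in> ?D" using BD by auto
      have M_Cons: "M (b # w) = b \<odot> M w" by (simp add: M_def)
      show ?case
        unfolding M_Cons using Cons D_mult[OF b] p_mult[OF b]
        by (simp add: dual_mult_apply mult.assoc)
    qed
    have "M w = M w'"
    proof (rule characters_ext)
      fix x assume x: "x \<in> carrier S"
      have "g x = 0 \<or> x \<in> V"
        using g_apply[OF x] x by (auto simp: V_def)
      then show "M w x = M w' x"
        using M[OF w(1)] M[OF w(2)] x eq by auto
    qed (use M w in auto)
    then show "(\<Prod>b\<leftarrow>w. p b) = (\<Prod>b\<leftarrow>w'. p b)"
      using M[OF w(1)] M[OF w(2)] by simp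
  next
    show "finite B" "g \<in> B" using F1(1) by (auto simp: B_def)
    fix h x y assume "h \<in> B" "x \<in> V" "y \<in> V"
    then show "h (x \<otimes> y) = h x * h y"
      using characterD(4)[of h x y] BD V(1) by blast
  qed (use V B_unit pB g e in \<open>auto simp: V_def\<close>)
  then obtain x where x: "x \<in> V" "\<forall>h\<in>B. cmod (h x - p h) < e" by blast
  have xc: "x \<in> carrier S" using x(1) V(1) by blast
  show ?thesis
  proof (intro bexI ballI)
    \<comment> \<open>The idempotent \<open>dom z\<close> has value 0 under the members of
      \<open>F0\<close> and value 1 under those of \<open>F1\<close>, so it corrects the zeros
      without disturbing the approximation.\<close>
    show "x \<otimes> dom z \<in> carrier S" using xc z(1) by simp
    fix h assume h: "h \<in> F"
    have hD: "h \<in> ?D" using h F by blast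
    have hx: "h (x \<otimes> dom z) = h x * (if h z = 0 then 0 else 1)"
      using characterD(4)[OF hD xc dom_closed[OF z(1)]] character_dom[OF hD z(1)] by simp
    show "cmod (h (x \<otimes> dom z) - p h) < e"
    proof (cases "p h = 0")
      case True
      then have "h z = 0" using z(3) h by (simp add: F0_def)
      then show ?thesis using hx True e by simp
    next
      case False
      then have hB: "h \<in> B" "h \<in> F1" using h by (auto simp: B_def F1_def)
      then have "h z \<noteq> 0"
        using g_apply[OF z(1)] z(2) by (auto split: if_splits)
      then show ?thesis using hx x(2) hB(1) by simp
    qed
  qed
qed

end

theorem theorem5:
  fixes S :: "'a top_monoid"
  assumes "topological_inverse_monoid S"
    and "comm_monoid S"
    and "compact_space (subtopology (topo S) (idempotents S))"
    and "zero_dimensional_space (subtopology (topo S) (idempotents S))"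
    and "\<And>e. e \<in> idempotents S \<Longrightarrow> compact_space (subtopology (topo S) (maximal_group S e))"
  shows "reflexive_monoid S \<longleftrightarrow> compact_space (topo S)"
proof -
  interpret topological_inverse_monoid S by fact
  interpret comm_monoid S by fact
  interpret abelian_topological_inverse_monoid S ..
  interpret D: comm_monoid "dual_monoid S" by (rule dual_comm_monoid)
  let ?D = "characters S" and ?DD = "characters (dual_monoid S)" and ?d = "canonical_hom S"
  let ?DDX = "topo (dual_monoid (dual_monoid S))"
  have "compactin (topo S) (idempotents S)"
    using assms(3) idemD(1) by (auto simp: compactin_subspace topspace_eq)
  moreover have "compactin (topo S) (maximal_group S e)" if "e \<in> idempotents S" for e
    using assms(5)[OF that] by (auto simp: compactin_subspace topspace_eq maximal_group_eq)
  ultimately have discrete: "topo (dual_monoid S) = discrete_topology ?D"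
    by (rule dual_discrete)
  have comp_dd: "compact_space (topo (dual_monoid (dual_monoid S)))"
    using compact_dual_of_discrete[OF D.monoid_axioms] discrete by (simp add: carrier_dual)
  have topspace_dd: "topspace ?DDX = ?DD"
    by (simp add: dual_monoid_def)
  \<comment> \<open>The dual is discrete, so its characters are all of its homomorphisms and
    continuity imposes no condition.\<close>
  have DD_iff: "p \<in> ?DD \<longleftrightarrow> p \<in> extensional ?D \<and> p \<one>\<^bsub>dual_monoid S\<^esub> = 1 \<and>
      (\<forall>h\<in>?D. cmod (p h) \<in> {0, 1}) \<and>
      (\<forall>h\<in>?D. \<forall>f\<in>?D. p (h \<otimes>\<^bsub>dual_monoid S\<^esub> f) = p h * p f)" for p
    using characters_iff[OF D.monoid_axioms, of p] discrete by (simp add: carrier_dual)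
  have d_apply: "?d x h = h x" if "h \<in> ?D" for x h
    using that by (simp add: canonical_hom_def carrier_dual)
  have d_DD: "?d x \<in> ?DD" if x: "x \<in> carrier S" for x
    unfolding DD_iff using x D.one_closed D.m_closed characterD(3)
    by (auto simp: canonical_hom_def carrier_dual dual_mult_apply one_dual)
  show ?thesis
  proof
    assume "reflexive_monoid S"
    then have "homeomorphic_map (topo S) ?DDX ?d"
      by (simp add: reflexive_monoid_def topological_iso_def)
    then have "topo S homeomorphic_space ?DDX"
      by (rule homeomorphic_map_imp_homeomorphic_space)
    with comp_dd show "compact_space (topo S)"
      using homeomorphic_compact_space by blast
  next
    assume comp: "compact_space (topo S)"
    have cont: "continuous_map (topo S) ?DDX ?d"
    proof (rule continuous_into_dual_of_discrete[OF D.monoid_axioms])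
      show "topo (dual_monoid S) = discrete_topology (carrier (dual_monoid S))"
        by (simp add: discrete carrier_dual)
      show "continuous_map (topo S) euclidean (\<lambda>x. ?d x h)" if "h \<in> carrier (dual_monoid S)" for h
        using that characterD(5) by (simp add: carrier_dual d_apply)
    qed (simp add: d_DD topspace_eq)
    have inj: "inj_on ?d (carrier S)"
    proof (rule inj_onI, rule ccontr)
      fix x y assume xy: "x \<in> carrier S" "y \<in> carrier S" "?d x = ?d y" "x \<noteq> y"
      then obtain h where h: "h \<in> ?D" "h x \<noteq> h y"
        using characters_separate_points[OF assms(3,4,5) xy(1,2,4)] by blast
      then show False
        using d_apply[OF h(1), of x] d_apply[OF h(1), of y] xy(3) by simp
    qed
    have surj: "?d ` carrier S = ?DD"
    proof (intro equalityI subsetI)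
      fix p assume p: "p \<in> ?DD"
      \<comment> \<open>A point common to all these closed sets evaluates to p. For finitely many of
        them, \<open>evaluation_approximates\<close> is applied with the finest tolerance that
        occurs.\<close>
      define C where "C = (\<lambda>(h, n::nat). {x \<in> topspace (topo S). h x \<in> cball (p h) (1 / real (Suc n))})"
      have "closedin (topo S) (C i)" if "i \<in> ?D \<times> UNIV" for i
        using that unfolding C_def
        by (auto intro!: closedin_continuous_map_preimage[OF characterD(5)] simp del: mem_cball)
      moreover have "topspace (topo S) \<inter> \<Inter>\<F> \<noteq> {}" if \<F>: "finite \<F> \<and> \<F> \<subseteq> C ` (?D \<times> UNIV)" for \<F>
      proof -
        obtain I where I: "I \<subseteq> ?D \<times> UNIV" "finite I" "\<F> = C ` I"
          using finite_subset_image[OF conjunct1[OF \<F>] conjunct2[OF \<F>]] by (elim exE conjE)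
        define N where "N = Max (insert 0 (snd ` I))"
        have N: "n \<le> N" if "(h, n) \<in> I" for h n
          unfolding N_def using I(2) that by (intro Max_ge) force+
        obtain x where x: "x \<in> carrier S" "\<forall>h\<in>fst ` I. cmod (h x - p h) < 1 / real (Suc N)"
          using evaluation_approximates[of p "fst ` I" "1 / real (Suc N)"] p I(1,2) unfolding DD_iff by force
        have "x \<in> C i" if "i \<in> I" for i
        proof -
          obtain h n where i: "i = (h, n)" by fastforce
          have "cmod (h x - p h) < 1 / real (Suc N)"
            using x(2) that i by force
          also have "\<dots> \<le> 1 / real (Suc n)"
            using N that i by (intro divide_left_mono) auto
          finally show ?thesis
            using x(1) by (simp add: C_def i topspace_eq dist_norm norm_minus_commute)
        qed
        then show ?thesis
          unfolding I(3) using x(1) by (auto simp: topspace_eq)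
      qed
      ultimately have "topspace (topo S) \<inter> \<Inter>(C ` (?D \<times> UNIV)) \<noteq> {}"
        by (intro comp[unfolded compact_space_def compactin_fip, THEN conjunct2, rule_format]) auto
      then obtain x where x: "x \<in> carrier S" "\<And>i. i \<in> ?D \<times> UNIV \<Longrightarrow> x \<in> C i"
        by (auto simp: topspace_eq)
      have "p h = h x" if h: "h \<in> ?D" for h
      proof (rule ccontr)
        assume "p h \<noteq> h x"
        then obtain n where n: "inverse (real (Suc n)) < cmod (p h - h x)"
          using reals_Archimedean[of "cmod (p h - h x)"] by auto
        moreover have "cmod (p h - h x) \<le> 1 / real (Suc n)"
          using x(2)[of "(h, n)"] h by (simp add: C_def dist_norm)
        ultimately show False by (simp add: inverse_eq_divide)
      qed
      moreover have "p \<in> extensional ?D"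
        using p unfolding DD_iff by blast
      ultimately have "p = ?d x"
        by (intro extensionalityI[of p ?D]) (auto simp: canonical_hom_def carrier_dual)
      then show "p \<in> ?d ` carrier S" using x(1) by blast
    qed (use d_DD in auto)
    \<comment> \<open>Evaluation at h is continuous because a single point is compact. Since
      elements of the double dual are determined by these evaluations, its topology is
      Hausdorff.\<close>
    have "continuous_map ?DDX euclidean (\<lambda>p. p h)" if h: "h \<in> ?D" for h
      unfolding continuous_map_def
    proof (intro conjI allI impI)
      fix U :: "complex set" assume "openin euclidean U"
      then have "openin ?DDX {p \<in> ?DD. p ` {h} \<subseteq> {z. cmod z \<in> {0, 1}} \<inter> U}"
        unfolding dual_monoid_def[of "dual_monoid S"] top_monoid.simps
        by (intro openin_compact_open_subbase openin_T_dot) (simp_all add: discrete h)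
      moreover have "{p \<in> ?DD. p ` {h} \<subseteq> {z. cmod z \<in> {0, 1}} \<inter> U} = {p \<in> topspace ?DDX. p h \<in> U}"
        unfolding topspace_dd using h by (auto simp: DD_iff)
      ultimately show "openin ?DDX {p \<in> topspace ?DDX. p h \<in> U}"
        by simp
    qed simp
    then have "continuous_map ?DDX (product_topology (\<lambda>_. euclidean) ?D) (\<lambda>p. p)"
      by (auto simp: continuous_map_componentwise topspace_dd DD_iff)
    then have "Hausdorff_space ?DDX"
      by (rule Hausdorff_space_injective_preimage[rotated]) (simp_all add: Hausdorff_space_product_topology)
    then have homeo: "homeomorphic_map (topo S) ?DDX ?d"
      using cont comp inj surj by (intro continuous_imp_homeomorphic_map) (simp_all add: topspace_eq topspace_dd)
    have "?d (x \<otimes>\<^bsub>S\<^esub> y) = ?d x \<otimes>\<^bsub>dual_monoid (dual_monoid S)\<^esub> ?d y" if "x \<in> carrier S" "y \<in> carrier S" for x y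
      using that characterD(4)
      by (auto simp: canonical_hom_def dual_monoid_def[of "dual_monoid S"] carrier_dual T_dot_def)
    then have "?d \<in> hom S (dual_monoid (dual_monoid S))"
      using d_DD by (auto simp: hom_def dual_monoid_def[of "dual_monoid S"])
    moreover have "?d \<one>\<^bsub>S\<^esub> = \<one>\<^bsub>dual_monoid (dual_monoid S)\<^esub>"
      using characterD(2)
      by (auto simp: canonical_hom_def dual_monoid_def[of "dual_monoid S"] carrier_dual T_dot_def)
    ultimately show "reflexive_monoid S"
      unfolding reflexive_monoid_def topological_iso_def monoid_hom_def iso_def bij_betw_def
      using homeo inj surj by (simp add: dual_monoid_def[of "dual_monoid S"])
  qed
qed

end
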